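(* Let $N\ge 5$ and $\alpha,l\in\mathbb{R}$, put $N'=N+\alpha$ and $\tau=l-\alpha$, and assume $2N>N'>4$, $\tau>-4$ and $\alpha<\frac{N-4}{4}\tau$. Let $\Omega\subset\mathbb{R}^N$ be a bounded domain of class $C^2$, not a ball, with $0\in\Omega$. Then the embedding $$D^{2,\alpha}_0(\Omega)\hookrightarrow L^q_l(\Omega)$$ is continuous for every $q\in[1,\frac{2N}{N-4}]$ and compact for every $q\in[1,\frac{2N}{N-4})$.
   Context: $D^{2,\alpha}_0(\Omega)$ is the completion of $C_c^\infty(\Omega\setminus\{0\})$ with respect to the norm $\|\phi\|_{2,\alpha}=\left(\int_\Omega|x|^\alpha|\Delta\phi|^2\,dx\right)^{1/2}$. For $q\ge1$, $L^q_l(\Omega)$ is the space of functions $\phi$ with $|x|^{l/q}|\phi|\in L^q(\Omega)$, with norm $\|\phi\|_{L^q_l(\Omega)}=\left(\int_\Omega|x|^l|\phi|^q\,dx\right)^{1/q}$. *)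

theory Defs
  imports "HOL-Analysis.Analysis"
begin

section \<open>Smooth functions and domains of class \<open>C\<^sup>2\<close>\<close>

definition partial_deriv :: "'a::euclidean_space \<Rightarrow> ('a \<Rightarrow> real) \<Rightarrow> 'a \<Rightarrow> real" where
  "partial_deriv b f x = frechet_derivative f (at x) b"

text \<open>Differentiability is required at each stage because \<^const>\<open>frechet_derivative\<close> is an
  unspecified function at points where differentiability fails.\<close>

fun C_k :: "nat \<Rightarrow> ('a::euclidean_space \<Rightarrow> real) \<Rightarrow> bool" where
  "C_k 0 f \<longleftrightarrow> continuous_on UNIV f"
| "C_k (Suc k) f \<longleftrightarrow> f differentiable_on UNIV \<and> (\<forall>b\<in>Basis. C_k k (partial_deriv b f))"

definition laplacian :: "('a::euclidean_space \<Rightarrow> real) \<Rightarrow> 'a \<Rightarrow> real" where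
  "laplacian f x = (\<Sum>b\<in>Basis. partial_deriv b (partial_deriv b f) x)"

text \<open>Elements of \<open>C\<^sub>c\<^sup>\<infinity>(U)\<close> are represented by their extensions by zero.\<close>

definition test_functions :: "'a::euclidean_space set \<Rightarrow> ('a \<Rightarrow> real) set" where
  "test_functions U = {\<phi>. (\<forall>k. C_k k \<phi>) \<and>
     compact (closure {x. \<phi> x \<noteq> 0}) \<and> closure {x. \<phi> x \<noteq> 0} \<subseteq> U}"

text \<open>Near each boundary point, \<open>\<Omega>\<close> is the region strictly above the graph, in the direction of
  the unit vector \<open>\<nu>\<close>, of a \<open>C\<^sup>2\<close> function on the hyperplane orthogonal to \<open>\<nu>\<close>.  Such a function
  is represented by a function on the whole space that is invariant under translation by
  multiples of \<open>\<nu>\<close>.\<close>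

definition C2_boundary :: "'a::euclidean_space set \<Rightarrow> bool" where
  "C2_boundary \<Omega> \<longleftrightarrow> (\<forall>p\<in>frontier \<Omega>. \<exists>r>0. \<exists>\<nu> \<gamma>.
     norm \<nu> = 1 \<and> C_k 2 \<gamma> \<and> (\<forall>x t. \<gamma> (x + t *\<^sub>R \<nu>) = \<gamma> x) \<and>
     \<Omega> \<inter> ball p r = {x \<in> ball p r. x \<bullet> \<nu> > \<gamma> x})"

definition bounded_C2_domain :: "'a::euclidean_space set \<Rightarrow> bool" where
  "bounded_C2_domain \<Omega> \<longleftrightarrow>
     open \<Omega> \<and> connected \<Omega> \<and> \<Omega> \<noteq> {} \<and> bounded \<Omega> \<and> C2_boundary \<Omega>"


section \<open>Completion of a normed space of functions\<close>

text \<open>\<open>V\<close> is a linear space of functions and \<open>p\<close> a norm on it.  The completion consists of the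
  \<open>p\<close>-Cauchy sequences in \<open>V\<close> modulo the sequences converging to zero.\<close>

definition cauchy_seqs :: "('a \<Rightarrow> real) set \<Rightarrow> (('a \<Rightarrow> real) \<Rightarrow> real) \<Rightarrow> (nat \<Rightarrow> 'a \<Rightarrow> real) set" where
  "cauchy_seqs V p = {u. (\<forall>n. u n \<in> V) \<and>
     (\<forall>e>0. \<exists>M. \<forall>m\<ge>M. \<forall>n\<ge>M. p (\<lambda>x. u m x - u n x) < e)}"

definition cauchy_rel ::
  "('a \<Rightarrow> real) set \<Rightarrow> (('a \<Rightarrow> real) \<Rightarrow> real) \<Rightarrow> ((nat \<Rightarrow> 'a \<Rightarrow> real) \<times> (nat \<Rightarrow> 'a \<Rightarrow> real)) set" where
  "cauchy_rel V p = {(u, v). u \<in> cauchy_seqs V p \<and> v \<in> cauchy_seqs V p \<and>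
     (\<lambda>n. p (\<lambda>x. u n x - v n x)) \<longlonglongrightarrow> 0}"

definition completion ::
  "('a \<Rightarrow> real) set \<Rightarrow> (('a \<Rightarrow> real) \<Rightarrow> real) \<Rightarrow> (nat \<Rightarrow> 'a \<Rightarrow> real) set set" where
  "completion V p = cauchy_seqs V p // cauchy_rel V p"

definition compl_of ::
  "('a \<Rightarrow> real) set \<Rightarrow> (('a \<Rightarrow> real) \<Rightarrow> real) \<Rightarrow> ('a \<Rightarrow> real) \<Rightarrow> (nat \<Rightarrow> 'a \<Rightarrow> real) set" where
  "compl_of V p \<phi> = cauchy_rel V p `` {\<lambda>n. \<phi>}"

definition compl_add ::
  "('a \<Rightarrow> real) set \<Rightarrow> (('a \<Rightarrow> real) \<Rightarrow> real) \<Rightarrow>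
    (nat \<Rightarrow> 'a \<Rightarrow> real) set \<Rightarrow> (nat \<Rightarrow> 'a \<Rightarrow> real) set \<Rightarrow> (nat \<Rightarrow> 'a \<Rightarrow> real) set" where
  "compl_add V p X Y = (\<Union>u\<in>X. \<Union>v\<in>Y. cauchy_rel V p `` {\<lambda>n x. u n x + v n x})"

definition compl_scale ::
  "('a \<Rightarrow> real) set \<Rightarrow> (('a \<Rightarrow> real) \<Rightarrow> real) \<Rightarrow>
    real \<Rightarrow> (nat \<Rightarrow> 'a \<Rightarrow> real) set \<Rightarrow> (nat \<Rightarrow> 'a \<Rightarrow> real) set" where
  "compl_scale V p c X = (\<Union>u\<in>X. cauchy_rel V p `` {\<lambda>n x. c * u n x})"

definition compl_norm :: "(('a \<Rightarrow> real) \<Rightarrow> real) \<Rightarrow> (nat \<Rightarrow> 'a \<Rightarrow> real) set \<Rightarrow> real" where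
  "compl_norm p X = (THE r. \<forall>u\<in>X. (\<lambda>n. p (u n)) \<longlonglongrightarrow> r)"


section \<open>The weighted spaces\<close>

definition norm_2 :: "real \<Rightarrow> 'a::euclidean_space set \<Rightarrow> ('a \<Rightarrow> real) \<Rightarrow> real" where
  "norm_2 \<alpha> \<Omega> \<phi> =
     sqrt (integral\<^sup>L (lebesgue_on \<Omega>) (\<lambda>x. norm x powr \<alpha> * (laplacian \<phi> x)\<^sup>2))"

definition D0 :: "real \<Rightarrow> 'a::euclidean_space set \<Rightarrow> (nat \<Rightarrow> 'a \<Rightarrow> real) set set" where
  "D0 \<alpha> \<Omega> = completion (test_functions (\<Omega> - {0})) (norm_2 \<alpha> \<Omega>)"

text \<open>Elements of \<open>L\<^sup>q\<^sub>l(\<Omega>)\<close> are represented by functions, to be identified when they agree almost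
  everywhere on \<open>\<Omega>\<close>; their values outside \<open>\<Omega>\<close> are irrelevant.\<close>

definition Lq_weighted :: "real \<Rightarrow> real \<Rightarrow> 'a::euclidean_space set \<Rightarrow> ('a \<Rightarrow> real) set" where
  "Lq_weighted q l \<Omega> = {f. f \<in> borel_measurable (lebesgue_on \<Omega>) \<and>
     integrable (lebesgue_on \<Omega>) (\<lambda>x. (norm x powr (l / q) * \<bar>f x\<bar>) powr q)}"

definition Lq_norm :: "real \<Rightarrow> real \<Rightarrow> 'a::euclidean_space set \<Rightarrow> ('a \<Rightarrow> real) \<Rightarrow> real" where
  "Lq_norm q l \<Omega> f =
     (integral\<^sup>L (lebesgue_on \<Omega>) (\<lambda>x. norm x powr l * \<bar>f x\<bar> powr q)) powr (1 / q)"


section \<open>Embeddings\<close>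

text \<open>\<open>J\<close> is a bounded injective linear map from the completion into \<open>L\<^sup>q\<^sub>l(\<Omega>)\<close> that extends the
  inclusion of the test functions.  Since these are dense, \<open>J\<close> is unique up to equality almost
  everywhere.\<close>

definition continuous_embedding ::
  "real \<Rightarrow> real \<Rightarrow> real \<Rightarrow> 'a::euclidean_space set \<Rightarrow>
    ((nat \<Rightarrow> 'a \<Rightarrow> real) set \<Rightarrow> 'a \<Rightarrow> real) \<Rightarrow> bool" where
  "continuous_embedding \<alpha> l q \<Omega> J \<longleftrightarrow>
    (let V = test_functions (\<Omega> - {0}); p = norm_2 \<alpha> \<Omega>; D = D0 \<alpha> \<Omega> in
      (\<forall>X\<in>D. J X \<in> Lq_weighted q l \<Omega>) \<and>
      (\<forall>\<phi>\<in>V. AE x in lebesgue_on \<Omega>. J (compl_of V p \<phi>) x = \<phi> x) \<and>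
      (\<forall>X\<in>D. \<forall>Y\<in>D. AE x in lebesgue_on \<Omega>. J (compl_add V p X Y) x = J X x + J Y x) \<and>
      (\<forall>c. \<forall>X\<in>D. AE x in lebesgue_on \<Omega>. J (compl_scale V p c X) x = c * J X x) \<and>
      (\<forall>X\<in>D. \<forall>Y\<in>D. (AE x in lebesgue_on \<Omega>. J X x = J Y x) \<longrightarrow> X = Y) \<and>
      (\<exists>C. \<forall>X\<in>D. Lq_norm q l \<Omega> (J X) \<le> C * compl_norm p X))"

definition compact_map ::
  "real \<Rightarrow> real \<Rightarrow> real \<Rightarrow> 'a::euclidean_space set \<Rightarrow>
    ((nat \<Rightarrow> 'a \<Rightarrow> real) set \<Rightarrow> 'a \<Rightarrow> real) \<Rightarrow> bool" where
  "compact_map \<alpha> l q \<Omega> J \<longleftrightarrow>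
    (\<forall>X B. (\<forall>n::nat. X n \<in> D0 \<alpha> \<Omega> \<and> compl_norm (norm_2 \<alpha> \<Omega>) (X n) \<le> B) \<longrightarrow>
      (\<exists>s f. strict_mono (s :: nat \<Rightarrow> nat) \<and> f \<in> Lq_weighted q l \<Omega> \<and>
        (\<lambda>n. Lq_norm q l \<Omega> (\<lambda>x. J (X (s n)) x - f x)) \<longlonglongrightarrow> 0))"

definition continuously_embedded :: "real \<Rightarrow> real \<Rightarrow> real \<Rightarrow> 'a::euclidean_space set \<Rightarrow> bool" where
  "continuously_embedded \<alpha> l q \<Omega> \<longleftrightarrow> (\<exists>J. continuous_embedding \<alpha> l q \<Omega> J)"

definition compactly_embedded :: "real \<Rightarrow> real \<Rightarrow> real \<Rightarrow> 'a::euclidean_space set \<Rightarrow> bool" where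
  "compactly_embedded \<alpha> l q \<Omega> \<longleftrightarrow>
     (\<exists>J. continuous_embedding \<alpha> l q \<Omega> J \<and> compact_map \<alpha> l q \<Omega> J)"

end

theory Submission
  imports Defs "HOL-Complex_Analysis.Great_Picard"
begin

text \<open>
  Every estimate is proved for test functions on the punctured set, where integration by parts
  leaves no boundary terms, and is then carried over to the completion.  Put \<open>r = 2N / (N - 4)\<close>,
  and let \<open>\<parallel>u\<parallel>\<close> be the norm of \<open>D\<close>.

  The analytic core is the scale invariant inequality
  \<open>\<integral> |x|^(\<alpha>r/2) |u|^r \<le> C \<parallel>u\<parallel>^r\<close>.  Integration by parts yields Hardy and Rellich inequalities:
  for \<open>4 - N < \<alpha> < N\<close> the integrals of \<open>|x|^(\<alpha>-4) u\<^sup>2\<close> and \<open>|x|^(\<alpha>-2) |\<nabla>u|\<^sup>2\<close> are bounded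
  by \<open>\<parallel>u\<parallel>\<^sup>2\<close> (\<open>weighted_Rellich\<close>).  These are the lower order terms in the Laplacian of
  \<open>v = |x|^(\<alpha>/2) u\<close>, so \<open>\<integral> (\<Delta>v)\<^sup>2 \<le> C \<parallel>u\<parallel>\<^sup>2\<close>: the weight has disappeared, and what remains is
  the Sobolev inequality \<open>\<parallel>v\<parallel>\<^sub>r \<le> C \<parallel>\<Delta>v\<parallel>\<^sub>2\<close>.  It follows by testing \<open>\<Delta>v\<close> with a power of \<open>v\<close>
  (\<open>second_order_Sobolev\<close>) from the inequality between the \<open>L^(N/(N-1))\<close> norm of a function and
  the \<open>L\<^sup>1\<close> norm of its gradient (\<open>sobolev_L1\<close>).

  The condition on \<open>\<alpha>\<close> and \<open>\<tau>\<close> says that \<open>l > \<alpha>r/2\<close>, so on a bounded set \<open>|x|^l\<close> is at most a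
  constant times \<open>|x|^(\<alpha>r/2)\<close>, which gives the embedding for \<open>q = r\<close>.  Since also \<open>l > - N\<close>, the
  measure \<open>|x|^l dx\<close> is finite on \<open>\<Omega>\<close>, and the exponents \<open>q < r\<close> follow from \<open>q = r\<close>.

  For compactness, a family bounded in \<open>\<parallel>\<cdot>\<parallel>\<close> has its functions \<open>v\<close> bounded in \<open>W\<^sup>1\<^sup>,\<^sup>1\<close>, so some sequence
  in it converges almost everywhere (\<open>L1_compactness\<close>); on a finite measure space this convergence
  and a bound in \<open>L\<^sup>r\<close> give convergence in \<open>L\<^sup>q\<close> for \<open>q < r\<close>
  (\<open>Lq_convergence_of_AE_bounded\<close>).

  That the map on the completion is injective is closability of the norm: if \<open>u\<^sub>n\<close> is a Cauchy
  sequence tending to zero in the weighted \<open>L\<^sup>r\<close>, then its norms tend to zero.  This is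
  \<open>norm_2_closable\<close>; the reason is that the form defining the norm equals
  \<open>\<integral> u\<^sub>m \<Delta>(|x|^\<alpha> \<Delta>u\<^sub>n)\<close>, in which \<open>u\<^sub>m\<close> appears undifferentiated.
\<close>

section \<open>Compactly supported functions and integration by parts\<close>

lemma integrable_compact_support:
  fixes f :: "'a::euclidean_space \<Rightarrow> real"
  assumes "continuous_on UNIV f" "compact K" "\<And>x. x \<notin> K \<Longrightarrow> f x = 0"
  shows "integrable lborel f"
proof -
  have "integrable lborel (\<lambda>x. indicator K x *\<^sub>R f x)"
    by (rule borel_integrable_compact) (use assms continuous_on_subset[OF assms(1), of K] in auto)
  also have "(\<lambda>x. indicator K x *\<^sub>R f x) = f"
    using assms(3) by (auto simp: indicator_def fun_eq_iff)
  finally show ?thesis .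
qed

lemma integral_translate:
  fixes f :: "'a::euclidean_space \<Rightarrow> real"
  assumes "f \<in> borel_measurable borel"
  shows "(\<integral>x. f (x + h) \<partial>lborel) = (\<integral>x. f x \<partial>lborel)"
proof -
  have "(\<integral>x. f x \<partial>lborel) = (\<integral>x. f x \<partial>distr lborel borel ((+) h))"
    by (simp add: lborel_distr_plus)
  also have "\<dots> = (\<integral>x. f (h + x) \<partial>lborel)"
    using assms by (subst integral_distr) auto
  finally show ?thesis by (simp add: add.commute)
qed

lemma nn_integral_translate:
  fixes f :: "'a::euclidean_space \<Rightarrow> ennreal"
  assumes "f \<in> borel_measurable borel"
  shows "(\<integral>\<^sup>+x. f (x + h) \<partial>lborel) = (\<integral>\<^sup>+x. f x \<partial>lborel)"
proof -
  have "(\<integral>\<^sup>+x. f x \<partial>lborel) = (\<integral>\<^sup>+x. f x \<partial>distr lborel borel ((+) h))"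
    by (simp add: lborel_distr_plus)
  also have "\<dots> = (\<integral>\<^sup>+x. f (h + x) \<partial>lborel)"
    using assms by (subst nn_integral_distr) auto
  finally show ?thesis by (simp add: add.commute)
qed

lemma directional_derivative_shift:
  fixes F :: "'a::euclidean_space \<Rightarrow> real"
  assumes "\<And>x. ((\<lambda>t. F (x + t *\<^sub>R b)) has_real_derivative G x) (at 0)"
  shows "((\<lambda>t. F (x + t *\<^sub>R b)) has_real_derivative G (x + s *\<^sub>R b)) (at s)"
proof -
  have "((\<lambda>t. F ((x + s *\<^sub>R b) + t *\<^sub>R b)) has_real_derivative G (x + s *\<^sub>R b)) (at 0)"
    by (rule assms)
  then have "((\<lambda>t. F (x + (t + s) *\<^sub>R b)) has_real_derivative G (x + s *\<^sub>R b)) (at 0)"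
    by (simp add: algebra_simps)
  then show ?thesis
    using DERIV_shift[of "\<lambda>t. F (x + t *\<^sub>R b)" _ 0 s] by simp
qed

lemma directional_derivative_outside_support:
  fixes F :: "'a::euclidean_space \<Rightarrow> real"
  assumes der: "((\<lambda>t. F (x + t *\<^sub>R b)) has_real_derivative D) (at 0)"
    and K: "closed K" "\<And>x. x \<notin> K \<Longrightarrow> F x = 0" and x: "x \<notin> K"
  shows "D = 0"
proof -
  have "open ((\<lambda>t::real. x + t *\<^sub>R b) -` (- K))"
    by (intro open_vimage continuous_intros) (use K in auto)
  moreover have "0 \<in> (\<lambda>t::real. x + t *\<^sub>R b) -` (- K)" using x by auto
  ultimately have "\<forall>\<^sub>F t in nhds (0::real). t \<in> (\<lambda>t::real. x + t *\<^sub>R b) -` (- K)"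
    by (metis eventually_nhds)
  then have "\<forall>\<^sub>F t in nhds 0. F (x + t *\<^sub>R b) = 0"
    by eventually_elim (use K in auto)
  then have "((\<lambda>t. 0::real) has_real_derivative D) (at 0)"
    using DERIV_cong_ev[of 0 0 "\<lambda>t. F (x + t *\<^sub>R b)" "\<lambda>_. 0" D D] der by blast
  then show ?thesis using DERIV_unique DERIV_const by blast
qed

lemma bounded_compact_support:
  fixes G :: "'a::euclidean_space \<Rightarrow> real"
  assumes "continuous_on UNIV G" "compact K" "\<And>x. x \<notin> K \<Longrightarrow> G x = 0"
  obtains B where "B \<ge> 0" "\<And>x. \<bar>G x\<bar> \<le> B"
proof -
  have "compact (G ` K)"
    using assms compact_continuous_image continuous_on_subset by blast
  then obtain B where B: "\<And>y. y \<in> G ` K \<Longrightarrow> norm y \<le> B"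
    using compact_imp_bounded bounded_iff by metis
  show ?thesis
    by (rule that[of "max 0 B"]) (use B assms(3) in \<open>force simp: max_def\<close>)+
qed

text \<open>Translation invariance makes the integral of every difference quotient of \<open>F\<close> vanish, and
  dominated convergence passes to the limit.  All integrations by parts below rest on this.\<close>

lemma integral_directional_derivative_eq_0:
  fixes F :: "'a::euclidean_space \<Rightarrow> real"
  assumes der: "\<And>x. ((\<lambda>t. F (x + t *\<^sub>R b)) has_real_derivative G x) (at 0)"
    and contF: "continuous_on UNIV F" and contG: "continuous_on UNIV G"
    and K: "compact K" "\<And>x. x \<notin> K \<Longrightarrow> F x = 0"
  shows "(\<integral>x. G x \<partial>lborel) = 0"
proof -
  have G0: "G x = 0" if "x \<notin> K" for x
    using directional_derivative_outside_support[OF der compact_imp_closed[OF K(1)] K(2) that] .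
  obtain B where B: "B \<ge> 0" "\<And>x. \<bar>G x\<bar> \<le> B"
    using bounded_compact_support[OF contG K(1) G0] by blast
  define s where "s n = 1 / real (Suc n)" for n
  have s: "s n > 0" "s n \<le> 1" for n by (auto simp: s_def)
  have s0: "s \<longlonglongrightarrow> 0" unfolding s_def by (rule LIMSEQ_Suc[OF lim_inverse_n'])
  define D where "D n x = (F (x + s n *\<^sub>R b) - F x) / s n" for n x
  \<comment> \<open>All difference quotients with steps at most 1 vanish outside this compact set.\<close>
  define K' where "K' = (\<lambda>(x, t). x - t *\<^sub>R b) ` (K \<times> {0..1::real})"
  have K': "compact K'"
    unfolding K'_def
    by (intro compact_continuous_image compact_Times K) (auto simp: case_prod_unfold intro!: continuous_intros)
  have K'I: "x \<in> K'" if "x + t *\<^sub>R b \<in> K" "t \<in> {0..1}" for x t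
    unfolding K'_def using that by (force simp: image_iff intro!: bexI[of _ "(x + t *\<^sub>R b, t)"])
  have D0: "D n x = 0" if "x \<notin> K'" for n x
  proof -
    have "x \<notin> K" using K'I[of x 0] that by auto
    moreover have "x + s n *\<^sub>R b \<notin> K" using K'I[of x "s n"] that s[of n] by (auto intro: less_imp_le)
    ultimately show ?thesis by (simp add: D_def K(2))
  qed
  have DB: "\<bar>D n x\<bar> \<le> B" for n x
  proof -
    obtain z where z: "F (x + s n *\<^sub>R b) - F (x + 0 *\<^sub>R b) = (s n - 0) * G (x + z *\<^sub>R b)"
      using MVT2[OF s(1), of n "\<lambda>t. F (x + t *\<^sub>R b)" "\<lambda>t. G (x + t *\<^sub>R b)"]
        directional_derivative_shift[OF der] by blast
    then have "D n x = G (x + z *\<^sub>R b)" using s(1)[of n] by (simp add: D_def)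
    then show ?thesis using B by simp
  qed
  have contD: "continuous_on UNIV (D n)" for n
    unfolding D_def divide_inverse
    by (intro continuous_intros continuous_on_compose2[OF contF]) auto
  have intF: "integrable lborel F" using integrable_compact_support[OF contF K] .
  have mF: "F \<in> borel_measurable borel" using contF by (rule borel_measurable_continuous_onI)
  have "integrable lborel (\<lambda>x. F (x + s n *\<^sub>R b))" for n
  proof -
    have "integrable (distr lborel borel ((+) (s n *\<^sub>R b))) F" using intF by (simp add: lborel_distr_plus)
    then show ?thesis using mF by (subst (asm) integrable_distr_eq) (auto simp: add.commute)
  qed
  then have D_int: "(\<integral>x. D n x \<partial>lborel) = 0" for n
    unfolding D_def using intF integral_translate[OF mF] by simp
  have conv: "(\<lambda>n. D n x) \<longlonglongrightarrow> G x" for x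
  proof -
    have "((\<lambda>t. (F (x + t *\<^sub>R b) - F x) / t) \<longlongrightarrow> G x) (at 0)"
      using der[of x] by (simp add: has_field_derivative_iff)
    moreover have "filterlim s (at 0) sequentially"
      using s0 s(1) by (simp add: filterlim_at less_imp_neq[symmetric])
    ultimately show ?thesis unfolding D_def by (rule filterlim_compose)
  qed
  have "(\<lambda>n. \<integral>x. D n x \<partial>lborel) \<longlonglongrightarrow> (\<integral>x. G x \<partial>lborel)"
  proof (rule integral_dominated_convergence[where w = "\<lambda>x. indicator K' x *\<^sub>R B"])
    show "integrable lborel (\<lambda>x. indicator K' x *\<^sub>R B)"
      by (rule borel_integrable_compact) (use K' in auto)
    show "AE x in lborel. norm (D n x) \<le> indicator K' x *\<^sub>R B" for n
      using DB D0 by (auto simp: indicator_def)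
    show "G \<in> borel_measurable lborel" using contG by (simp add: borel_measurable_continuous_onI)
    show "D n \<in> borel_measurable lborel" for n using contD by (simp add: borel_measurable_continuous_onI)
  qed (use conv in auto)
  then show ?thesis unfolding D_int by (simp add: LIMSEQ_const_iff)
qed

text \<open>The gradient is a parameter, so that the chain and product rules can act on it directly.\<close>

definition C1_compact :: "'a::euclidean_space set \<Rightarrow> ('a \<Rightarrow> real) \<Rightarrow> ('a \<Rightarrow> 'a) \<Rightarrow> bool" where
  "C1_compact S f G \<longleftrightarrow> (\<forall>x. GDERIV f x :> G x) \<and> continuous_on UNIV G \<and>
     (\<exists>K. compact K \<and> K \<subseteq> S \<and> (\<forall>x. x \<notin> K \<longrightarrow> f x = 0))"

lemma GDERIV_along_line:
  fixes f :: "'a::euclidean_space \<Rightarrow> real"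
  assumes "GDERIV f (x + t *\<^sub>R b) :> D"
  shows "((\<lambda>t. f (x + t *\<^sub>R b)) has_real_derivative (b \<bullet> D)) (at t)"
proof -
  have *: "((\<lambda>t. x + t *\<^sub>R b) has_derivative (\<lambda>h. h *\<^sub>R b)) (at t)"
    by (auto intro!: derivative_eq_intros)
  have "(f has_derivative (\<lambda>h. h \<bullet> D)) (at (x + t *\<^sub>R b))" using assms by (simp add: gderiv_def)
  from has_derivative_compose[OF * this]
  show ?thesis by (simp add: has_field_derivative_def mult_commute_abs)
qed

lemma C1_compactD:
  assumes "C1_compact S f G"
  shows "GDERIV f x :> G x" "continuous_on UNIV G" "continuous_on UNIV f"
    "((\<lambda>t. f (x + t *\<^sub>R b)) has_real_derivative (b \<bullet> G x)) (at 0)"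
proof -
  show *: "GDERIV f x :> G x" for x using assms by (auto simp: C1_compact_def)
  show "continuous_on UNIV G" using assms by (auto simp: C1_compact_def)
  show "continuous_on UNIV f"
    using * by (auto intro!: continuous_at_imp_continuous_on has_derivative_continuous simp: gderiv_def)
  show "((\<lambda>t. f (x + t *\<^sub>R b)) has_real_derivative (b \<bullet> G x)) (at 0)"
    using GDERIV_along_line[of f x 0 b "G x"] * by simp
qed

lemma C1_compact_support:
  assumes "C1_compact S f G"
  shows "\<exists>K. compact K \<and> K \<subseteq> S \<and> (\<forall>x. x \<notin> K \<longrightarrow> f x = 0 \<and> G x = 0)"
proof -
  obtain K where K: "compact K" "K \<subseteq> S" "\<And>x. x \<notin> K \<Longrightarrow> f x = 0"
    using assms by (auto simp: C1_compact_def)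
  have "G x = 0" if "x \<notin> K" for x
  proof -
    have "G x \<bullet> G x = 0"
      by (rule directional_derivative_outside_support[OF C1_compactD(4)[OF assms] compact_imp_closed[OF K(1)] K(3) that])
    then show ?thesis by simp
  qed
  then show ?thesis using K by blast
qed

lemma C1_compact_integrable:
  assumes "C1_compact S f G"
  shows "integrable lborel f" "integrable lborel (\<lambda>x. norm (G x))"
proof -
  obtain K where K: "compact K" "K \<subseteq> S" "\<And>x. x \<notin> K \<Longrightarrow> f x = 0" "\<And>x. x \<notin> K \<Longrightarrow> G x = 0"
    using C1_compact_support[OF assms] by blast
  show "integrable lborel f"
    by (rule integrable_compact_support[OF C1_compactD(3)[OF assms] K(1)]) (use K in auto)
  show "integrable lborel (\<lambda>x. norm (G x))"
    by (rule integrable_compact_support[OF _ K(1)]) (use K C1_compactD(2)[OF assms] in \<open>auto intro!: continuous_intros\<close>)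
qed

lemma C1_compact_compose:
  assumes f: "C1_compact S f G" and h: "\<And>t. (h has_real_derivative h' t) (at t)"
    and h': "continuous_on UNIV h'" and h0: "h 0 = 0"
  shows "C1_compact S (\<lambda>x. h (f x)) (\<lambda>x. h' (f x) *\<^sub>R G x)"
  unfolding C1_compact_def
proof (intro conjI allI)
  show "GDERIV (\<lambda>x. h (f x)) x :> h' (f x) *\<^sub>R G x" for x
    using GDERIV_DERIV_compose[OF C1_compactD(1)[OF f] h] .
  show "continuous_on UNIV (\<lambda>x. h' (f x) *\<^sub>R G x)"
    by (intro continuous_intros continuous_on_compose2[OF h'] C1_compactD[OF f]) auto
  obtain K where K: "compact K" "K \<subseteq> S" "\<And>x. x \<notin> K \<Longrightarrow> f x = 0"
    using C1_compact_support[OF f] by blast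
  show "\<exists>K. compact K \<and> K \<subseteq> S \<and> (\<forall>x. x \<notin> K \<longrightarrow> h (f x) = 0)"
    by (rule exI[of _ K]) (use K h0 in auto)
qed

text \<open>The increment is the integral of \<open>h \<bullet> G\<close> along a segment; Tonelli's theorem and translation
  invariance give the bound.\<close>

lemma nn_integral_translation_difference_le:
  assumes f: "C1_compact S f G"
  shows "(\<integral>\<^sup>+x. ennreal \<bar>f (x + h) - f x\<bar> \<partial>lborel) \<le> ennreal (norm h * (\<integral>x. norm (G x) \<partial>lborel))"
proof -
  note contG = C1_compactD(2)[OF f]
  have mG [measurable]: "G \<in> borel_measurable borel" using contG by (rule borel_measurable_continuous_onI)
  have le: "ennreal \<bar>f (x + h) - f x\<bar> \<le> (\<integral>\<^sup>+s. indicator {0..1} s * ennreal (norm h * norm (G (x + s *\<^sub>R h))) \<partial>lborel)" for x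
  proof -
    have d: "((\<lambda>t. f (x + t *\<^sub>R h)) has_real_derivative (h \<bullet> G (x + s *\<^sub>R h))) (at s)" for s
      using GDERIV_along_line C1_compactD(1)[OF f] by blast
    have c: "continuous_on {0..1} (\<lambda>s::real. h \<bullet> G (x + s *\<^sub>R h))"
      by (intro continuous_intros continuous_on_compose2[OF contG]) auto
    have i: "integrable lborel (\<lambda>s. indicator {0..1} s *\<^sub>R (h \<bullet> G (x + s *\<^sub>R h)))"
      by (rule borel_integrable_compact) (use c in auto)
    have eq: "(\<integral>s. indicator {0..1} s *\<^sub>R (h \<bullet> G (x + s *\<^sub>R h)) \<partial>lborel) = f (x + 1 *\<^sub>R h) - f (x + 0 *\<^sub>R h)"
      by (rule integral_FTC_atLeastAtMost)
        (use d c in \<open>auto simp: has_real_derivative_iff_has_vector_derivative[symmetric] intro: DERIV_subset\<close>)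
    have "ennreal \<bar>f (x + h) - f x\<bar> \<le> (\<integral>\<^sup>+s. ennreal (norm (indicator {0..1} s *\<^sub>R (h \<bullet> G (x + s *\<^sub>R h)))) \<partial>lborel)"
      using integral_norm_bound_ennreal[OF i] eq by simp
    also have "\<dots> \<le> (\<integral>\<^sup>+s. indicator {0..1} s * ennreal (norm h * norm (G (x + s *\<^sub>R h))) \<partial>lborel)"
      by (intro nn_integral_mono) (auto simp: indicator_def Cauchy_Schwarz_ineq2 intro!: ennreal_leI)
    finally show ?thesis .
  qed
  have "(\<integral>\<^sup>+x. ennreal \<bar>f (x + h) - f x\<bar> \<partial>lborel)
      \<le> (\<integral>\<^sup>+x. (\<integral>\<^sup>+s. indicator {0..1::real} s * ennreal (norm h * norm (G (x + s *\<^sub>R h))) \<partial>lborel) \<partial>lborel)"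
    by (rule nn_integral_mono) (use le in auto)
  also have "\<dots> = (\<integral>\<^sup>+s. (\<integral>\<^sup>+x. indicator {0..1::real} s * ennreal (norm h * norm (G (x + s *\<^sub>R h))) \<partial>lborel) \<partial>lborel)"
    by (rule lborel_pair.Fubini'[symmetric]) simp
  also have "\<dots> = (\<integral>\<^sup>+s. indicator {0..1::real} s * (\<integral>\<^sup>+x. ennreal (norm h * norm (G x)) \<partial>lborel) \<partial>lborel)"
    by (intro nn_integral_cong) (simp add: nn_integral_cmult nn_integral_translate[of "\<lambda>x. ennreal (norm h * norm (G x))"])
  also have "\<dots> = (\<integral>\<^sup>+x. ennreal (norm h * norm (G x)) \<partial>lborel)"
    by (simp add: nn_integral_multc)
  also have "\<dots> = ennreal (norm h * (\<integral>x. norm (G x) \<partial>lborel))"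
    using C1_compact_integrable(2)[OF f] by (subst nn_integral_eq_integral) auto
  finally show ?thesis .
qed

section \<open>The Sobolev inequality for integrable gradients\<close>

lemma measurable_indicator_ball [measurable]:
  "(indicator (ball c r) :: 'a::euclidean_space \<Rightarrow> ennreal) \<in> borel_measurable borel"
  by (intro borel_measurable_indicator borel_open open_ball)

text \<open>This controls both the measure of superlevel sets and, in the proof of compactness, the distance
  from a function to its averages over small balls.\<close>

lemma nn_integral_ball_difference_le:
  fixes f :: "'a::euclidean_space \<Rightarrow> real"
  assumes f: "C1_compact S f G" and r: "r \<ge> 0"
  shows "(\<integral>\<^sup>+x. (\<integral>\<^sup>+h. indicator (ball 0 r) h * ennreal \<bar>f (x + h) - f x\<bar> \<partial>lborel) \<partial>lborel)
    \<le> ennreal (unit_ball_vol (real DIM('a)) * r ^ DIM('a) * (r * (\<integral>x. norm (G x) \<partial>lborel)))"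
proof -
  have mf [measurable]: "f \<in> borel_measurable borel"
    using C1_compactD(3)[OF f] by (rule borel_measurable_continuous_onI)
  have "(\<integral>\<^sup>+x. (\<integral>\<^sup>+h. indicator (ball 0 r) h * ennreal \<bar>f (x + h) - f x\<bar> \<partial>lborel) \<partial>lborel)
      = (\<integral>\<^sup>+h. (\<integral>\<^sup>+x. indicator (ball 0 r) h * ennreal \<bar>f (x + h) - f x\<bar> \<partial>lborel) \<partial>lborel)"
  proof (rule lborel_pair.Fubini'[symmetric])
    define B :: "'a \<Rightarrow> ennreal" where "B = indicator (ball 0 r)"
    have [measurable]: "B \<in> borel_measurable borel" unfolding B_def by (rule measurable_indicator_ball)
    have "(\<lambda>(x, h). B h * ennreal \<bar>f (x + h) - f x\<bar>) \<in> borel_measurable (lborel \<Otimes>\<^sub>M lborel)"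
      by measurable
    then show "(\<lambda>(x, h). indicator (ball 0 r) h * ennreal \<bar>f (x + h) - f x\<bar>) \<in> borel_measurable (lborel \<Otimes>\<^sub>M lborel)"
      by (simp add: B_def)
  qed
  also have "\<dots> = (\<integral>\<^sup>+h. indicator (ball 0 r) h * (\<integral>\<^sup>+x. ennreal \<bar>f (x + h) - f x\<bar> \<partial>lborel) \<partial>lborel)"
    by (intro nn_integral_cong nn_integral_cmult) simp
  also have "\<dots> \<le> (\<integral>\<^sup>+h. indicator (ball (0::'a) r) h * ennreal (r * (\<integral>x. norm (G x) \<partial>lborel)) \<partial>lborel)"
  proof (rule nn_integral_mono)
    fix h :: 'a
    show "indicator (ball 0 r) h * (\<integral>\<^sup>+x. ennreal \<bar>f (x + h) - f x\<bar> \<partial>lborel)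
        \<le> indicator (ball 0 r) h * ennreal (r * (\<integral>x. norm (G x) \<partial>lborel))"
    proof (cases "h \<in> ball 0 r")
      case True
      have "(\<integral>\<^sup>+x. ennreal \<bar>f (x + h) - f x\<bar> \<partial>lborel) \<le> ennreal (norm h * (\<integral>x. norm (G x) \<partial>lborel))"
        by (rule nn_integral_translation_difference_le[OF f])
      also have "\<dots> \<le> ennreal (r * (\<integral>x. norm (G x) \<partial>lborel))"
        using True by (intro ennreal_leI mult_right_mono) auto
      finally show ?thesis using True by simp
    qed simp
  qed
  also have "\<dots> = emeasure lborel (ball (0::'a) r) * ennreal (r * (\<integral>x. norm (G x) \<partial>lborel))"
    by (simp add: nn_integral_multc)
  also have "\<dots> = ennreal (unit_ball_vol (real DIM('a)) * r ^ DIM('a) * (r * (\<integral>x. norm (G x) \<partial>lborel)))"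
    using r by (subst emeasure_ball) (auto simp: ennreal_mult)
  finally show ?thesis .
qed

lemma emeasure_superlevel:
  fixes f :: "'a::euclidean_space \<Rightarrow> real"
  assumes f: "C1_compact S f G" and t: "t > 0"
  shows "emeasure lborel {x. t \<le> f x} = ennreal (measure lborel {x. t \<le> f x})" "{x. t \<le> f x} \<in> sets lborel"
proof -
  obtain K where K: "compact K" "\<And>x. x \<notin> K \<Longrightarrow> f x = 0"
    using C1_compact_support[OF f] by blast
  have [measurable]: "f \<in> borel_measurable borel"
    using C1_compactD(3)[OF f] by (rule borel_measurable_continuous_onI)
  show "{x. t \<le> f x} \<in> sets lborel" by simp
  have "emeasure lborel {x. t \<le> f x} \<le> emeasure lborel K"
    by (rule emeasure_mono) (use K t in \<open>force intro: borel_closed compact_imp_closed\<close>)+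
  also have "\<dots> < \<infinity>" using emeasure_compact_finite[OF K(1)] by simp
  finally show "emeasure lborel {x. t \<le> f x} = ennreal (measure lborel {x. t \<le> f x})"
    by (intro emeasure_eq_ennreal_measure) auto
qed

text \<open>If a ball is so large that the mean of \<open>|f|\<close> over any translate of it is at most \<open>t / 2\<close>, then at
  every point where \<open>f \<ge> t\<close> the mean of \<open>|f (x + h) - f x|\<close> over \<open>h\<close> in that ball is at least \<open>t / 2\<close>.\<close>

lemma superlevel_measure_le:
  fixes f :: "'a::euclidean_space \<Rightarrow> real"
  assumes f: "C1_compact S f G" and t: "t > 0" and r: "r > 0"
    and small: "2 * (\<integral>x. \<bar>f x\<bar> \<partial>lborel) \<le> t * (unit_ball_vol (real DIM('a)) * r ^ DIM('a))"
  shows "t * measure lborel {x. t \<le> f x} \<le> 2 * r * (\<integral>x. norm (G x) \<partial>lborel)"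
proof -
  define V where "V = unit_ball_vol (real DIM('a)) * r ^ DIM('a)"
  have V: "V > 0" using r by (simp add: V_def)
  have emV: "emeasure lborel (ball (0::'a) r) = ennreal V"
    using r by (simp add: emeasure_ball V_def)
  have mf [measurable]: "f \<in> borel_measurable borel"
    using C1_compactD(3)[OF f] by (rule borel_measurable_continuous_onI)
  define I where "I x = (\<integral>\<^sup>+h. indicator (ball 0 r) h * ennreal \<bar>f (x + h) - f x\<bar> \<partial>lborel)" for x
  have lower: "ennreal (t * V / 2) \<le> I x" if x: "t \<le> f x" for x
  proof -
    have "ennreal (t * V) = (\<integral>\<^sup>+h. indicator (ball (0::'a) r) h * ennreal t \<partial>lborel)"
      using t V by (subst nn_integral_multc) (auto simp: emV ennreal_mult mult.commute intro: measurable_indicator_ball)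
    also have "\<dots> \<le> (\<integral>\<^sup>+h. indicator (ball 0 r) h * ennreal \<bar>f (x + h) - f x\<bar> + ennreal \<bar>f (h + x)\<bar> \<partial>lborel)"
    proof (rule nn_integral_mono)
      fix h :: 'a
      have "t \<le> \<bar>f (x + h) - f x\<bar> + \<bar>f (h + x)\<bar>" using x t by (auto simp: add.commute)
      then show "indicator (ball 0 r) h * ennreal t
          \<le> indicator (ball 0 r) h * ennreal \<bar>f (x + h) - f x\<bar> + ennreal \<bar>f (h + x)\<bar>"
        by (auto simp: indicator_def ennreal_plus[symmetric] simp del: ennreal_plus intro!: ennreal_leI)
    qed
    also have "\<dots> = I x + (\<integral>\<^sup>+h. ennreal \<bar>f (h + x)\<bar> \<partial>lborel)"
      unfolding I_def by (rule nn_integral_add) auto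
    also have "(\<integral>\<^sup>+h. ennreal \<bar>f (h + x)\<bar> \<partial>lborel) = (\<integral>\<^sup>+h. ennreal \<bar>f h\<bar> \<partial>lborel)"
      by (rule nn_integral_translate) simp
    also have "\<dots> = ennreal (\<integral>h. \<bar>f h\<bar> \<partial>lborel)"
      using C1_compact_integrable(1)[OF f] by (intro nn_integral_eq_integral) auto
    also have "\<dots> \<le> ennreal (t * V / 2)"
      using small by (intro ennreal_leI) (simp add: V_def)
    finally have "ennreal (t * V) \<le> I x + ennreal (t * V / 2)" by (simp add: add_left_mono)
    moreover have "ennreal (t * V) = ennreal (t * V / 2) + ennreal (t * V / 2)"
      using t V by (simp add: ennreal_plus[symmetric] del: ennreal_plus)
    ultimately show ?thesis by (simp add: add.commute)
  qed
  let ?m = "measure lborel {x. t \<le> f x}"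
  have "ennreal (t * V / 2 * ?m) = ennreal (t * V / 2) * emeasure lborel {x. t \<le> f x}"
    unfolding emeasure_superlevel(1)[OF f t] using t V by (subst ennreal_mult[symmetric]) auto
  also have "\<dots> = (\<integral>\<^sup>+x. ennreal (t * V / 2) * indicator {x. t \<le> f x} x \<partial>lborel)"
    by (subst nn_integral_cmult_indicator) (use emeasure_superlevel(2)[OF f t] in auto)
  also have "\<dots> \<le> (\<integral>\<^sup>+x. I x \<partial>lborel)"
    by (rule nn_integral_mono) (use lower in \<open>auto simp: indicator_def\<close>)
  also have "\<dots> \<le> ennreal (V * (r * (\<integral>x. norm (G x) \<partial>lborel)))"
    unfolding I_def V_def using nn_integral_ball_difference_le[OF f] r by simp
  finally have "t * V / 2 * ?m \<le> V * (r * (\<integral>x. norm (G x) \<partial>lborel))"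
    using V r by (subst (asm) ennreal_le_iff) (auto intro!: mult_nonneg_nonneg)
  then show ?thesis using V by (simp add: field_simps)
qed

definition weak_const :: "nat \<Rightarrow> real" where
  "weak_const n = 2 * (2 / unit_ball_vol (real n)) powr (1 / real n)"

lemma weak_const_pos: "weak_const n > 0"
  using unit_ball_vol_pos[of "real n"] by (simp add: weak_const_def less_imp_neq[symmetric])

text \<open>The radius is chosen to give equality in the smallness condition of \<open>superlevel_measure_le\<close>.\<close>

lemma weak_type:
  fixes f :: "'a::euclidean_space \<Rightarrow> real"
  assumes f: "C1_compact S f G" and t: "t > 0"
  shows "t * measure lborel {x. t \<le> f x} \<le>
    weak_const DIM('a) * ((\<integral>x. \<bar>f x\<bar> \<partial>lborel) / t) powr (1 / real DIM('a)) * (\<integral>x. norm (G x) \<partial>lborel)"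
proof (cases "(\<integral>x. \<bar>f x\<bar> \<partial>lborel) = 0")
  case True
  have i: "integrable lborel (\<lambda>x. \<bar>f x\<bar>)" using C1_compact_integrable(1)[OF f] by auto
  have "AE x in lborel. \<bar>f x\<bar> = 0"
    using integral_nonneg_eq_0_iff_AE[OF i] True by simp
  then have "AE x in lborel. x \<notin> {x. t \<le> f x}" by eventually_elim (use t in auto)
  then have "emeasure lborel {x. t \<le> f x} = 0"
    using emeasure_superlevel(2)[OF f t] by (subst (asm) AE_iff_measurable[OF _ refl]) auto
  then show ?thesis using True by (simp add: measure_def)
next
  case False
  let ?n = "DIM('a)"
  define v where "v = unit_ball_vol (real ?n)"
  have v: "v > 0" by (simp add: v_def)
  define I where "I = (\<integral>x. \<bar>f x\<bar> \<partial>lborel)"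
  have I: "I > 0" using False Bochner_Integration.integral_nonneg[of lborel "\<lambda>x. \<bar>f x\<bar>"] unfolding I_def by (simp add: less_le)
  define r where "r = (2 * I / (t * v)) powr (1 / real ?n)"
  have r: "r > 0" using I t v by (simp add: r_def)
  have rn: "r ^ ?n = 2 * I / (t * v)"
    using I t v by (simp add: r_def powr_realpow[symmetric] powr_powr)
  have "t * measure lborel {x. t \<le> f x} \<le> 2 * r * (\<integral>x. norm (G x) \<partial>lborel)"
    by (rule superlevel_measure_le[OF f t r]) (use t v in \<open>simp add: rn flip: I_def v_def\<close>)
  also have "2 * r = weak_const ?n * (I / t) powr (1 / real ?n)"
    using I t v by (simp add: r_def weak_const_def v_def powr_mult[symmetric] powr_divide field_simps)
  finally show ?thesis by (simp add: I_def)
qed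

text \<open>A continuously differentiable function that is 0 up to 1 and is 1 from 2 on: a quadratic
  spline, whose derivative is a hat function on the interval between 1 and 2.\<close>

definition ramp :: "real \<Rightarrow> real" where
  "ramp t = 2 * ((max 0 (t - 1))\<^sup>2 - 2 * (max 0 (t - 3/2))\<^sup>2 + (max 0 (t - 2))\<^sup>2)"

definition ramp' :: "real \<Rightarrow> real" where
  "ramp' t = 4 * (max 0 (t - 1) - 2 * max 0 (t - 3/2) + max 0 (t - 2))"

lemma DERIV_square_positive_part: "((\<lambda>t::real. (max 0 (t - a))\<^sup>2) has_real_derivative 2 * max 0 (t - a)) (at t)"
proof -
  consider "t < a" | "t > a" | "t = a" by linarith
  then show ?thesis
  proof cases
    case 1
    have "((\<lambda>t::real. 0) has_real_derivative 0) (at t)" by simp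
    then have "((\<lambda>t::real. (max 0 (t - a))\<^sup>2) has_real_derivative 0) (at t)"
      by (rule has_field_derivative_transform_within_open[where S = "{..<a}"]) (use 1 in \<open>auto simp: max_def\<close>)
    then show ?thesis using 1 by (simp add: max_def)
  next
    case 2
    have "((\<lambda>t::real. (t - a)\<^sup>2) has_real_derivative 2 * (t - a)) (at t)" by (auto intro!: derivative_eq_intros)
    then have "((\<lambda>t::real. (max 0 (t - a))\<^sup>2) has_real_derivative 2 * (t - a)) (at t)"
      by (rule has_field_derivative_transform_within_open[where S = "{a<..}"]) (use 2 in \<open>auto simp: max_def\<close>)
    then show ?thesis using 2 by (simp add: max_def)
  next
    case 3
    have "((\<lambda>h. (max 0 h)\<^sup>2 / h) \<longlongrightarrow> 0) (at (0::real))"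
    proof (rule Lim_null_comparison)
      show "\<forall>\<^sub>F h in at (0::real). norm ((max 0 h)\<^sup>2 / h) \<le> \<bar>h\<bar>"
        by (rule always_eventually) (auto simp: max_def power2_eq_square)
      show "((\<lambda>h::real. \<bar>h\<bar>) \<longlongrightarrow> 0) (at 0)" by (auto intro!: tendsto_eq_intros)
    qed
    then show ?thesis using 3 by (simp add: DERIV_def)
  qed
qed

lemma DERIV_ramp: "(ramp has_real_derivative ramp' t) (at t)"
  unfolding ramp_def[abs_def] ramp'_def
  by (rule derivative_eq_intros DERIV_square_positive_part refl)+ (simp add: algebra_simps)

lemma ramp_bounds:
  "t \<le> 1 \<Longrightarrow> ramp t = 0" "t \<ge> 2 \<Longrightarrow> ramp t = 1" "0 \<le> ramp t" "ramp t \<le> 1"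
proof -
  show "t \<le> 1 \<Longrightarrow> ramp t = 0" by (simp add: ramp_def max_def)
  show "t \<ge> 2 \<Longrightarrow> ramp t = 1" by (simp add: ramp_def max_def power2_eq_square algebra_simps)
  consider "t \<le> 1" | "1 \<le> t" "t \<le> 3/2" | "3/2 \<le> t" "t \<le> 2" | "2 \<le> t" by linarith
  then have "0 \<le> ramp t \<and> ramp t \<le> 1"
  proof cases
    case 2
    then have "ramp t = 2 * (t - 1)\<^sup>2" by (simp add: ramp_def max_def)
    moreover have "(t - 1)\<^sup>2 \<le> (1/2)\<^sup>2" by (rule power_mono) (use 2 in auto)
    ultimately show ?thesis by (simp add: power2_eq_square)
  next
    case 3
    then have "ramp t = 1 - 2 * (2 - t)\<^sup>2" by (simp add: ramp_def max_def power2_eq_square algebra_simps)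
    moreover have "(2 - t)\<^sup>2 \<le> (1/2)\<^sup>2" by (rule power_mono) (use 3 in auto)
    ultimately show ?thesis by (simp add: power2_eq_square)
  qed (auto simp: ramp_def max_def power2_eq_square algebra_simps)
  then show "0 \<le> ramp t" "ramp t \<le> 1" by auto
qed

lemma ramp'_bounds: "0 \<le> ramp' t" "ramp' t \<le> 2" "t \<le> 1 \<or> t \<ge> 2 \<Longrightarrow> ramp' t = 0"
  by (auto simp: ramp'_def max_def)

lemma continuous_ramp': "continuous_on S ramp'"
  unfolding ramp'_def[abs_def] by (intro continuous_intros)

lemma C1_compact_truncation:
  assumes f: "C1_compact S f G" and l: "l > 0"
  shows "C1_compact S (\<lambda>x. l * ramp (f x / l)) (\<lambda>x. ramp' (f x / l) *\<^sub>R G x)"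
proof (rule C1_compact_compose[OF f])
  show "((\<lambda>t. l * ramp (t / l)) has_real_derivative ramp' (t / l)) (at t)" for t
    using l by (auto intro!: derivative_eq_intros DERIV_chain2[OF DERIV_ramp])
  show "continuous_on UNIV (\<lambda>t. ramp' (t / l))"
    using l by (intro continuous_on_compose2[OF continuous_ramp'[of UNIV]] continuous_intros) auto
qed (simp add: ramp_bounds)

text \<open>Truncation in the manner of Maz'ya: the weak type inequality is applied to the slice of \<open>f\<close>
  between the heights \<open>l\<close> and \<open>2 l\<close>, whose gradient lives where \<open>f\<close> has these values.\<close>

lemma level_estimate:
  fixes f :: "'a::euclidean_space \<Rightarrow> real"
  assumes f: "C1_compact S f G" and l: "l > 0"
  shows "l * measure lborel {x. 2 * l \<le> f x} \<le>
    weak_const DIM('a) * (measure lborel {x. l \<le> f x}) powr (1 / real DIM('a)) * (\<integral>x. ramp' (f x / l) * norm (G x) \<partial>lborel)"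
proof -
  let ?T = "\<lambda>x. l * ramp (f x / l)"
  note T = C1_compact_truncation[OF f l]
  have eq: "{x. l \<le> ?T x} \<supseteq> {x. 2 * l \<le> f x}"
    using l ramp_bounds(2) by (auto simp: pos_le_divide_eq)
  have iT: "integrable lborel ?T" by (rule C1_compact_integrable(1)[OF T])
  have "(\<integral>x. \<bar>?T x\<bar> \<partial>lborel) \<le> (\<integral>x. l * indicator {x. l \<le> f x} x \<partial>lborel)"
  proof (rule integral_mono)
    show "integrable lborel (\<lambda>x. \<bar>?T x\<bar>)" using iT by simp
    show "integrable lborel (\<lambda>x. l * indicator {x. l \<le> f x} x)"
      using emeasure_superlevel[OF f l] by (intro integrable_mult_right integrable_real_indicator) auto
    show "\<bar>?T x\<bar> \<le> l * indicator {x. l \<le> f x} x" for x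
      using l ramp_bounds(1,3,4)[of "f x / l"] by (auto simp: indicator_def abs_mult)
  qed
  also have "\<dots> = l * measure lborel {x. l \<le> f x}"
    using emeasure_superlevel[OF f l] by simp
  finally have I: "(\<integral>x. \<bar>?T x\<bar> \<partial>lborel) / l \<le> measure lborel {x. l \<le> f x}"
    using l by (simp add: field_simps)
  have "l * measure lborel {x. 2 * l \<le> f x} \<le> l * measure lborel {x. l \<le> ?T x}"
  proof (intro mult_left_mono)
    show "measure lborel {x. 2 * l \<le> f x} \<le> measure lborel {x. l \<le> ?T x}"
      by (rule measure_mono_fmeasurable[OF eq])
        (use emeasure_superlevel[OF f, of "2 * l"] emeasure_superlevel[OF T, of l] l in \<open>auto simp: fmeasurable_def\<close>)
  qed (use l in auto)
  also have "\<dots> \<le> weak_const DIM('a) * ((\<integral>x. \<bar>?T x\<bar> \<partial>lborel) / l) powr (1 / real DIM('a))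
       * (\<integral>x. norm (ramp' (f x / l) *\<^sub>R G x) \<partial>lborel)"
    by (rule weak_type[OF T l])
  also have "\<dots> \<le> weak_const DIM('a) * (measure lborel {x. l \<le> f x}) powr (1 / real DIM('a))
       * (\<integral>x. norm (ramp' (f x / l) *\<^sub>R G x) \<partial>lborel)"
    using I l weak_const_pos[of "DIM('a)"]
    by (intro mult_right_mono mult_left_mono powr_mono2) (auto intro!: divide_nonneg_nonneg)
  finally show ?thesis using ramp'_bounds(1) by simp
qed

text \<open>At most one summand is nonzero, since the dyadic slices do not overlap.\<close>

lemma sum_ramp'_dyadic_le:
  assumes "finite I" "y \<ge> 0"
  shows "(\<Sum>k\<in>I. ramp' (y / 2 powr real_of_int k)) \<le> 2"
proof -
  define k0 where "k0 = \<lfloor>log 2 y\<rfloor>"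
  have z: "ramp' (y / 2 powr real_of_int k) = 0" if "k \<noteq> k0" for k
  proof (rule ccontr)
    assume "ramp' (y / 2 powr real_of_int k) \<noteq> 0"
    then have "1 < y / 2 powr k" "y / 2 powr k < 2" by (meson not_le ramp'_bounds(3))+
    then have y: "2 powr k < y" "y < 2 powr (k + 1)" by (auto simp: field_simps powr_add)
    have "0 < y" using y(1) powr_gt_zero[of 2 "real_of_int k"] by linarith
    then have "real_of_int k < log 2 y" "log 2 y < real_of_int k + 1"
      using y by (auto simp: less_log_iff log_less_iff)
    then show False using that unfolding k0_def by linarith
  qed
  have "(\<Sum>k\<in>I. ramp' (y / 2 powr real_of_int k)) \<le> (\<Sum>k\<in>I. if k = k0 then 2 else 0)"
    by (rule sum_mono) (use z ramp'_bounds in auto)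
  also have "\<dots> \<le> 2" using assms(1) by simp
  finally show ?thesis .
qed

lemma powr_le_dyadic_sum:
  fixes y q :: real
  assumes q: "q > 0" and y: "0 \<le> y" "y \<le> 2 powr real_of_int J" and i: "i \<le> J"
  shows "y powr q \<le> (\<Sum>k\<in>{i..J}. 2 powr (q * (real_of_int k + 1)) * indicator {y. 2 powr real_of_int k \<le> y} y)
     + 2 powr (q * real_of_int i)"
proof (cases "y < 2 powr real_of_int i")
  case True
  then have "y powr q \<le> (2 powr real_of_int i) powr q" using q y by (intro powr_mono2) auto
  also have "\<dots> = 2 powr (q * real_of_int i)" by (simp add: powr_powr mult.commute)
  finally show ?thesis by (simp add: add_increasing sum_nonneg)
next
  case False
  define k where "k = \<lfloor>log 2 y\<rfloor>"
  have y0: "0 < y" using False powr_gt_zero[of 2 "real_of_int i"] by linarith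
  have k1: "real_of_int k \<le> log 2 y" "log 2 y < real_of_int k + 1" by (auto simp: k_def)
  then have k2: "2 powr k \<le> y" "y < 2 powr (k + 1)" using y0 by (auto simp: le_log_iff log_less_iff)
  have "real_of_int i \<le> log 2 y" using False y0 by (simp add: le_log_iff)
  then have "i \<le> k" by (simp add: k_def le_floor_iff)
  moreover have "log 2 y \<le> real_of_int J" using y y0 by (simp add: log_le_iff)
  then have "k \<le> J" using k1 by linarith
  ultimately have k: "k \<in> {i..J}" by simp
  have "y powr q \<le> (2 powr (k + 1)) powr q" using k2 y q by (intro powr_mono2) auto
  also have "\<dots> = 2 powr (q * (real_of_int k + 1)) * indicator {y. 2 powr real_of_int k \<le> y} y"
    using k2 by (simp add: powr_powr mult.commute)
  also have "\<dots> \<le> (\<Sum>k\<in>{i..J}. 2 powr (q * (real_of_int k + 1)) * indicator {y. 2 powr real_of_int k \<le> y} y)"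
    using k by (intro member_le_sum) auto
  finally show ?thesis by (simp add: add_increasing2)
qed

definition sobolev_const :: "nat \<Rightarrow> real" where
  "sobolev_const n = 2 powr (2 + real n / (real n - 1)) * weak_const n"

lemma sobolev_const_pos: "sobolev_const n > 0"
  using weak_const_pos by (simp add: sobolev_const_def)

text \<open>With \<open>M\<^sub>k = 2^(q k) |{f \<ge> 2^k}|\<close> and \<open>b\<^sub>k\<close> the mass of the gradient in the \<open>k\<close>-th slice, the level
  estimate reads \<open>M\<^sub>k\<^sub>+\<^sub>1 \<le> c M\<^sub>k^(1/n) b\<^sub>k\<close>; the exponent \<open>q = n / (n - 1)\<close> is the one for which the
  powers of 2 cancel.  Replacing \<open>M\<^sub>k\<close> by its supremum on the right first bounds the supremum, and
  then, after summation, the sum of the \<open>M\<^sub>k\<close>.\<close>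

lemma sobolev_L1_dyadic:
  fixes f :: "'a::euclidean_space \<Rightarrow> real"
  assumes f: "C1_compact S f G" and f0: "\<And>x. 0 \<le> f x" and n2: "DIM('a) \<ge> 2"
    and q: "q = real DIM('a) / (real DIM('a) - 1)" and I: "finite I"
  shows "(\<Sum>k\<in>I. 2 powr (q * real_of_int (k + 1)) * measure lborel {x. 2 powr real_of_int (k + 1) \<le> f x})
     \<le> (2 powr (q + 1) * weak_const DIM('a) * (\<integral>x. norm (G x) \<partial>lborel)) powr q"
proof -
  let ?n = "real DIM('a)"
  define W where "W = weak_const DIM('a)"
  have W: "W > 0" by (simp add: W_def weak_const_pos)
  define A where "A = (\<integral>x. norm (G x) \<partial>lborel)"
  have A: "A \<ge> 0" by (simp add: A_def)
  have q1: "q > 1" using n2 by (simp add: q field_simps)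
  have qn: "q - 1 = q / ?n" "q * (1 - 1 / ?n) = 1" using n2 by (simp_all add: q field_simps)
  define m where "m k = measure lborel {x. 2 powr real_of_int k \<le> f x}" for k
  define M where "M k = 2 powr (q * real_of_int k) * m k" for k
  define b where "b k = (\<integral>x. ramp' (f x / 2 powr real_of_int k) * norm (G x) \<partial>lborel)" for k
  have M0: "M k \<ge> 0" "m k \<ge> 0" for k by (simp_all add: M_def m_def)
  have intb: "integrable lborel (\<lambda>x. ramp' (f x / 2 powr real_of_int k) * norm (G x))" for k
    using C1_compact_integrable(2)[OF C1_compact_truncation[OF f, of "2 powr real_of_int k"]] ramp'_bounds(1) by simp
  have b0: "b k \<ge> 0" for k unfolding b_def by (intro Bochner_Integration.integral_nonneg) (simp add: ramp'_bounds)
  have bsum: "(\<Sum>k\<in>I. b k) \<le> 2 * A" if "finite I" for I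
  proof -
    have "(\<Sum>k\<in>I. b k) = (\<integral>x. (\<Sum>k\<in>I. ramp' (f x / 2 powr real_of_int k) * norm (G x)) \<partial>lborel)"
      unfolding b_def by (rule Bochner_Integration.integral_sum[symmetric]) (rule intb)
    also have "\<dots> \<le> (\<integral>x. 2 * norm (G x) \<partial>lborel)"
    proof (rule integral_mono)
      show "integrable lborel (\<lambda>x. \<Sum>k\<in>I. ramp' (f x / 2 powr real_of_int k) * norm (G x))"
        by (rule Bochner_Integration.integrable_sum) (rule intb)
      show "integrable lborel (\<lambda>x. 2 * norm (G x))" using C1_compact_integrable(2)[OF f] by simp
      show "(\<Sum>k\<in>I. ramp' (f x / 2 powr real_of_int k) * norm (G x)) \<le> 2 * norm (G x)" for x
        unfolding sum_distrib_right[symmetric]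
        by (rule mult_right_mono[OF sum_ramp'_dyadic_le[OF that f0]]) simp
    qed
    finally show ?thesis by (simp add: A_def)
  qed
  have step: "M (k + 1) \<le> 2 powr q * W * M k powr (1 / ?n) * b k" for k
  proof -
    have "2 powr real_of_int k * m (k + 1) \<le> W * m k powr (1 / ?n) * b k"
      using level_estimate[OF f, of "2 powr real_of_int k"] by (simp add: m_def W_def b_def powr_add mult.commute)
    then have le: "2 powr (q * real_of_int (k + 1)) * 2 powr (- real_of_int k) * (2 powr real_of_int k * m (k + 1))
        \<le> 2 powr (q * real_of_int (k + 1)) * 2 powr (- real_of_int k) * (W * m k powr (1 / ?n) * b k)"
      by (rule mult_left_mono) simp
    have "2 powr (- real_of_int k) * 2 powr real_of_int k = (1::real)" by (simp flip: powr_add)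
    then have "M (k + 1) = 2 powr (q * real_of_int (k + 1)) * (2 powr (- real_of_int k) * 2 powr real_of_int k) * m (k + 1)"
      unfolding M_def by simp
    also have "\<dots> = 2 powr (q * real_of_int (k + 1)) * 2 powr (- real_of_int k) * (2 powr real_of_int k * m (k + 1))"
      by (simp only: mult.assoc)
    also note le
    also have "2 powr (q * real_of_int (k + 1)) * 2 powr (- real_of_int k) = 2 powr q * (2 powr (q * real_of_int k)) powr (1 / ?n)"
    proof -
      have "q * real_of_int (k + 1) + - real_of_int k = q + q * real_of_int k * (1 / ?n)"
        using arg_cong[OF qn(1), of "\<lambda>z. z * real_of_int k"] by (simp add: algebra_simps)
      then show ?thesis by (simp add: powr_powr flip: powr_add)
    qed
    also have "2 powr q * (2 powr (q * real_of_int k)) powr (1 / ?n) * (W * m k powr (1 / ?n) * b k)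
        = 2 powr q * W * M k powr (1 / ?n) * b k"
      unfolding M_def by (subst powr_mult) (use M0 in \<open>simp_all only: mult_ac powr_ge_zero\<close>)
    finally show ?thesis .
  qed
  obtain K where K: "compact K" "\<And>x. x \<notin> K \<Longrightarrow> f x = 0"
    using C1_compact_support[OF f] by blast
  obtain F where F: "F \<ge> 0" "\<And>x. \<bar>f x\<bar> \<le> F"
    using bounded_compact_support[OF C1_compactD(3)[OF f] K] by blast
  have bdd: "M k \<le> F powr q * measure lborel K" for k
  proof (cases "2 powr real_of_int k \<le> F")
    case True
    have "2 powr (q * real_of_int k) = (2 powr real_of_int k) powr q" by (simp add: powr_powr mult.commute)
    also have "\<dots> \<le> F powr q" using True q1 by (intro powr_mono2) auto
    finally have 1: "2 powr (q * real_of_int k) \<le> F powr q" .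
    have Kf: "K \<in> fmeasurable lborel"
      using K(1) emeasure_compact_finite[OF K(1)] by (auto simp: fmeasurable_def intro: borel_closed compact_imp_closed)
    have sub: "{x. 2 powr real_of_int k \<le> f x} \<subseteq> K"
    proof (rule subsetI, rule ccontr)
      fix x assume "x \<in> {x. 2 powr real_of_int k \<le> f x}" "x \<notin> K"
      then have "2 powr real_of_int k \<le> (0::real)" using K(2)[of x] by simp
      moreover have "0 < 2 powr real_of_int k" by simp
      ultimately show False by linarith
    qed
    have "m k \<le> measure lborel K"
      unfolding m_def by (rule measure_mono_fmeasurable[OF sub _ Kf])
        (rule emeasure_superlevel(2)[OF f], simp)
    then show ?thesis unfolding M_def using 1 M0 by (intro mult_mono) auto
  next
    case False
    then have "\<not> 2 powr real_of_int k \<le> f x" for x using F(2)[of x] by linarith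
    then have "{x. 2 powr real_of_int k \<le> f x} = {}" by blast
    then show ?thesis unfolding M_def m_def by simp
  qed
  define Z where "Z = (SUP k. M k)"
  have bddM: "bdd_above (range M)" using bdd by (auto simp: bdd_above_def)
  have MZ: "M k \<le> Z" for k unfolding Z_def by (rule cSUP_upper[OF _ bddM]) simp
  have Z0: "Z \<ge> 0" using MZ[of 0] M0(1)[of 0] by linarith
  define c where "c = 2 powr q * W * (2 * A)"
  have c0: "c \<ge> 0" using W A by (simp add: c_def)
  have step': "M (k + 1) \<le> 2 powr q * W * Z powr (1 / ?n) * b k" for k
  proof -
    have "M k powr (1 / ?n) \<le> Z powr (1 / ?n)" using MZ M0 by (intro powr_mono2) auto
    then have "2 powr q * W * M k powr (1 / ?n) * b k \<le> 2 powr q * W * Z powr (1 / ?n) * b k"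
      using W b0 by (intro mult_right_mono mult_left_mono) auto
    with step[of k] show ?thesis by linarith
  qed
  have bA: "b k \<le> 2 * A" for k using bsum[of "{k}"] by simp
  have "M k \<le> c * Z powr (1 / ?n)" for k
  proof -
    have "M k \<le> 2 powr q * W * Z powr (1 / ?n) * b (k - 1)" using step'[of "k - 1"] by simp
    also have "\<dots> \<le> 2 powr q * W * Z powr (1 / ?n) * (2 * A)" using bA W by (intro mult_left_mono) auto
    finally show ?thesis by (simp add: c_def mult_ac)
  qed
  then have Zc: "Z \<le> c * Z powr (1 / ?n)" unfolding Z_def by (intro cSUP_least) auto
  have Zle: "Z powr (1 / ?n) \<le> c powr (q - 1)"
  proof (cases "Z = 0")
    case False
    then have Zp: "Z > 0" using Z0 by simp
    have "Z = Z powr (1 - 1 / ?n) * Z powr (1 / ?n)" using Zp by (simp flip: powr_add)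
    then have "Z powr (1 - 1 / ?n) \<le> c" using Zc Zp
      by (metis mult_right_le_imp_le powr_gt_zero less_irrefl)
    then have "(Z powr (1 - 1 / ?n)) powr (q / ?n) \<le> c powr (q / ?n)" using q1 by (intro powr_mono2) auto
    moreover have "(1 - 1 / ?n) * (q / ?n) = 1 / ?n" using qn(2) by (metis mult.commute times_divide_eq_right)
    ultimately show ?thesis by (simp only: powr_powr qn(1))
  qed (use n2 in simp)
  have "(\<Sum>k\<in>I. M (k + 1)) \<le> (\<Sum>k\<in>I. 2 powr q * W * Z powr (1 / ?n) * b k)"
    by (rule sum_mono) (rule step')
  also have "\<dots> = 2 powr q * W * Z powr (1 / ?n) * (\<Sum>k\<in>I. b k)" by (simp add: sum_distrib_left)
  also have "\<dots> \<le> 2 powr q * W * Z powr (1 / ?n) * (2 * A)" using bsum[OF I] W by (intro mult_left_mono) auto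
  also have "\<dots> = c * Z powr (1 / ?n)" by (simp add: c_def)
  also have "\<dots> \<le> c * c powr (q - 1)" using Zle c0 by (rule mult_left_mono)
  also have "\<dots> = c powr q" using c0 q1 by (cases "c = 0") (auto simp: powr_diff)
  also have "c = 2 powr (q + 1) * weak_const DIM('a) * A" by (simp add: c_def W_def powr_add)
  finally show ?thesis by (simp add: M_def m_def A_def)
qed

text \<open>The inequality of Gagliardo, Nirenberg and Sobolev.  Values of \<open>f\<close> below \<open>2^(-j)\<close> contribute at
  most \<open>2^(-q j)\<close> times the measure of the support, which vanishes in the limit.\<close>

theorem sobolev_L1:
  fixes f :: "'a::euclidean_space \<Rightarrow> real"
  assumes f: "C1_compact S f G" and f0: "\<And>x. 0 \<le> f x" and n2: "DIM('a) \<ge> 2"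
    and q: "q = real DIM('a) / (real DIM('a) - 1)"
  shows "(\<integral>x. f x powr q \<partial>lborel) \<le> (sobolev_const DIM('a) * (\<integral>x. norm (G x) \<partial>lborel)) powr q"
proof -
  define W where "W = weak_const DIM('a)"
  have W: "W > 0" by (simp add: W_def weak_const_pos)
  define A where "A = (\<integral>x. norm (G x) \<partial>lborel)"
  have A: "A \<ge> 0" by (simp add: A_def)
  have q1: "q > 1" using n2 by (simp add: q field_simps)
  obtain K where K: "compact K" "\<And>x. x \<notin> K \<Longrightarrow> f x = 0"
    using C1_compact_support[OF f] by blast
  have Kf: "K \<in> fmeasurable lborel"
    using K(1) emeasure_compact_finite[OF K(1)] by (auto simp: fmeasurable_def intro: borel_closed compact_imp_closed)
  obtain F where F: "F \<ge> 0" "\<And>x. \<bar>f x\<bar> \<le> F"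
    using bounded_compact_support[OF C1_compactD(3)[OF f] K] by blast
  define J where "J = max 0 \<lceil>log 2 (F + 1)\<rceil>"
  have "F + 1 = 2 powr log 2 (F + 1)" using F by simp
  also have "\<dots> \<le> 2 powr real_of_int J" unfolding J_def by (intro powr_mono) linarith+
  finally have FJ: "F \<le> 2 powr real_of_int J" by simp
  have contf: "continuous_on UNIV (\<lambda>x. f x powr q)"
    using C1_compactD(3)[OF f] f0 q1 by (intro continuous_on_powr') auto
  have int: "integrable lborel (\<lambda>x. f x powr q)"
    by (rule integrable_compact_support[OF contf K(1)]) (simp add: K(2))
  have bound: "(\<integral>x. f x powr q \<partial>lborel) \<le> 2 powr q * (2 powr (q + 1) * W * A) powr q + 2 powr (q * real_of_int (- int j)) * measure lborel K" for j
  proof -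
    let ?I = "{- int j..J}"
    let ?g = "\<lambda>x. (\<Sum>k\<in>?I. 2 powr (q * (real_of_int k + 1)) * indicator {x. 2 powr real_of_int k \<le> f x} x) + 2 powr (q * real_of_int (- int j)) * indicator K x"
    have i: "integrable lborel (\<lambda>x. indicator {x. 2 powr real_of_int k \<le> f x} x :: real)" for k
    proof (rule integrable_real_indicator)
      have pos: "0 < 2 powr real_of_int k" by simp
      show "{x. 2 powr real_of_int k \<le> f x} \<in> sets lborel" by (rule emeasure_superlevel(2)[OF f pos])
      show "emeasure lborel {x. 2 powr real_of_int k \<le> f x} < \<infinity>"
        by (subst emeasure_superlevel(1)[OF f pos]) simp
    qed
    have iK: "integrable lborel (\<lambda>x. indicator K x :: real)" using Kf by (intro integrable_real_indicator) (auto simp: fmeasurable_def)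
    have "(\<integral>x. f x powr q \<partial>lborel) \<le> (\<integral>x. ?g x \<partial>lborel)"
    proof (rule integral_mono[OF int])
      show "integrable lborel ?g"
        by (intro Bochner_Integration.integrable_add Bochner_Integration.integrable_sum integrable_mult_right i iK)
      show "f x powr q \<le> ?g x" for x
      proof (cases "x \<in> K")
        case True
        have "f x powr q \<le> (\<Sum>k\<in>?I. 2 powr (q * (real_of_int k + 1)) * indicator {y. 2 powr real_of_int k \<le> y} (f x)) + 2 powr (q * real_of_int (- int j))"
          by (rule powr_le_dyadic_sum) (use q1 f0 F FJ in \<open>auto simp: J_def intro: order_trans[OF abs_ge_self order_trans[OF F(2)]]\<close>)
        then show ?thesis using True by (simp add: indicator_def)
      next
        case False
        then show ?thesis using K(2) q1 by (auto intro!: sum_nonneg)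
      qed
    qed
    also have "\<dots> = (\<Sum>k\<in>?I. 2 powr (q * (real_of_int k + 1)) * measure lborel {x. 2 powr real_of_int k \<le> f x}) + 2 powr (q * real_of_int (- int j)) * measure lborel K"
    proof (subst Bochner_Integration.integral_add)
      show "integrable lborel (\<lambda>x. \<Sum>k\<in>?I. 2 powr (q * (real_of_int k + 1)) * indicator {x. 2 powr real_of_int k \<le> f x} x)"
        by (intro Bochner_Integration.integrable_sum integrable_mult_right i)
      show "integrable lborel (\<lambda>x. 2 powr (q * real_of_int (- int j)) * indicator K x)"
        by (intro integrable_mult_right iK)
      have "(\<integral>x. (\<Sum>k\<in>?I. 2 powr (q * (real_of_int k + 1)) * indicator {x. 2 powr real_of_int k \<le> f x} x) \<partial>lborel)
          = (\<Sum>k\<in>?I. (\<integral>x. 2 powr (q * (real_of_int k + 1)) * indicator {x. 2 powr real_of_int k \<le> f x} x \<partial>lborel))"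
        by (intro Bochner_Integration.integral_sum integrable_mult_right i)
      also have "\<dots> = (\<Sum>k\<in>?I. 2 powr (q * (real_of_int k + 1)) * measure lborel {x. 2 powr real_of_int k \<le> f x})"
        by (intro sum.cong refl) simp
      finally have "(\<integral>x. (\<Sum>k\<in>?I. 2 powr (q * (real_of_int k + 1)) * indicator {x. 2 powr real_of_int k \<le> f x} x) \<partial>lborel)
          = (\<Sum>k\<in>?I. 2 powr (q * (real_of_int k + 1)) * measure lborel {x. 2 powr real_of_int k \<le> f x})" .
      moreover have "(\<integral>x. 2 powr (q * real_of_int (- int j)) * indicator K x \<partial>lborel) = 2 powr (q * real_of_int (- int j)) * measure lborel K"
        by simp
      ultimately show "(\<integral>x. (\<Sum>k\<in>?I. 2 powr (q * (real_of_int k + 1)) * indicator {x. 2 powr real_of_int k \<le> f x} x) \<partial>lborel)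
          + (\<integral>x. 2 powr (q * real_of_int (- int j)) * indicator K x \<partial>lborel)
          = (\<Sum>k\<in>?I. 2 powr (q * (real_of_int k + 1)) * measure lborel {x. 2 powr real_of_int k \<le> f x}) + 2 powr (q * real_of_int (- int j)) * measure lborel K"
        by (simp only:)
    qed
    also have "(\<Sum>k\<in>?I. 2 powr (q * (real_of_int k + 1)) * measure lborel {x. 2 powr real_of_int k \<le> f x})
       = 2 powr q * (\<Sum>k\<in>?I. 2 powr (q * real_of_int k) * measure lborel {x. 2 powr real_of_int k \<le> f x})"
      by (simp add: sum_distrib_left powr_add distrib_left mult_ac)
    also have "(\<Sum>k\<in>?I. 2 powr (q * real_of_int k) * measure lborel {x. 2 powr real_of_int k \<le> f x})
       = (\<Sum>k\<in>(\<lambda>k. k - 1) ` ?I. 2 powr (q * real_of_int (k + 1)) * measure lborel {x. 2 powr real_of_int (k + 1) \<le> f x})"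
      by (subst sum.reindex) (auto simp: inj_on_def)
    also have "\<dots> \<le> (2 powr (q + 1) * W * A) powr q"
      unfolding W_def A_def by (rule sobolev_L1_dyadic[OF f f0 n2 q]) simp
    finally show ?thesis by simp
  qed
  have lim: "(\<lambda>j. 2 powr (q * real_of_int (- int j))) \<longlonglongrightarrow> 0"
  proof -
    have eq: "2 powr (q * real_of_int (- int j)) = (2 powr (- q)) ^ j" for j
      by (simp add: powr_realpow[symmetric] powr_powr)
    have "2 powr (- q) < 2 powr 0" using q1 by (intro powr_less_mono) auto
    then show ?thesis unfolding eq by (intro LIMSEQ_power_zero) auto
  qed
  have "(\<lambda>j. 2 powr q * (2 powr (q + 1) * W * A) powr q + 2 powr (q * real_of_int (- int j)) * measure lborel K)
      \<longlonglongrightarrow> 2 powr q * (2 powr (q + 1) * W * A) powr q + 0 * measure lborel K"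
    by (intro tendsto_intros lim)
  then have "(\<integral>x. f x powr q \<partial>lborel) \<le> 2 powr q * (2 powr (q + 1) * W * A) powr q + 0 * measure lborel K"
    by (rule LIMSEQ_le_const) (use bound in blast)
  also have "\<dots> = (2 * (2 powr (q + 1) * W * A)) powr q" using W A by (subst powr_mult) auto
  also have "2 * (2 powr (q + 1) * W * A) = sobolev_const DIM('a) * A"
    by (simp add: sobolev_const_def W_def q[symmetric] powr_add)
  finally show ?thesis by (simp add: A_def)
qed

section \<open>Hardy and Rellich inequalities with power weights\<close>

lemma integral_Cauchy_Schwarz:
  fixes f g :: "'a \<Rightarrow> real"
  assumes [measurable]: "f \<in> borel_measurable M" "g \<in> borel_measurable M"
    and f2: "integrable M (\<lambda>x. (f x)\<^sup>2)" and g2: "integrable M (\<lambda>x. (g x)\<^sup>2)"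
  shows "integrable M (\<lambda>x. f x * g x)"
    and "(\<integral>x. f x * g x \<partial>M)\<^sup>2 \<le> (\<integral>x. (f x)\<^sup>2 \<partial>M) * (\<integral>x. (g x)\<^sup>2 \<partial>M)"
proof -
  show fg: "integrable M (\<lambda>x. f x * g x)"
  proof (rule Bochner_Integration.integrable_bound)
    show "integrable M (\<lambda>x. (f x)\<^sup>2 + (g x)\<^sup>2)" using f2 g2 by (rule Bochner_Integration.integrable_add)
    show "AE x in M. norm (f x * g x) \<le> norm ((f x)\<^sup>2 + (g x)\<^sup>2)"
    proof (rule AE_I2)
      fix x
      have "0 \<le> (\<bar>f x\<bar> - \<bar>g x\<bar>)\<^sup>2" by simp
      then have "2 * (\<bar>f x\<bar> * \<bar>g x\<bar>) \<le> (f x)\<^sup>2 + (g x)\<^sup>2" by (simp add: power2_diff mult.assoc)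
      moreover have "0 \<le> \<bar>f x\<bar> * \<bar>g x\<bar>" by simp
      ultimately have "\<bar>f x\<bar> * \<bar>g x\<bar> \<le> (f x)\<^sup>2 + (g x)\<^sup>2" by linarith
      then show "norm (f x * g x) \<le> norm ((f x)\<^sup>2 + (g x)\<^sup>2)" by (simp add: abs_mult)
    qed
  qed simp
  define A where "A = (\<integral>x. (f x)\<^sup>2 \<partial>M)"
  define B where "B = (\<integral>x. f x * g x \<partial>M)"
  define C where "C = (\<integral>x. (g x)\<^sup>2 \<partial>M)"
  have pos: "0 \<le> A + 2 * t * B + t\<^sup>2 * C" for t
  proof -
    have "0 \<le> (\<integral>x. (f x + t * g x)\<^sup>2 \<partial>M)" by simp
    also have "\<dots> = (\<integral>x. (f x)\<^sup>2 + (2 * t) * (f x * g x) + t\<^sup>2 * (g x)\<^sup>2 \<partial>M)"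
      by (intro Bochner_Integration.integral_cong refl) (simp add: power2_eq_square algebra_simps)
    also have "\<dots> = A + (2 * t) * B + t\<^sup>2 * C"
      unfolding A_def B_def C_def using f2 g2 fg by simp
    finally show ?thesis by simp
  qed
  have "C \<ge> 0" by (simp add: C_def)
  have "B\<^sup>2 \<le> A * C"
  proof (cases "C = 0")
    case True
    have "B = 0"
    proof (rule ccontr)
      assume "B \<noteq> 0"
      then have "2 * (- (A + 1) / (2 * B)) * B = - (A + 1)" by (simp add: field_simps)
      then show False using pos[of "- (A + 1) / (2 * B)"] True by simp
    qed
    then show ?thesis using True by simp
  next
    case False
    then have C: "C > 0" using \<open>C \<ge> 0\<close> by simp
    have "A + 2 * (- B / C) * B + (- B / C)\<^sup>2 * C = A - B\<^sup>2 / C"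
      using C by (simp add: power2_eq_square field_simps)
    then have "B\<^sup>2 / C \<le> A" using pos[of "- B / C"] by simp
    then show ?thesis using C by (simp add: field_simps)
  qed
  then show "(\<integral>x. f x * g x \<partial>M)\<^sup>2 \<le> (\<integral>x. (f x)\<^sup>2 \<partial>M) * (\<integral>x. (g x)\<^sup>2 \<partial>M)"
    by (simp add: A_def B_def C_def)
qed

text \<open>Of the second derivatives only the pure ones are recorded, as the Laplacian is their sum.\<close>

definition C2_compact ::
  "'a::euclidean_space set \<Rightarrow> ('a \<Rightarrow> real) \<Rightarrow> ('a \<Rightarrow> 'a) \<Rightarrow> ('a \<Rightarrow> 'a \<Rightarrow> real) \<Rightarrow> bool" where
  "C2_compact S f G L \<longleftrightarrow> C1_compact S f G \<and>
     (\<forall>b\<in>Basis. continuous_on UNIV (L b) \<and>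
        (\<forall>x. ((\<lambda>t. b \<bullet> G (x + t *\<^sub>R b)) has_real_derivative L b x) (at 0)))"

lemma C2_compactD:
  assumes "C2_compact S f G L"
  shows "C1_compact S f G"
    "b \<in> Basis \<Longrightarrow> continuous_on UNIV (L b)"
    "b \<in> Basis \<Longrightarrow> ((\<lambda>t. b \<bullet> G (x + t *\<^sub>R b)) has_real_derivative L b x) (at 0)"
  using assms by (auto simp: C2_compact_def)

abbreviation Lap :: "('a::euclidean_space \<Rightarrow> 'a \<Rightarrow> real) \<Rightarrow> 'a \<Rightarrow> real" where
  "Lap L x \<equiv> (\<Sum>b\<in>Basis. L b x)"

lemma continuous_Lap: "C2_compact S f G L \<Longrightarrow> continuous_on UNIV (Lap L)"
  by (intro continuous_intros C2_compactD(2))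

lemma C2_compact_support:
  assumes f: "C2_compact S f G L"
  shows "\<exists>K. compact K \<and> K \<subseteq> S \<and> (\<forall>x. x \<notin> K \<longrightarrow> f x = 0 \<and> G x = 0 \<and> (\<forall>b\<in>Basis. L b x = 0) \<and> Lap L x = 0)"
proof -
  obtain K where K: "compact K" "K \<subseteq> S" "\<And>x. x \<notin> K \<Longrightarrow> f x = 0" "\<And>x. x \<notin> K \<Longrightarrow> G x = 0"
    using C1_compact_support[OF C2_compactD(1)[OF f]] by blast
  have L0: "L b x = 0" if "x \<notin> K" "b \<in> Basis" for x b
    by (rule directional_derivative_outside_support[OF C2_compactD(3)[OF f that(2)] compact_imp_closed[OF K(1)] _ that(1)])
      (simp add: K(4))
  show ?thesis
    by (rule exI[of _ K]) (simp add: K L0)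
qed

text \<open>Green's first identity: in each coordinate direction \<open>b\<close> the derivative of \<open>w (b \<bullet> G)\<close> has
  integral zero.\<close>

lemma integral_Green:
  fixes w f :: "'a::euclidean_space \<Rightarrow> real"
  assumes w: "C1_compact S w W" and f: "C2_compact T f G L"
  shows "(\<integral>x. w x * Lap L x + W x \<bullet> G x \<partial>lborel) = 0"
proof -
  obtain K where K: "compact K" "\<And>x. x \<notin> K \<Longrightarrow> w x = 0" "\<And>x. x \<notin> K \<Longrightarrow> W x = 0"
    using C1_compact_support[OF w] by blast
  note cont = C1_compactD(2,3)[OF w] C1_compactD(2)[OF C2_compactD(1)[OF f]] C2_compactD(2)[OF f]
  let ?F = "\<lambda>b x. w x * L b x + (b \<bullet> W x) * (b \<bullet> G x)"
  have i: "integrable lborel (?F b)" and z: "(\<integral>x. ?F b x \<partial>lborel) = 0" if b: "b \<in> Basis" for b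
  proof -
    have c: "continuous_on UNIV (?F b)" by (intro continuous_intros cont b)
    show "integrable lborel (?F b)"
      by (rule integrable_compact_support[OF c K(1)]) (simp add: K)
    show "(\<integral>x. ?F b x \<partial>lborel) = 0"
    proof (rule integral_directional_derivative_eq_0[where F = "\<lambda>x. w x * (b \<bullet> G x)" and b = b and K = K])
      show "((\<lambda>t. w (x + t *\<^sub>R b) * (b \<bullet> G (x + t *\<^sub>R b))) has_real_derivative ?F b x) (at 0)" for x
        by (rule derivative_eq_intros C1_compactD(4)[OF w] C2_compactD(3)[OF f b] refl)+ simp
      show "continuous_on UNIV (\<lambda>x. w x * (b \<bullet> G x))" by (intro continuous_intros cont)
    qed (use K c in simp_all)
  qed
  have "W x \<bullet> G x = (\<Sum>b\<in>Basis. (b \<bullet> W x) * (b \<bullet> G x))" for x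
    by (subst euclidean_inner) (simp add: inner_commute)
  then have "w x * Lap L x + W x \<bullet> G x = (\<Sum>b\<in>Basis. ?F b x)" for x
    by (simp add: sum.distrib sum_distrib_left)
  then have "(\<integral>x. w x * Lap L x + W x \<bullet> G x \<partial>lborel) = (\<integral>x. (\<Sum>b\<in>Basis. ?F b x) \<partial>lborel)"
    by simp
  also have "\<dots> = (\<Sum>b\<in>Basis. (\<integral>x. ?F b x \<partial>lborel))"
    by (rule Bochner_Integration.integral_sum) (rule i)
  also have "\<dots> = 0" by (simp add: z)
  finally show ?thesis .
qed

text \<open>The divergence theorem for the vector field \<open>w(x) x\<close>.  With a power weight in \<open>w\<close> it leads to
  Hardy's inequality.\<close>

lemma integral_radial_divergence:
  fixes w :: "'a::euclidean_space \<Rightarrow> real"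
  assumes w: "C1_compact S w W"
  shows "(\<integral>x. real DIM('a) * w x + x \<bullet> W x \<partial>lborel) = 0"
proof -
  obtain K where K: "compact K" "\<And>x. x \<notin> K \<Longrightarrow> w x = 0" "\<And>x. x \<notin> K \<Longrightarrow> W x = 0"
    using C1_compact_support[OF w] by blast
  note cont = C1_compactD(2,3)[OF w]
  let ?F = "\<lambda>b x. w x + (x \<bullet> b) * (b \<bullet> W x)"
  have i: "integrable lborel (?F b)" and z: "(\<integral>x. ?F b x \<partial>lborel) = 0" if b: "b \<in> Basis" for b :: 'a
  proof -
    have c: "continuous_on UNIV (?F b)" by (intro continuous_intros cont)
    show "integrable lborel (?F b)"
      by (rule integrable_compact_support[OF c K(1)]) (simp add: K)
    show "(\<integral>x. ?F b x \<partial>lborel) = 0"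
    proof (rule integral_directional_derivative_eq_0[where F = "\<lambda>x. w x * (x \<bullet> b)" and b = b and K = K])
      show "((\<lambda>t. w (x + t *\<^sub>R b) * ((x + t *\<^sub>R b) \<bullet> b)) has_real_derivative ?F b x) (at 0)" for x
      proof -
        have "((\<lambda>t. (x + t *\<^sub>R b) \<bullet> b) has_real_derivative 1) (at 0)"
          using b by (auto simp: inner_add_left inner_Basis intro!: derivative_eq_intros)
        from DERIV_mult[OF C1_compactD(4)[OF w] this, of x]
        show ?thesis by (simp add: algebra_simps)
      qed
      show "continuous_on UNIV (\<lambda>x. w x * (x \<bullet> b))" by (intro continuous_intros cont)
    qed (use K c in simp_all)
  qed
  have "real DIM('a) * w x + x \<bullet> W x = (\<Sum>b\<in>Basis. ?F b x)" for x
    by (simp add: sum.distrib euclidean_inner[of x] inner_commute)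
  then have "(\<integral>x. real DIM('a) * w x + x \<bullet> W x \<partial>lborel) = (\<integral>x. (\<Sum>b\<in>Basis. ?F b x) \<partial>lborel)"
    by simp
  also have "\<dots> = (\<Sum>b\<in>Basis. (\<integral>x. ?F b x \<partial>lborel))"
    by (rule Bochner_Integration.integral_sum) (rule i)
  also have "\<dots> = 0" by (simp add: z)
  finally show ?thesis .
qed

lemma GDERIV_norm_powr:
  fixes x :: "'a::euclidean_space"
  assumes "x \<noteq> 0"
  shows "GDERIV (\<lambda>x. norm x powr s) x :> (s * norm x powr (s - 2)) *\<^sub>R x"
proof -
  have "DERIV (\<lambda>y. y powr s) (norm x) :> s * norm x powr (s - 1)"
    using assms by (auto intro!: derivative_eq_intros)
  from GDERIV_DERIV_compose[OF GDERIV_norm[OF assms] this]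
  have "GDERIV (\<lambda>x. norm x powr s) x :> (s * norm x powr (s - 1)) *\<^sub>R sgn x" .
  moreover have "norm x powr (s - 1) / norm x = norm x powr (s - 2)"
    using assms powr_diff[of "norm x" "s - 1" 1] by simp
  ultimately show ?thesis by (simp add: sgn_div_norm divide_inverse mult.assoc)
qed

text \<open>The weight is singular only at the origin, and \<open>f\<close> vanishes near the origin.\<close>

lemma continuous_on_norm_powr_scaleR:
  fixes f :: "'a::euclidean_space \<Rightarrow> 'b::real_normed_vector"
  assumes f: "continuous_on UNIV f" and K: "compact K" "0 \<notin> K" "\<And>x. x \<notin> K \<Longrightarrow> f x = 0"
  shows "continuous_on UNIV (\<lambda>x. norm x powr s *\<^sub>R f x)"
proof -
  have 1: "continuous_on (- {0}) (\<lambda>x. norm x powr s *\<^sub>R f x)"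
    by (intro continuous_intros continuous_on_subset[OF f]) auto
  have 2: "continuous_on (- K) (\<lambda>x. norm x powr s *\<^sub>R f x)"
    by (rule continuous_on_eq[of _ "\<lambda>x. 0"]) (auto simp: K)
  have "- {0} \<union> - K = UNIV" using K by auto
  then show ?thesis
    using continuous_on_open_Un[OF _ _ 1 2] compact_imp_closed[OF K(1)] by (simp add: open_Compl)
qed

lemma continuous_on_norm_powr_mult:
  fixes f :: "'a::euclidean_space \<Rightarrow> real"
  assumes f: "continuous_on UNIV f" and K: "compact K" "0 \<notin> K" "\<And>x. x \<notin> K \<Longrightarrow> f x = 0"
  shows "continuous_on UNIV (\<lambda>x. norm x powr s * f x)"
  using continuous_on_norm_powr_scaleR[OF assms] by simp

lemma integrable_norm_powr_mult:
  fixes f :: "'a::euclidean_space \<Rightarrow> real"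
  assumes f: "continuous_on UNIV f" and K: "compact K" "0 \<notin> K" "\<And>x. x \<notin> K \<Longrightarrow> f x = 0"
  shows "integrable lborel (\<lambda>x. norm x powr s * f x)"
  by (rule integrable_compact_support[OF continuous_on_norm_powr_mult[OF assms] K(1)]) (simp_all add: K(3))

lemma C1_compact_norm_powr_mult:
  fixes f :: "'a::euclidean_space \<Rightarrow> real"
  assumes f: "C1_compact S f G" and S: "0 \<notin> S"
  shows "C1_compact S (\<lambda>x. norm x powr s * f x)
     (\<lambda>x. norm x powr s *\<^sub>R G x + norm x powr (s - 2) *\<^sub>R ((s * f x) *\<^sub>R x))"
  unfolding C1_compact_def
proof (intro conjI allI)
  obtain K where K: "compact K" "K \<subseteq> S" "\<And>x. x \<notin> K \<Longrightarrow> f x = 0" "\<And>x. x \<notin> K \<Longrightarrow> G x = 0"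
    using C1_compact_support[OF f] by blast
  have K0: "0 \<notin> K" using K S by blast
  show "\<exists>K. compact K \<and> K \<subseteq> S \<and> (\<forall>x. x \<notin> K \<longrightarrow> norm x powr s * f x = 0)"
    by (rule exI[of _ K]) (simp add: K)
  show "continuous_on UNIV (\<lambda>x. norm x powr s *\<^sub>R G x + norm x powr (s - 2) *\<^sub>R ((s * f x) *\<^sub>R x))"
    by (intro continuous_on_add continuous_on_norm_powr_scaleR[OF _ K(1) K0] continuous_intros C1_compactD[OF f]) (simp_all add: K)
  show "GDERIV (\<lambda>x. norm x powr s * f x) x :> norm x powr s *\<^sub>R G x + norm x powr (s - 2) *\<^sub>R ((s * f x) *\<^sub>R x)" for x
  proof (cases "x = 0")
    case False
    from GDERIV_mult[OF GDERIV_norm_powr[OF False, of s] C1_compactD(1)[OF f]]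
    show ?thesis by (simp add: mult_ac)
  next
    case True
    have "GDERIV (\<lambda>x. 0) x :> 0" by (rule GDERIV_const)
    then have "((\<lambda>x. 0) has_derivative (\<lambda>h. h \<bullet> 0)) (at x)" by (simp add: gderiv_def)
    then have "((\<lambda>x. norm x powr s * f x) has_derivative (\<lambda>h. h \<bullet> 0)) (at x)"
      by (rule has_derivative_transform_within_open[where s = "- K"])
        (use True K0 K compact_imp_closed[OF K(1)] in auto)
    then show ?thesis using True K(4)[OF K0] by (simp add: gderiv_def)
  qed
qed

text \<open>Away from the origin this is the product rule; near the origin everything vanishes.\<close>

lemma C2_compact_norm_powr_mult:
  fixes f :: "'a::euclidean_space \<Rightarrow> real"
  assumes f: "C2_compact S f G L" and S: "0 \<notin> S"
  shows "C2_compact S (\<lambda>x. norm x powr s * f x)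
     (\<lambda>x. norm x powr s *\<^sub>R G x + norm x powr (s - 2) *\<^sub>R ((s * f x) *\<^sub>R x))
     (\<lambda>b x. norm x powr s * L b x + norm x powr (s - 2) * (2 * s * ((x \<bullet> b) * (b \<bullet> G x)) + s * f x)
        + norm x powr (s - 4) * (s * (s - 2) * (x \<bullet> b)\<^sup>2 * f x))" (is "C2_compact _ _ ?G ?L")
  unfolding C2_compact_def
proof (intro conjI ballI allI)
  note f1 = C2_compactD(1)[OF f]
  show "C1_compact S (\<lambda>x. norm x powr s * f x) ?G"
    by (rule C1_compact_norm_powr_mult[OF f1 S])
  fix b :: 'a assume b: "b \<in> Basis"
  obtain K where K: "compact K" "K \<subseteq> S" "\<And>x. x \<notin> K \<Longrightarrow> f x = 0" "\<And>x. x \<notin> K \<Longrightarrow> G x = 0"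
      "\<And>x. x \<notin> K \<Longrightarrow> L b x = 0"
    using C2_compact_support[OF f] b by blast
  have K0: "0 \<notin> K" using K S by blast
  show "continuous_on UNIV (?L b)"
    by (intro continuous_on_add continuous_on_norm_powr_mult[OF _ K(1) K0] continuous_intros
          C1_compactD[OF f1] C2_compactD(2)[OF f b]) (simp_all add: K)
  show "((\<lambda>t. b \<bullet> ?G (x + t *\<^sub>R b)) has_real_derivative ?L b x) (at 0)" for x
  proof (cases "x = 0")
    case False
    have p: "((\<lambda>t. norm (x + t *\<^sub>R b) powr r) has_real_derivative r * norm x powr (r - 2) * (x \<bullet> b)) (at 0)" for r
      using GDERIV_along_line[of "\<lambda>x. norm x powr r" x 0 b "(r * norm x powr (r - 2)) *\<^sub>R x"] GDERIV_norm_powr[OF False, of r]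
      by (simp add: inner_commute[of b x])
    have i: "((\<lambda>t. b \<bullet> (x + t *\<^sub>R b)) has_real_derivative 1) (at 0)"
      using b by (auto simp: inner_add_right inner_Basis intro!: derivative_eq_intros)
    have d1: "((\<lambda>t. norm (x + t *\<^sub>R b) powr s * (b \<bullet> G (x + t *\<^sub>R b))
        + norm (x + t *\<^sub>R b) powr (s - 2) * (s * f (x + t *\<^sub>R b) * (b \<bullet> (x + t *\<^sub>R b)))) has_real_derivative
        s * norm x powr (s - 2) * (x \<bullet> b) * (b \<bullet> G x) + norm x powr s * L b x
        + ((s - 2) * norm x powr (s - 2 - 2) * (x \<bullet> b) * (s * f x * (b \<bullet> x))
        + norm x powr (s - 2) * (s * (b \<bullet> G x) * (b \<bullet> x) + s * f x))) (at 0)"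
      by (rule derivative_eq_intros p i C1_compactD(4)[OF f1] C2_compactD(3)[OF f b] refl)+ (simp add: algebra_simps)
    have e1: "s * norm x powr (s - 2) * (x \<bullet> b) * (b \<bullet> G x) + norm x powr s * L b x
        + ((s - 2) * norm x powr (s - 2 - 2) * (x \<bullet> b) * (s * f x * (b \<bullet> x))
        + norm x powr (s - 2) * (s * (b \<bullet> G x) * (b \<bullet> x) + s * f x)) = ?L b x"
      by (simp add: inner_commute[of b x] power2_eq_square algebra_simps)
    show ?thesis using d1 unfolding e1 by (simp only: inner_add_right inner_scaleR_right mult.assoc)
  next
    case True
    let ?K = "(\<lambda>t. x + t *\<^sub>R b) -` K"
    have "((\<lambda>t. 0::real) has_real_derivative 0) (at 0)" by simp
    then have "((\<lambda>t. b \<bullet> ?G (x + t *\<^sub>R b)) has_real_derivative 0) (at 0)"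
    proof (rule has_field_derivative_transform_within_open[where S = "- ?K"])
      have "closed ?K" by (intro closed_vimage continuous_intros compact_imp_closed K)
      then show "open (- ?K)" by (rule open_Compl)
    qed (use True K0 K in auto)
    then show ?thesis using True K0 K by simp
  qed
qed

lemma Lap_norm_powr_mult:
  fixes x :: "'a::euclidean_space"
  shows "Lap (\<lambda>b x. norm x powr s * L b x + norm x powr (s - 2) * (2 * s * ((x \<bullet> b) * (b \<bullet> G x)) + s * f x)
        + norm x powr (s - 4) * (s * (s - 2) * (x \<bullet> b)\<^sup>2 * f x)) x
    = norm x powr s * Lap L x + norm x powr (s - 2) * (2 * s * (x \<bullet> G x) + s * (s + real DIM('a) - 2) * f x)"
proof -
  have 1: "(\<Sum>b\<in>Basis. (x \<bullet> b) * (b \<bullet> G x)) = x \<bullet> G x"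
    by (simp add: euclidean_inner[of x] inner_commute)
  have 2: "(\<Sum>b\<in>Basis. (x \<bullet> b)\<^sup>2) = (norm x)\<^sup>2"
    by (simp only: power2_norm_eq_inner) (subst euclidean_inner, simp add: power2_eq_square)
  have 3: "norm x powr (s - 4) * (norm x)\<^sup>2 = norm x powr (s - 2)"
    using powr_add[of "norm x" "s - 4" 2] by simp
  have "(\<Sum>b\<in>Basis. norm x powr s * L b x + norm x powr (s - 2) * (2 * s * ((x \<bullet> b) * (b \<bullet> G x)) + s * f x)
        + norm x powr (s - 4) * (s * (s - 2) * (x \<bullet> b)\<^sup>2 * f x))
     = norm x powr s * Lap L x + norm x powr (s - 2) * (2 * s * (\<Sum>b\<in>Basis. (x \<bullet> b) * (b \<bullet> G x)) + real DIM('a) * (s * f x))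
        + norm x powr (s - 4) * (s * (s - 2) * (\<Sum>b\<in>Basis. (x \<bullet> b)\<^sup>2) * f x)"
    by (simp add: sum.distrib sum_distrib_left sum_distrib_right distrib_left mult.assoc mult.left_commute)
  also have "\<dots> = norm x powr s * Lap L x + norm x powr (s - 2) * (2 * s * (x \<bullet> G x) + real DIM('a) * (s * f x))
        + (norm x powr (s - 4) * (norm x)\<^sup>2) * (s * (s - 2) * f x)"
    unfolding 1 2 by (simp add: mult_ac)
  finally show ?thesis unfolding 3 by (simp add: algebra_simps)
qed

lemma norm_powr_mult_norm_sq:
  fixes x :: "'a::euclidean_space"
  shows "norm x powr (s - 2) * ((x \<bullet> x) * y) = norm x powr s * (y::real)"
proof (cases "x = 0")
  case False
  then have "norm x powr (s - 2) * (x \<bullet> x) = norm x powr s"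
    using powr_add[of "norm x" "s - 2" 2] by (simp add: power2_norm_eq_inner)
  then show ?thesis by (metis mult.assoc)
qed simp

text \<open>Write \<open>D\<close> for the integral of \<open>|x|^(\<alpha>-4) u (x \<bullet> \<nabla>u)\<close>.  The divergence theorem for
  \<open>|x|^(\<alpha>-4) u\<^sup>2 x\<close> gives \<open>D = - c A\<close>.  Integrating the square of
  \<open>|x|^(\<alpha>/2-1) (\<nabla>u + c u x / |x|\<^sup>2)\<close> then gives Hardy's inequality \<open>c\<^sup>2 A \<le> B\<close>, and Green's
  identity with \<open>|x|^(\<alpha>-2) u\<close> gives \<open>B - (\<alpha> - 2) c A = - \<integral> |x|^(\<alpha>-2) u \<Delta>u\<close>.  As
  \<open>\<kappa> = c\<^sup>2 - (\<alpha> - 2) c\<close>, the left side is at least \<open>\<kappa> A\<close>, while the right side is at most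
  \<open>(\<kappa>/2) A + E / (2\<kappa>)\<close>.  Both \<open>c\<close> and \<open>\<kappa>\<close> are positive when \<open>4 - N < \<alpha> < N\<close>.\<close>

lemma weighted_Rellich:
  fixes u :: "'a::euclidean_space \<Rightarrow> real"
  assumes u: "C2_compact S u G L" and S: "0 \<notin> S"
    and c: "c = (real DIM('a) + \<alpha> - 4) / 2" "c > 0"
    and \<kappa>: "\<kappa> = c * (real DIM('a) - \<alpha>) / 2" "\<kappa> > 0"
  defines "A \<equiv> (\<integral>x. norm x powr (\<alpha> - 4) * (u x)\<^sup>2 \<partial>lborel)"
    and "B \<equiv> (\<integral>x. norm x powr (\<alpha> - 2) * (G x \<bullet> G x) \<partial>lborel)"
    and "E \<equiv> (\<integral>x. norm x powr \<alpha> * (Lap L x)\<^sup>2 \<partial>lborel)"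
  shows "A \<le> E / \<kappa>\<^sup>2" and "B \<le> (\<bar>\<alpha> - 2\<bar> * c / \<kappa>\<^sup>2 + 1 / \<kappa>) * E"
proof -
  let ?N = "real DIM('a)"
  note u1 = C2_compactD(1)[OF u]
  obtain K where K: "compact K" "K \<subseteq> S" "\<And>x. x \<notin> K \<Longrightarrow> u x = 0" "\<And>x. x \<notin> K \<Longrightarrow> G x = 0"
      "\<And>x. x \<notin> K \<Longrightarrow> Lap L x = 0"
    using C2_compact_support[OF u] by blast
  have K0: "0 \<notin> K" using K S by blast
  note cont = continuous_intros C1_compactD(2,3)[OF u1] continuous_Lap[OF u]
  define D where "D = (\<integral>x. norm x powr (\<alpha> - 4) * (u x * (x \<bullet> G x)) \<partial>lborel)"
  have iA: "integrable lborel (\<lambda>x. norm x powr (\<alpha> - 4) * (u x)\<^sup>2)"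
    by (rule integrable_norm_powr_mult[OF _ K(1) K0]) (auto intro!: cont simp: K)
  have iB: "integrable lborel (\<lambda>x. norm x powr (\<alpha> - 2) * (G x \<bullet> G x))"
    by (rule integrable_norm_powr_mult[OF _ K(1) K0]) (auto intro!: cont simp: K)
  have iE: "integrable lborel (\<lambda>x. norm x powr \<alpha> * (Lap L x)\<^sup>2)"
    by (rule integrable_norm_powr_mult[OF _ K(1) K0]) (auto intro!: cont simp: K)
  have iD: "integrable lborel (\<lambda>x. norm x powr (\<alpha> - 4) * (u x * (x \<bullet> G x)))"
    by (rule integrable_norm_powr_mult[OF _ K(1) K0]) (auto intro!: cont simp: K)
  have iH: "integrable lborel (\<lambda>x. norm x powr (\<alpha> - 2) * (u x * Lap L x))"
    by (rule integrable_norm_powr_mult[OF _ K(1) K0]) (auto intro!: cont simp: K)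
  define H where "H = (\<integral>x. norm x powr (\<alpha> - 2) * (u x * Lap L x) \<partial>lborel)"

  have "C1_compact S (\<lambda>x. (u x)\<^sup>2) (\<lambda>x. (2 * u x) *\<^sub>R G x)"
    by (rule C1_compact_compose[OF u1]) (auto intro!: derivative_eq_intros continuous_intros)
  from integral_radial_divergence[OF C1_compact_norm_powr_mult[OF this S, of "\<alpha> - 4"]]
  have "0 = (\<integral>x. ?N * (norm x powr (\<alpha> - 4) * (u x)\<^sup>2) + x \<bullet> (norm x powr (\<alpha> - 4) *\<^sub>R (2 * u x) *\<^sub>R G x
      + norm x powr (\<alpha> - 4 - 2) *\<^sub>R ((\<alpha> - 4) * (u x)\<^sup>2) *\<^sub>R x) \<partial>lborel)" by simp
  also have "\<dots> = (\<integral>x. 2 * c * (norm x powr (\<alpha> - 4) * (u x)\<^sup>2) + 2 * (norm x powr (\<alpha> - 4) * (u x * (x \<bullet> G x))) \<partial>lborel)"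
  proof (intro Bochner_Integration.integral_cong refl)
    fix x
    have N: "?N = 2 * c - \<alpha> + 4" using c(1) by simp
    have "norm x powr (\<alpha> - 4 - 2) * ((x \<bullet> x) * ((\<alpha> - 4) * (u x)\<^sup>2)) = norm x powr (\<alpha> - 4) * ((\<alpha> - 4) * (u x)\<^sup>2)"
      by (rule norm_powr_mult_norm_sq)
    then show "?N * (norm x powr (\<alpha> - 4) * (u x)\<^sup>2) + x \<bullet> (norm x powr (\<alpha> - 4) *\<^sub>R (2 * u x) *\<^sub>R G x
      + norm x powr (\<alpha> - 4 - 2) *\<^sub>R ((\<alpha> - 4) * (u x)\<^sup>2) *\<^sub>R x)
      = 2 * c * (norm x powr (\<alpha> - 4) * (u x)\<^sup>2) + 2 * (norm x powr (\<alpha> - 4) * (u x * (x \<bullet> G x)))"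
      unfolding N by (simp add: inner_add_right algebra_simps)
  qed
  also have "\<dots> = 2 * c * A + 2 * D" unfolding A_def D_def using iA iD by simp
  finally have D: "D = - c * A" by simp

  have "0 \<le> (\<integral>x. norm x powr (\<alpha> - 2) * (G x \<bullet> G x) + 2 * c * (norm x powr (\<alpha> - 4) * (u x * (x \<bullet> G x)))
      + c\<^sup>2 * (norm x powr (\<alpha> - 4) * (u x)\<^sup>2) \<partial>lborel)"
  proof (intro Bochner_Integration.integral_nonneg)
    fix x
    have 1: "norm x powr (\<alpha> - 4) * ((x \<bullet> x) * (G x \<bullet> G x)) = norm x powr (\<alpha> - 2) * (G x \<bullet> G x)"
      using norm_powr_mult_norm_sq[of x "\<alpha> - 2" "G x \<bullet> G x"] by simp
    have "0 \<le> (norm x * norm (G x) - c * \<bar>u x\<bar>)\<^sup>2" by simp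
    also have "\<dots> = (x \<bullet> x) * (G x \<bullet> G x) - 2 * c * (\<bar>u x\<bar> * (norm x * norm (G x))) + c\<^sup>2 * (u x)\<^sup>2"
      by (simp add: power2_diff power_mult_distrib power2_norm_eq_inner)
    also have "\<dots> \<le> (x \<bullet> x) * (G x \<bullet> G x) + 2 * c * (u x * (x \<bullet> G x)) + c\<^sup>2 * (u x)\<^sup>2"
    proof -
      have "\<bar>u x * (x \<bullet> G x)\<bar> \<le> \<bar>u x\<bar> * (norm x * norm (G x))"
        unfolding abs_mult by (intro mult_left_mono Cauchy_Schwarz_ineq2) simp
      then have "- (u x * (x \<bullet> G x)) \<le> \<bar>u x\<bar> * (norm x * norm (G x))" by linarith
      then have "2 * c * (- (u x * (x \<bullet> G x))) \<le> 2 * c * (\<bar>u x\<bar> * (norm x * norm (G x)))"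
        using c(2) by (intro mult_left_mono) auto
      then show ?thesis unfolding mult_minus_right by linarith
    qed
    finally have "0 \<le> norm x powr (\<alpha> - 4) * ((x \<bullet> x) * (G x \<bullet> G x) + 2 * c * (u x * (x \<bullet> G x)) + c\<^sup>2 * (u x)\<^sup>2)"
      by (intro mult_nonneg_nonneg) auto
    also have "\<dots> = norm x powr (\<alpha> - 2) * (G x \<bullet> G x) + 2 * c * (norm x powr (\<alpha> - 4) * (u x * (x \<bullet> G x)))
      + c\<^sup>2 * (norm x powr (\<alpha> - 4) * (u x)\<^sup>2)" unfolding 1[symmetric] by (simp add: algebra_simps)
    finally show "0 \<le> norm x powr (\<alpha> - 2) * (G x \<bullet> G x) + 2 * c * (norm x powr (\<alpha> - 4) * (u x * (x \<bullet> G x)))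
      + c\<^sup>2 * (norm x powr (\<alpha> - 4) * (u x)\<^sup>2)" .
  qed
  also have "\<dots> = B + 2 * c * D + c\<^sup>2 * A" unfolding A_def B_def D_def using iA iB iD by simp
  finally have "0 \<le> B + 2 * c * D + c\<^sup>2 * A" .
  moreover have "2 * c * D = - 2 * (c\<^sup>2 * A)" unfolding D by (simp add: power2_eq_square)
  ultimately have AB: "c\<^sup>2 * A \<le> B" by linarith

  from integral_Green[OF C1_compact_norm_powr_mult[OF u1 S, of "\<alpha> - 2"] u]
  have "0 = (\<integral>x. norm x powr (\<alpha> - 2) * u x * Lap L x + (norm x powr (\<alpha> - 2) *\<^sub>R G x
      + norm x powr (\<alpha> - 2 - 2) *\<^sub>R ((\<alpha> - 2) * u x) *\<^sub>R x) \<bullet> G x \<partial>lborel)" by simp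
  also have "\<dots> = (\<integral>x. norm x powr (\<alpha> - 2) * (u x * Lap L x) + norm x powr (\<alpha> - 2) * (G x \<bullet> G x)
      + (\<alpha> - 2) * (norm x powr (\<alpha> - 4) * (u x * (x \<bullet> G x))) \<partial>lborel)"
    by (intro Bochner_Integration.integral_cong refl) (simp add: inner_add_left algebra_simps)
  also have "\<dots> = H + B + (\<alpha> - 2) * D" unfolding H_def B_def D_def using iB iD iH by simp
  finally have HB: "- H = B - (\<alpha> - 2) * c * A" unfolding D by simp

  have "- H = (\<integral>x. - (norm x powr (\<alpha> - 2) * (u x * Lap L x)) \<partial>lborel)" unfolding H_def by simp
  also have "\<dots> \<le> (\<integral>x. (\<kappa> / 2) * (norm x powr (\<alpha> - 4) * (u x)\<^sup>2) + (1 / (2 * \<kappa>)) * (norm x powr \<alpha> * (Lap L x)\<^sup>2) \<partial>lborel)"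
  proof (rule integral_mono)
    show "integrable lborel (\<lambda>x. - (norm x powr (\<alpha> - 2) * (u x * Lap L x)))" using iH by simp
    show "integrable lborel (\<lambda>x. (\<kappa> / 2) * (norm x powr (\<alpha> - 4) * (u x)\<^sup>2) + (1 / (2 * \<kappa>)) * (norm x powr \<alpha> * (Lap L x)\<^sup>2))"
      by (intro Bochner_Integration.integrable_add integrable_mult_right iA iE)
    fix x
    define p where "p = norm x powr (\<alpha> / 2 - 2) * u x"
    define r where "r = norm x powr (\<alpha> / 2) * Lap L x"
    have 1: "norm x powr (\<alpha> - 4) * (u x)\<^sup>2 = p\<^sup>2" "norm x powr \<alpha> * (Lap L x)\<^sup>2 = r\<^sup>2"
      "norm x powr (\<alpha> - 2) * (u x * Lap L x) = p * r"
      using powr_add[of "norm x" "\<alpha> / 2 - 2" "\<alpha> / 2 - 2"] powr_add[of "norm x" "\<alpha> / 2" "\<alpha> / 2"]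
        powr_add[of "norm x" "\<alpha> / 2 - 2" "\<alpha> / 2"]
      by (simp_all add: p_def r_def power2_eq_square mult_ac)
    have "0 \<le> (\<kappa> * p + r)\<^sup>2 / (2 * \<kappa>)" using \<kappa>(2) by simp
    also have "\<dots> = (\<kappa> / 2) * p\<^sup>2 + (1 / (2 * \<kappa>)) * r\<^sup>2 + p * r"
      using \<kappa>(2) by (simp add: power2_eq_square field_simps)
    finally show "- (norm x powr (\<alpha> - 2) * (u x * Lap L x))
      \<le> (\<kappa> / 2) * (norm x powr (\<alpha> - 4) * (u x)\<^sup>2) + (1 / (2 * \<kappa>)) * (norm x powr \<alpha> * (Lap L x)\<^sup>2)"
      unfolding 1 by linarith
  qed
  also have "\<dots> = (\<kappa> / 2) * A + (1 / (2 * \<kappa>)) * E" unfolding A_def E_def using iA iE by simp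
  finally have Hle: "B - (\<alpha> - 2) * c * A \<le> (\<kappa> / 2) * A + (1 / (2 * \<kappa>)) * E" using HB by simp
  have A0: "A \<ge> 0" unfolding A_def by simp
  have "\<kappa> * A = c\<^sup>2 * A - (\<alpha> - 2) * c * A" unfolding \<kappa>(1) c(1) by (simp add: power2_eq_square field_simps)
  with AB Hle have "\<kappa> * A \<le> (\<kappa> / 2) * A + (1 / (2 * \<kappa>)) * E" by linarith
  then have "(\<kappa> / 2) * A \<le> (1 / (2 * \<kappa>)) * E" by linarith
  then show AE: "A \<le> E / \<kappa>\<^sup>2" using \<kappa>(2) by (simp add: power2_eq_square field_simps)
  have "(\<alpha> - 2) * c * A \<le> \<bar>\<alpha> - 2\<bar> * c * A" using c(2) A0 by (intro mult_right_mono) auto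
  also have "\<dots> \<le> \<bar>\<alpha> - 2\<bar> * c * (E / \<kappa>\<^sup>2)" using c(2) AE by (intro mult_left_mono) auto
  finally have 1: "(\<alpha> - 2) * c * A \<le> \<bar>\<alpha> - 2\<bar> * c / \<kappa>\<^sup>2 * E" by simp
  have "(\<kappa> / 2) * A \<le> (\<kappa> / 2) * (E / \<kappa>\<^sup>2)" using \<kappa>(2) AE by (intro mult_left_mono) auto
  also have "\<dots> = (1 / (2 * \<kappa>)) * E" using \<kappa>(2) by (simp add: power2_eq_square)
  finally have "B \<le> \<bar>\<alpha> - 2\<bar> * c / \<kappa>\<^sup>2 * E + 1 / \<kappa> * E" using 1 Hle by (simp add: field_simps)
  then show "B \<le> (\<bar>\<alpha> - 2\<bar> * c / \<kappa>\<^sup>2 + 1 / \<kappa>) * E" by (simp add: distrib_right)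
qed

section \<open>The second order Sobolev inequality\<close>

lemma DERIV_abs_powr:
  fixes p :: real
  assumes p: "p > 1"
  shows "((\<lambda>t. \<bar>t\<bar> powr p) has_real_derivative p * (sgn t * \<bar>t\<bar> powr (p - 1))) (at t)"
proof -
  consider "t > 0" | "t < 0" | "t = 0" by linarith
  then show ?thesis
  proof cases
    case 1
    have "((\<lambda>t. t powr p) has_real_derivative p * t powr (p - 1)) (at t)"
      using 1 by (auto intro!: derivative_eq_intros)
    then have "((\<lambda>t. \<bar>t\<bar> powr p) has_real_derivative p * t powr (p - 1)) (at t)"
      by (rule has_field_derivative_transform_within_open[where S = "{0<..}"]) (use 1 in auto)
    then show ?thesis using 1 by simp
  next
    case 2
    have "((\<lambda>t. (- t) powr p) has_real_derivative - (p * (- t) powr (p - 1))) (at t)"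
      using 2 by (auto intro!: derivative_eq_intros)
    then have "((\<lambda>t. \<bar>t\<bar> powr p) has_real_derivative - (p * (- t) powr (p - 1))) (at t)"
      by (rule has_field_derivative_transform_within_open[where S = "{..<0}"]) (use 2 in auto)
    then show ?thesis using 2 by simp
  next
    case 3
    have "((\<lambda>h. \<bar>h\<bar> powr p / h) \<longlongrightarrow> 0) (at (0::real))"
    proof (rule Lim_null_comparison)
      show "\<forall>\<^sub>F h in at (0::real). norm (\<bar>h\<bar> powr p / h) \<le> \<bar>h\<bar> powr (p - 1)"
        by (rule always_eventually) (auto simp: powr_diff)
      have "((\<lambda>h::real. \<bar>h\<bar> powr (p - 1)) \<longlongrightarrow> \<bar>0\<bar> powr (p - 1)) (at 0)"
        using p by (intro tendsto_powr' tendsto_intros) auto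
      then show "((\<lambda>h::real. \<bar>h\<bar> powr (p - 1)) \<longlongrightarrow> 0) (at 0)" by simp
    qed
    then show ?thesis using 3 by (simp add: DERIV_def)
  qed
qed

lemma continuous_on_abs_powr:
  assumes "p > (0::real)"
  shows "continuous_on A (\<lambda>t::real. \<bar>t\<bar> powr p)"
  using assms by (intro continuous_on_powr' continuous_intros) auto

lemma continuous_on_sgn_abs_powr:
  assumes p: "p > (0::real)"
  shows "continuous_on A (\<lambda>t::real. sgn t * \<bar>t\<bar> powr p)"
proof -
  have "isCont (\<lambda>t::real. sgn t * \<bar>t\<bar> powr p) t" for t
  proof (cases "t = 0")
    case False
    then show ?thesis by (intro continuous_intros) auto
  next
    case True
    have "((\<lambda>t::real. sgn t * \<bar>t\<bar> powr p) \<longlongrightarrow> 0) (at 0)"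
    proof (rule Lim_null_comparison)
      show "\<forall>\<^sub>F t in at (0::real). norm (sgn t * \<bar>t\<bar> powr p) \<le> \<bar>t\<bar> powr p"
        by (rule always_eventually) (auto simp: abs_mult abs_sgn_eq)
      have "((\<lambda>h::real. \<bar>h\<bar> powr p) \<longlongrightarrow> \<bar>0\<bar> powr p) (at 0)"
        using p by (intro tendsto_powr' tendsto_intros) auto
      then show "((\<lambda>h::real. \<bar>h\<bar> powr p) \<longlongrightarrow> 0) (at 0)" by simp
    qed
    then show ?thesis using True by (simp add: isCont_def)
  qed
  then show ?thesis by (intro continuous_at_imp_continuous_on) auto
qed

lemma DERIV_sgn_abs_powr:
  fixes p :: real
  assumes p: "p > 1"
  shows "((\<lambda>t. sgn t * \<bar>t\<bar> powr p) has_real_derivative p * \<bar>t\<bar> powr (p - 1)) (at t)"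
proof -
  consider "t > 0" | "t < 0" | "t = 0" by linarith
  then show ?thesis
  proof cases
    case 1
    then have "((\<lambda>t. \<bar>t\<bar> powr p) has_real_derivative p * \<bar>t\<bar> powr (p - 1)) (at t)"
      using DERIV_abs_powr[OF p, of t] by simp
    then show ?thesis
      by (rule has_field_derivative_transform_within_open[where S = "{0<..}"]) (use 1 in auto)
  next
    case 2
    then have "((\<lambda>t. - (\<bar>t\<bar> powr p)) has_real_derivative p * \<bar>t\<bar> powr (p - 1)) (at t)"
      using DERIV_minus[OF DERIV_abs_powr[OF p, of t]] by simp
    then show ?thesis
      by (rule has_field_derivative_transform_within_open[where S = "{..<0}"]) (use 2 in auto)
  next
    case 3
    have "((\<lambda>h. sgn h * \<bar>h\<bar> powr p / h) \<longlongrightarrow> 0) (at (0::real))"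
    proof (rule Lim_null_comparison)
      show "\<forall>\<^sub>F h in at (0::real). norm (sgn h * \<bar>h\<bar> powr p / h) \<le> \<bar>h\<bar> powr (p - 1)"
        by (rule always_eventually) (auto simp: powr_diff abs_mult abs_sgn_eq)
      have "((\<lambda>h::real. \<bar>h\<bar> powr (p - 1)) \<longlongrightarrow> \<bar>0\<bar> powr (p - 1)) (at 0)"
        using p by (intro tendsto_powr' tendsto_intros) auto
      then show "((\<lambda>h::real. \<bar>h\<bar> powr (p - 1)) \<longlongrightarrow> 0) (at 0)" by simp
    qed
    then show ?thesis using 3 by (simp add: DERIV_def)
  qed
qed

text \<open>Let \<open>M = \<integral> |v|^r\<close>, \<open>Q = \<integral> (\<Delta>v)\<^sup>2\<close> and \<open>\<gamma> = N / (N - 4) = r / 2\<close>.  Testing \<open>\<Delta>v\<close> with \<open>|v|^(\<gamma>-1) v\<close>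
  bounds \<open>P = \<integral> |v|^(\<gamma>-1) |\<nabla>v|\<^sup>2\<close> by \<open>\<surd>(M Q)\<close>.  The exponent \<open>s = 2 (N - 1) / (N - 4)\<close> has two
  properties: \<open>|v|^s\<close> to the power \<open>N / (N - 1)\<close> is \<open>|v|^r\<close>, and by Cauchy-Schwarz the gradient of
  \<open>|v|^s\<close> has integral at most \<open>s \<surd>(P M)\<close>.  The first order inequality for \<open>|v|^s\<close> thus bounds
  \<open>M^((N-1)/N)\<close> by a multiple of \<open>Q^(1/4) M^(3/4)\<close>, and the exponent on the left is the larger one.
  Second derivatives enter only through \<open>\<Delta>v\<close>.\<close>

lemma second_order_Sobolev:
  fixes v :: "'a::euclidean_space \<Rightarrow> real"
  assumes v: "C2_compact S v G L" and N: "DIM('a) \<ge> 5"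
    and r: "r = 2 * real DIM('a) / (real DIM('a) - 4)"
    and C: "C = sobolev_const DIM('a) * (2 * (real DIM('a) - 1) / (real DIM('a) - 4))"
  shows "(\<integral>x. \<bar>v x\<bar> powr r \<partial>lborel) \<le> (C ^ 4 * (\<integral>x. (Lap L x)\<^sup>2 \<partial>lborel)) powr (r / 2)"
proof -
  define n where "n = real DIM('a)"
  have n: "n \<ge> 5" using N by (simp add: n_def)
  note v1 = C2_compactD(1)[OF v]
  obtain K where K: "compact K" "K \<subseteq> S" "\<And>x. x \<notin> K \<Longrightarrow> v x = 0" "\<And>x. x \<notin> K \<Longrightarrow> G x = 0"
      "\<And>x. x \<notin> K \<Longrightarrow> Lap L x = 0"
    using C2_compact_support[OF v] by blast
  define \<gamma> where "\<gamma> = n / (n - 4)"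
  define s where "s = 2 * (n - 1) / (n - 4)"
  define q where "q = n / (n - 1)"
  have \<gamma>: "\<gamma> > 1" using n by (simp add: \<gamma>_def field_simps)
  have s: "s > 1" using n by (simp add: s_def field_simps)
  have q: "q > 0" using n by (simp add: q_def)
  have r2: "r = 2 * \<gamma>" by (simp add: r \<gamma>_def n_def)
  have r0: "r > 0" using r2 \<gamma> by simp
  have nz: "n - 1 \<noteq> 0" "n - 4 \<noteq> 0" using n by auto
  have sq: "s * q = r" using nz unfolding s_def q_def r n_def[symmetric] by (simp add: divide_simps)
  have sr: "2 * (s - 1) = (\<gamma> - 1) + r" using nz unfolding s_def \<gamma>_def r n_def[symmetric] by (simp add: divide_simps) (simp add: algebra_simps)
  define M where "M = (\<integral>x. \<bar>v x\<bar> powr r \<partial>lborel)"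
  define Q where "Q = (\<integral>x. (Lap L x)\<^sup>2 \<partial>lborel)"
  have M0: "M \<ge> 0" and Q0: "Q \<ge> 0" by (simp_all add: M_def Q_def)
  have ca: "continuous_on UNIV (\<lambda>x. \<bar>v x\<bar> powr p)" if "p > 0" for p
    using that by (intro continuous_on_compose2[OF continuous_on_abs_powr[OF that, of UNIV] C1_compactD(3)[OF v1]]) auto
  have csa: "continuous_on UNIV (\<lambda>x. sgn (v x) * \<bar>v x\<bar> powr p)" if "p > 0" for p
    using that by (intro continuous_on_compose2[OF continuous_on_sgn_abs_powr[OF that, of UNIV] C1_compactD(3)[OF v1]]) auto
  note cont = continuous_intros C1_compactD(2,3)[OF v1] continuous_Lap[OF v] ca csa
  have int: "integrable lborel f" if "continuous_on UNIV f" "\<And>x. x \<notin> K \<Longrightarrow> f x = 0" for f :: "'a \<Rightarrow> real"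
    by (rule integrable_compact_support[OF that(1) K(1) that(2)])
  have meas: "f \<in> borel_measurable lborel" if "continuous_on UNIV f" for f :: "'a \<Rightarrow> real"
    using borel_measurable_continuous_onI[OF that] by simp

  have w: "C1_compact S (\<lambda>x. sgn (v x) * \<bar>v x\<bar> powr \<gamma>) (\<lambda>x. (\<gamma> * \<bar>v x\<bar> powr (\<gamma> - 1)) *\<^sub>R G x)"
    by (rule C1_compact_compose[OF v1 DERIV_sgn_abs_powr[OF \<gamma>]])
      (use \<gamma> in \<open>auto intro!: continuous_intros continuous_on_abs_powr\<close>)
  define P where "P = (\<integral>x. \<bar>v x\<bar> powr (\<gamma> - 1) * (G x \<bullet> G x) \<partial>lborel)"
  define R where "R = (\<integral>x. (sgn (v x) * \<bar>v x\<bar> powr \<gamma>) * Lap L x \<partial>lborel)"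
  have iP: "integrable lborel (\<lambda>x. \<bar>v x\<bar> powr (\<gamma> - 1) * (G x \<bullet> G x))"
    using \<gamma> by (intro int cont) (auto simp: K)
  have iR: "integrable lborel (\<lambda>x. (sgn (v x) * \<bar>v x\<bar> powr \<gamma>) * Lap L x)"
    using \<gamma> by (intro int cont) (auto simp: K)
  have iM: "integrable lborel (\<lambda>x. \<bar>v x\<bar> powr r)"
    using r0 by (intro int cont) (auto simp: K)
  have iQ: "integrable lborel (\<lambda>x. (Lap L x)\<^sup>2)"
    by (intro int cont) (auto simp: K)
  have "0 = (\<integral>x. (sgn (v x) * \<bar>v x\<bar> powr \<gamma>) * Lap L x + \<gamma> * (\<bar>v x\<bar> powr (\<gamma> - 1) * (G x \<bullet> G x)) \<partial>lborel)"
    using integral_Green[OF w v] by (simp add: mult.assoc)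
  also have "\<dots> = R + \<gamma> * P"
    unfolding R_def P_def by (subst Bochner_Integration.integral_add[OF iR integrable_mult_right[OF iP]]) simp
  finally have RP: "\<gamma> * P = - R" by simp
  have sq1: "(sgn (v x) * \<bar>v x\<bar> powr \<gamma>)\<^sup>2 = \<bar>v x\<bar> powr r" for x
    by (simp add: power_mult_distrib r2 powr_add[of _ \<gamma> \<gamma>, folded mult_2] power2_eq_square sgn_if)
  have "R\<^sup>2 \<le> (\<integral>x. (sgn (v x) * \<bar>v x\<bar> powr \<gamma>)\<^sup>2 \<partial>lborel) * (\<integral>x. (Lap L x)\<^sup>2 \<partial>lborel)"
    unfolding R_def
  proof (rule integral_Cauchy_Schwarz)
    show "(\<lambda>x. sgn (v x) * \<bar>v x\<bar> powr \<gamma>) \<in> borel_measurable lborel" using \<gamma> by (intro meas cont) auto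
    show "Lap L \<in> borel_measurable lborel" by (intro meas continuous_Lap[OF v])
    show "integrable lborel (\<lambda>x. (sgn (v x) * \<bar>v x\<bar> powr \<gamma>)\<^sup>2)" unfolding sq1 by (rule iM)
  qed (rule iQ)
  then have R2: "R\<^sup>2 \<le> M * Q" unfolding sq1 M_def Q_def .
  have P0: "P \<ge> 0" unfolding P_def by simp
  have "P \<le> \<gamma> * P" using \<gamma> P0 mult_right_mono[of 1 \<gamma> P] by simp
  then have "P\<^sup>2 \<le> (\<gamma> * P)\<^sup>2" using P0 by (intro power_mono)
  then have P2: "P\<^sup>2 \<le> M * Q" using R2 unfolding RP by simp

  have g: "C1_compact S (\<lambda>x. \<bar>v x\<bar> powr s) (\<lambda>x. (s * (sgn (v x) * \<bar>v x\<bar> powr (s - 1))) *\<^sub>R G x)"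
    by (rule C1_compact_compose[OF v1 DERIV_abs_powr[OF s]])
      (use s in \<open>auto intro!: continuous_intros continuous_on_sgn_abs_powr\<close>)
  define T where "T = (\<integral>x. \<bar>v x\<bar> powr (s - 1) * norm (G x) \<partial>lborel)"
  have nrm: "norm ((s * (sgn (v x) * \<bar>v x\<bar> powr (s - 1))) *\<^sub>R G x) = s * (\<bar>v x\<bar> powr (s - 1) * norm (G x))" for x
    using s by (cases "v x = 0") (simp_all add: abs_mult abs_sgn_eq)
  have sob: "(\<integral>x. (\<bar>v x\<bar> powr s) powr q \<partial>lborel) \<le> (sobolev_const DIM('a) * (\<integral>x. norm ((s * (sgn (v x) * \<bar>v x\<bar> powr (s - 1))) *\<^sub>R G x) \<partial>lborel)) powr q"
    by (rule sobolev_L1[OF g]) (use N in \<open>auto simp: q_def n_def\<close>)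
  have MT: "M \<le> (C * T) powr q"
  proof -
    have e1: "(\<integral>x. s * (\<bar>v x\<bar> powr (s - 1) * norm (G x)) \<partial>lborel) = s * T" unfolding T_def by simp
    have e2: "sobolev_const DIM('a) * (s * T) = C * T" by (simp add: C s_def n_def)
    show ?thesis using sob unfolding nrm powr_powr sq M_def[symmetric] e1 e2 .
  qed
  have half: "\<bar>v x\<bar> powr (s - 1) * norm (G x) = (\<bar>v x\<bar> powr ((\<gamma> - 1) / 2) * norm (G x)) * \<bar>v x\<bar> powr \<gamma>" for x
  proof -
    have "s - 1 = (\<gamma> - 1) / 2 + \<gamma>" using sr unfolding r2 by (simp add: field_simps)
    then show ?thesis by (simp add: powr_add)
  qed
  have sq2: "(\<bar>v x\<bar> powr ((\<gamma> - 1) / 2) * norm (G x))\<^sup>2 = \<bar>v x\<bar> powr (\<gamma> - 1) * (G x \<bullet> G x)" for x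
    using powr_add[of "\<bar>v x\<bar>" "(\<gamma> - 1) / 2" "(\<gamma> - 1) / 2"]
    by (simp add: power_mult_distrib power2_norm_eq_inner power2_eq_square[of "_ powr _"])
  have sq3: "(\<bar>v x\<bar> powr \<gamma>)\<^sup>2 = \<bar>v x\<bar> powr r" for x
    by (simp add: r2 powr_add[of _ \<gamma> \<gamma>, folded mult_2] power2_eq_square)
  have "T\<^sup>2 \<le> (\<integral>x. (\<bar>v x\<bar> powr ((\<gamma> - 1) / 2) * norm (G x))\<^sup>2 \<partial>lborel) * (\<integral>x. (\<bar>v x\<bar> powr \<gamma>)\<^sup>2 \<partial>lborel)"
    unfolding T_def half
  proof (rule integral_Cauchy_Schwarz)
    show "(\<lambda>x. \<bar>v x\<bar> powr ((\<gamma> - 1) / 2) * norm (G x)) \<in> borel_measurable lborel" using \<gamma> by (intro meas cont) auto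
    show "(\<lambda>x. \<bar>v x\<bar> powr \<gamma>) \<in> borel_measurable lborel" using \<gamma> by (intro meas cont) auto
    show "integrable lborel (\<lambda>x. (\<bar>v x\<bar> powr ((\<gamma> - 1) / 2) * norm (G x))\<^sup>2)" unfolding sq2 by (rule iP)
    show "integrable lborel (\<lambda>x. (\<bar>v x\<bar> powr \<gamma>)\<^sup>2)" unfolding sq3 by (rule iM)
  qed
  then have T2: "T\<^sup>2 \<le> P * M" unfolding sq2 sq3 P_def M_def .
  have T0: "T \<ge> 0" unfolding T_def by simp
  have "(T\<^sup>2)\<^sup>2 \<le> (P * M)\<^sup>2" using T2 by (rule power_mono) simp
  also have "\<dots> = P\<^sup>2 * M\<^sup>2" by (rule power_mult_distrib)
  also have "\<dots> \<le> (M * Q) * M\<^sup>2" using P2 by (rule mult_right_mono) simp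
  finally have T4: "T ^ 4 \<le> Q * M ^ 3" by (simp add: power2_eq_square power4_eq_xxxx power3_eq_cube mult_ac)
  have C0: "C > 0" unfolding C using N sobolev_const_pos by (intro mult_pos_pos divide_pos_pos) auto
  have "M \<le> (C ^ 4 * Q) powr \<gamma>"
  proof (cases "M = 0")
    case False
    then have Mp: "M > 0" using M0 by simp
    have CT0: "C * T \<ge> 0" using C0 T0 by simp
    have "M powr (4 / q) \<le> ((C * T) powr q) powr (4 / q)" using MT M0 q by (intro powr_mono2) auto
    also have "\<dots> = (C * T) powr 4" using q by (simp add: powr_powr)
    also have "\<dots> = (C * T) ^ 4" using CT0 powr_realpow'[of "C * T" 4] by simp
    also have "\<dots> = C ^ 4 * T ^ 4" by (rule power_mult_distrib)
    also have "\<dots> \<le> C ^ 4 * (Q * M ^ 3)" using T4 by (rule mult_left_mono) simp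
    also have "\<dots> = (C ^ 4 * Q) * M powr 3" using Mp powr_realpow[of M 3] by simp
    finally have "M powr (4 / q) \<le> (C ^ 4 * Q) * M powr 3" .
    moreover have "M powr (4 / q) = M powr (4 / q - 3) * M powr 3" by (simp flip: powr_add)
    ultimately have "M powr (4 / q - 3) * M powr 3 \<le> (C ^ 4 * Q) * M powr 3" by simp
    then have "M powr (4 / q - 3) \<le> C ^ 4 * Q" using Mp by (simp add: mult_le_cancel_right)
    then have "(M powr (4 / q - 3)) powr \<gamma> \<le> (C ^ 4 * Q) powr \<gamma>" using \<gamma> by (intro powr_mono2) auto
    moreover have "(4 / q - 3) * \<gamma> = 1" using n by (simp add: q_def \<gamma>_def field_simps)
    ultimately show ?thesis using Mp by (simp add: powr_powr)
  qed simp
  then show ?thesis by (simp add: M_def Q_def r2)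
qed

lemma square_sum3_le: "(a + b + c)\<^sup>2 \<le> 3 * (a\<^sup>2 + b\<^sup>2 + (c::real)\<^sup>2)"
proof -
  have "0 \<le> (a - b)\<^sup>2 + (b - c)\<^sup>2 + (a - c)\<^sup>2" by simp
  then show ?thesis by (simp add: power2_eq_square algebra_simps)
qed

lemma weighted_Hardy_Rellich:
  assumes N: "4 - real DIM('a::euclidean_space) < \<alpha>" "\<alpha> < real DIM('a)"
  shows "\<exists>C\<ge>0. \<forall>S u G L. C2_compact S u G L \<and> 0 \<notin> (S :: 'a set) \<longrightarrow>
    (\<integral>x. norm x powr (\<alpha> - 4) * (u x)\<^sup>2 \<partial>lborel) \<le> C * (\<integral>x. norm x powr \<alpha> * (Lap L x)\<^sup>2 \<partial>lborel) \<and>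
    (\<integral>x. norm x powr (\<alpha> - 2) * (G x \<bullet> G x) \<partial>lborel) \<le> C * (\<integral>x. norm x powr \<alpha> * (Lap L x)\<^sup>2 \<partial>lborel)"
proof -
  define c where "c = (real DIM('a) + \<alpha> - 4) / 2"
  define \<kappa> where "\<kappa> = c * (real DIM('a) - \<alpha>) / 2"
  have c: "c > 0" using N by (simp add: c_def)
  have \<kappa>: "\<kappa> > 0" using N c by (simp add: \<kappa>_def)
  define C where "C = max (1 / \<kappa>\<^sup>2) (\<bar>\<alpha> - 2\<bar> * c / \<kappa>\<^sup>2 + 1 / \<kappa>)"
  show ?thesis
  proof (intro exI[of _ C] conjI allI impI)
    show "C \<ge> 0" unfolding C_def by (simp add: le_max_iff_disj)
    fix S :: "'a set" and u G L assume *: "C2_compact S u G L \<and> 0 \<notin> S"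
    define E where "E = (\<integral>x. norm x powr \<alpha> * (Lap L x)\<^sup>2 \<partial>lborel)"
    have E0: "E \<ge> 0" unfolding E_def by simp
    have 1: "1 / \<kappa>\<^sup>2 * E \<le> C * E" "(\<bar>\<alpha> - 2\<bar> * c / \<kappa>\<^sup>2 + 1 / \<kappa>) * E \<le> C * E"
      unfolding C_def by (intro mult_right_mono E0; simp)+
    have u: "C2_compact S u G L" "0 \<notin> S" using * by auto
    note W = weighted_Rellich[OF u c_def c \<kappa>_def \<kappa>]
    show "(\<integral>x. norm x powr (\<alpha> - 4) * (u x)\<^sup>2 \<partial>lborel) \<le> C * (\<integral>x. norm x powr \<alpha> * (Lap L x)\<^sup>2 \<partial>lborel)"
      using W(1) 1(1) unfolding E_def by simp
    show "(\<integral>x. norm x powr (\<alpha> - 2) * (G x \<bullet> G x) \<partial>lborel) \<le> C * (\<integral>x. norm x powr \<alpha> * (Lap L x)\<^sup>2 \<partial>lborel)"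
      using W(2) 1(2) unfolding E_def by linarith
  qed
qed

text \<open>The Laplacian of \<open>|x|^(\<alpha>/2) u\<close> consists of \<open>|x|^(\<alpha>/2) \<Delta>u\<close> and of two terms of lower order, whose
  squares are at most multiples of the integrands in \<open>weighted_Hardy_Rellich\<close>.\<close>

lemma weighted_Sobolev:
  assumes N: "4 - real DIM('a::euclidean_space) < \<alpha>" "\<alpha> < real DIM('a)" "DIM('a) \<ge> 5"
    and r: "r = 2 * real DIM('a) / (real DIM('a) - 4)"
  shows "\<exists>C\<ge>0. \<forall>S u G L. C2_compact S u G L \<and> 0 \<notin> (S :: 'a set) \<longrightarrow>
    (\<integral>x. \<bar>norm x powr (\<alpha> / 2) * u x\<bar> powr r \<partial>lborel) \<le> (C * (\<integral>x. norm x powr \<alpha> * (Lap L x)\<^sup>2 \<partial>lborel)) powr (r / 2)"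
proof -
  obtain C0 where C0: "C0 \<ge> 0" "\<And>S u G L. C2_compact S u G L \<Longrightarrow> 0 \<notin> (S :: 'a set) \<Longrightarrow>
    (\<integral>x. norm x powr (\<alpha> - 4) * (u x)\<^sup>2 \<partial>lborel) \<le> C0 * (\<integral>x. norm x powr \<alpha> * (Lap L x)\<^sup>2 \<partial>lborel) \<and>
    (\<integral>x. norm x powr (\<alpha> - 2) * (G x \<bullet> G x) \<partial>lborel) \<le> C0 * (\<integral>x. norm x powr \<alpha> * (Lap L x)\<^sup>2 \<partial>lborel)"
    using weighted_Hardy_Rellich[OF N(1,2)] by blast
  define a where "a = \<alpha> / 2"
  define k where "k = a * (a + real DIM('a) - 2)"
  define C1 where "C1 = sobolev_const DIM('a) * (2 * (real DIM('a) - 1) / (real DIM('a) - 4))"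
  define C where "C = C1 ^ 4 * (3 * (1 + \<alpha>\<^sup>2 * C0 + k\<^sup>2 * C0))"
  have r0: "r > 0" using N(3) by (simp add: r)
  show ?thesis
  proof (intro exI[of _ C] conjI allI impI)
    show "C \<ge> 0" using C0(1) by (simp add: C_def)
    fix S :: "'a set" and u G L assume *: "C2_compact S u G L \<and> 0 \<notin> S"
    then have u: "C2_compact S u G L" and S: "0 \<notin> S" by auto
    note u1 = C2_compactD(1)[OF u]
    define A where "A = (\<integral>x. norm x powr (\<alpha> - 4) * (u x)\<^sup>2 \<partial>lborel)"
    define B where "B = (\<integral>x. norm x powr (\<alpha> - 2) * (G x \<bullet> G x) \<partial>lborel)"
    define E where "E = (\<integral>x. norm x powr \<alpha> * (Lap L x)\<^sup>2 \<partial>lborel)"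
    have ABE: "A \<le> C0 * E" "B \<le> C0 * E" using C0(2)[OF u S] by (auto simp: A_def B_def E_def)
    obtain K where K: "compact K" "K \<subseteq> S" "\<And>x. x \<notin> K \<Longrightarrow> u x = 0" "\<And>x. x \<notin> K \<Longrightarrow> G x = 0"
        "\<And>x. x \<notin> K \<Longrightarrow> Lap L x = 0"
      using C2_compact_support[OF u] by blast
    have K0: "0 \<notin> K" using K S by blast
    note cont = continuous_intros C1_compactD(2,3)[OF u1] continuous_Lap[OF u]
    have iA: "integrable lborel (\<lambda>x. norm x powr (\<alpha> - 4) * (u x)\<^sup>2)"
      by (rule integrable_norm_powr_mult[OF _ K(1) K0]) (auto intro!: cont simp: K)
    have iB: "integrable lborel (\<lambda>x. norm x powr (\<alpha> - 2) * (G x \<bullet> G x))"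
      by (rule integrable_norm_powr_mult[OF _ K(1) K0]) (auto intro!: cont simp: K)
    have iE: "integrable lborel (\<lambda>x. norm x powr \<alpha> * (Lap L x)\<^sup>2)"
      by (rule integrable_norm_powr_mult[OF _ K(1) K0]) (auto intro!: cont simp: K)
    define G' where "G' = (\<lambda>x. norm x powr a *\<^sub>R G x + norm x powr (a - 2) *\<^sub>R ((a * u x) *\<^sub>R x))"
    define L' where "L' = (\<lambda>b x. norm x powr a * L b x + norm x powr (a - 2) * (2 * a * ((x \<bullet> b) * (b \<bullet> G x)) + a * u x)
        + norm x powr (a - 4) * (a * (a - 2) * (x \<bullet> b)\<^sup>2 * u x))"
    have v: "C2_compact S (\<lambda>x. norm x powr a * u x) G' L'"
      unfolding G'_def L'_def by (rule C2_compact_norm_powr_mult[OF u S])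
    have tr: "Lap L' x = norm x powr a * Lap L x + norm x powr (a - 2) * (2 * a * (x \<bullet> G x) + k * u x)" for x
      unfolding L'_def k_def by (rule Lap_norm_powr_mult)
    obtain K' where K': "compact K'" "\<And>x. x \<notin> K' \<Longrightarrow> Lap L' x = 0"
      using C2_compact_support[OF v] by blast
    have "(\<integral>x. (Lap L' x)\<^sup>2 \<partial>lborel) \<le> (\<integral>x. 3 * (norm x powr \<alpha> * (Lap L x)\<^sup>2
        + \<alpha>\<^sup>2 * (norm x powr (\<alpha> - 2) * (G x \<bullet> G x)) + k\<^sup>2 * (norm x powr (\<alpha> - 4) * (u x)\<^sup>2)) \<partial>lborel)"
    proof (rule integral_mono)
      show "integrable lborel (\<lambda>x. (Lap L' x)\<^sup>2)"
        by (rule integrable_compact_support[OF _ K'(1)]) (auto intro!: continuous_intros continuous_Lap[OF v] simp: K')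
      show "integrable lborel (\<lambda>x. 3 * (norm x powr \<alpha> * (Lap L x)\<^sup>2
        + \<alpha>\<^sup>2 * (norm x powr (\<alpha> - 2) * (G x \<bullet> G x)) + k\<^sup>2 * (norm x powr (\<alpha> - 4) * (u x)\<^sup>2)))"
        by (intro integrable_mult_right Bochner_Integration.integrable_add iA iB iE)
      fix x :: 'a
      have p: "(norm x powr b)\<^sup>2 = norm x powr (2 * b)" for b
        by (simp add: power2_eq_square powr_add[symmetric])
      have e: "2 * a = \<alpha>" "2 * (a - 2) = \<alpha> - 4" by (simp_all add: a_def)
      have "(x \<bullet> G x)\<^sup>2 \<le> (x \<bullet> x) * (G x \<bullet> G x)" by (rule Cauchy_Schwarz_ineq)
      then have "norm x powr (\<alpha> - 4) * (x \<bullet> G x)\<^sup>2 \<le> norm x powr (\<alpha> - 4) * ((x \<bullet> x) * (G x \<bullet> G x))"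
        by (rule mult_left_mono) simp
      also have "\<dots> = norm x powr (\<alpha> - 2) * (G x \<bullet> G x)"
        using norm_powr_mult_norm_sq[of x "\<alpha> - 2" "G x \<bullet> G x"] by simp
      finally have mid: "\<alpha>\<^sup>2 * (norm x powr (\<alpha> - 4) * (x \<bullet> G x)\<^sup>2) \<le> \<alpha>\<^sup>2 * (norm x powr (\<alpha> - 2) * (G x \<bullet> G x))"
        by (rule mult_left_mono) simp
      have "Lap L' x = norm x powr a * Lap L x + norm x powr (a - 2) * (\<alpha> * (x \<bullet> G x)) + norm x powr (a - 2) * (k * u x)"
        unfolding tr by (simp add: e distrib_left)
      then have "(Lap L' x)\<^sup>2 \<le> 3 * ((norm x powr a * Lap L x)\<^sup>2 + (norm x powr (a - 2) * (\<alpha> * (x \<bullet> G x)))\<^sup>2 + (norm x powr (a - 2) * (k * u x))\<^sup>2)"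
        by (simp only: square_sum3_le)
      then have "(Lap L' x)\<^sup>2 \<le> 3 * (norm x powr \<alpha> * (Lap L x)\<^sup>2 + \<alpha>\<^sup>2 * (norm x powr (\<alpha> - 4) * (x \<bullet> G x)\<^sup>2) + k\<^sup>2 * (norm x powr (\<alpha> - 4) * (u x)\<^sup>2))"
        unfolding power_mult_distrib p e by (simp only: mult_ac)
      also have "\<dots> \<le> 3 * (norm x powr \<alpha> * (Lap L x)\<^sup>2
        + \<alpha>\<^sup>2 * (norm x powr (\<alpha> - 2) * (G x \<bullet> G x)) + k\<^sup>2 * (norm x powr (\<alpha> - 4) * (u x)\<^sup>2))"
        by (intro mult_left_mono add_mono order_refl mid) simp
      finally show "(Lap L' x)\<^sup>2 \<le> 3 * (norm x powr \<alpha> * (Lap L x)\<^sup>2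
        + \<alpha>\<^sup>2 * (norm x powr (\<alpha> - 2) * (G x \<bullet> G x)) + k\<^sup>2 * (norm x powr (\<alpha> - 4) * (u x)\<^sup>2))" .
    qed
    also have "\<dots> = 3 * (E + \<alpha>\<^sup>2 * B + k\<^sup>2 * A)"
      unfolding A_def B_def E_def using iA iB iE by simp
    also have "\<dots> \<le> 3 * (E + \<alpha>\<^sup>2 * (C0 * E) + k\<^sup>2 * (C0 * E))"
      using ABE by (intro add_mono mult_left_mono) auto
    also have "\<dots> = (3 * (1 + \<alpha>\<^sup>2 * C0 + k\<^sup>2 * C0)) * E" by (simp add: algebra_simps)
    finally have Qle: "(\<integral>x. (Lap L' x)\<^sup>2 \<partial>lborel) \<le> (3 * (1 + \<alpha>\<^sup>2 * C0 + k\<^sup>2 * C0)) * E" .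
    have "C1 ^ 4 * (\<integral>x. (Lap L' x)\<^sup>2 \<partial>lborel) \<le> C1 ^ 4 * ((3 * (1 + \<alpha>\<^sup>2 * C0 + k\<^sup>2 * C0)) * E)"
      by (rule mult_left_mono[OF Qle]) simp
    also have "\<dots> = C * E" by (simp add: C_def mult.assoc)
    finally have "(C1 ^ 4 * (\<integral>x. (Lap L' x)\<^sup>2 \<partial>lborel)) powr (r / 2) \<le> (C * E) powr (r / 2)"
      using r0 by (intro powr_mono2) auto
    with second_order_Sobolev[OF v N(3) r C1_def]
    show "(\<integral>x. \<bar>norm x powr (\<alpha> / 2) * u x\<bar> powr r \<partial>lborel) \<le> (C * (\<integral>x. norm x powr \<alpha> * (Lap L x)\<^sup>2 \<partial>lborel)) powr (r / 2)"
      unfolding E_def a_def by linarith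
  qed
qed

lemma integral_le_sqrt_support:
  fixes f :: "'a::euclidean_space \<Rightarrow> real"
  assumes f: "f \<in> borel_measurable lborel" "integrable lborel (\<lambda>x. (f x)\<^sup>2)"
    and R: "R \<ge> 0" "\<And>x. x \<notin> cball 0 R \<Longrightarrow> f x = 0"
  shows "(\<integral>x. norm x ^ j * f x \<partial>lborel) \<le> sqrt (R ^ (2 * j) * measure lborel (cball (0::'a) R)) * sqrt (\<integral>x. (f x)\<^sup>2 \<partial>lborel)"
proof -
  let ?h = "\<lambda>x::'a. norm x ^ j * indicator (cball 0 R) x :: real"
  have mB: "cball (0::'a) R \<in> sets lborel" by (auto intro: borel_closed)
  have iB: "integrable lborel (\<lambda>x. indicator (cball (0::'a) R) x :: real)"
    using mB emeasure_compact_finite[of "cball (0::'a) R"] by (intro integrable_real_indicator) auto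
  have h2: "(?h x)\<^sup>2 \<le> R ^ (2 * j) * indicator (cball 0 R) x" for x :: 'a
  proof (cases "x \<in> cball 0 R")
    case True
    then have "norm x ^ (2 * j) \<le> R ^ (2 * j)" by (intro power_mono) auto
    then show ?thesis using True by (simp add: power_mult[symmetric] mult.commute)
  qed simp
  have mh: "?h \<in> borel_measurable lborel"
    using mB by (intro borel_measurable_times borel_measurable_indicator) auto
  have ih: "integrable lborel (\<lambda>x::'a. (?h x)\<^sup>2)"
  proof (rule Bochner_Integration.integrable_bound)
    show "integrable lborel (\<lambda>x::'a. R ^ (2 * j) * indicator (cball 0 R) x)" by (intro integrable_mult_right iB)
    show "(\<lambda>x::'a. (?h x)\<^sup>2) \<in> borel_measurable lborel" using mh by (rule borel_measurable_power)
    show "AE x::'a in lborel. norm ((?h x)\<^sup>2) \<le> norm (R ^ (2 * j) * indicator (cball 0 R) x :: real)"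
      by (rule AE_I2) (use h2 R(1) in \<open>simp add: abs_of_nonneg\<close>)
  qed
  have "(\<integral>x. norm x ^ j * f x \<partial>lborel) = (\<integral>x. ?h x * f x \<partial>lborel)"
    by (intro Bochner_Integration.integral_cong refl) (use R(2) in \<open>auto simp: indicator_def\<close>)
  also have "\<dots> \<le> sqrt ((\<integral>x. (?h x)\<^sup>2 \<partial>lborel) * (\<integral>x. (f x)\<^sup>2 \<partial>lborel))"
    by (rule real_le_rsqrt, rule integral_Cauchy_Schwarz(2)[OF mh f(1) ih f(2)])
  also have "\<dots> \<le> sqrt (R ^ (2 * j) * measure lborel (cball (0::'a) R) * (\<integral>x. (f x)\<^sup>2 \<partial>lborel))"
  proof (intro real_sqrt_le_mono mult_right_mono)
    have "(\<integral>x. (?h x)\<^sup>2 \<partial>lborel) \<le> (\<integral>x. R ^ (2 * j) * indicator (cball (0::'a) R) x \<partial>lborel)"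
      by (rule integral_mono[OF ih _ h2]) (intro integrable_mult_right iB)
    then show "(\<integral>x. (?h x)\<^sup>2 \<partial>lborel) \<le> R ^ (2 * j) * measure lborel (cball (0::'a) R)" by simp
  qed simp
  finally show ?thesis by (simp add: real_sqrt_mult)
qed

text \<open>On a bounded set, Cauchy-Schwarz turns the quadratic bounds of the Hardy and Rellich inequalities
  into bounds for the integral of \<open>|x|^(\<alpha>/2) u\<close> and of its gradient, because the weights there differ
  by nonnegative powers of \<open>|x|\<close>.\<close>

lemma weighted_W11_bound:
  assumes N: "4 - real DIM('a::euclidean_space) < \<alpha>" "\<alpha> < real DIM('a)" and R: "R \<ge> 0"
  shows "\<exists>C. \<forall>S u G L. C2_compact S u G L \<and> 0 \<notin> (S :: 'a set) \<and> S \<subseteq> cball 0 R \<longrightarrow>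
    (\<exists>G'. C1_compact S (\<lambda>x. norm x powr (\<alpha> / 2) * u x) G' \<and>
    (\<integral>x. \<bar>norm x powr (\<alpha> / 2) * u x\<bar> \<partial>lborel) \<le> C * sqrt (\<integral>x. norm x powr \<alpha> * (Lap L x)\<^sup>2 \<partial>lborel) \<and>
    (\<integral>x. norm (G' x) \<partial>lborel) \<le> C * sqrt (\<integral>x. norm x powr \<alpha> * (Lap L x)\<^sup>2 \<partial>lborel))"
proof -
  obtain C0 where C0: "C0 \<ge> 0" "\<And>S u G L. C2_compact S u G L \<Longrightarrow> 0 \<notin> (S :: 'a set) \<Longrightarrow>
    (\<integral>x. norm x powr (\<alpha> - 4) * (u x)\<^sup>2 \<partial>lborel) \<le> C0 * (\<integral>x. norm x powr \<alpha> * (Lap L x)\<^sup>2 \<partial>lborel) \<and>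
    (\<integral>x. norm x powr (\<alpha> - 2) * (G x \<bullet> G x) \<partial>lborel) \<le> C0 * (\<integral>x. norm x powr \<alpha> * (Lap L x)\<^sup>2 \<partial>lborel)"
    using weighted_Hardy_Rellich[OF N] by blast
  define a where "a = \<alpha> / 2"
  define k where "k j = sqrt (R ^ (2 * j) * measure lborel (cball (0::'a) R))" for j
  have k0: "k j \<ge> 0" for j unfolding k_def using R by simp
  define C where "C = max (k 2 * sqrt C0) (k 1 * sqrt C0 + \<bar>a\<bar> * (k 1 * sqrt C0))"
  show ?thesis
  proof (intro exI[of _ C] allI impI)
    fix S :: "'a set" and u G L assume *: "C2_compact S u G L \<and> 0 \<notin> S \<and> S \<subseteq> cball 0 R"
    then have u: "C2_compact S u G L" and S: "0 \<notin> S" and SR: "S \<subseteq> cball 0 R" by auto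
    note u1 = C2_compactD(1)[OF u]
    define A where "A = (\<integral>x. norm x powr (\<alpha> - 4) * (u x)\<^sup>2 \<partial>lborel)"
    define B where "B = (\<integral>x. norm x powr (\<alpha> - 2) * (G x \<bullet> G x) \<partial>lborel)"
    define E where "E = (\<integral>x. norm x powr \<alpha> * (Lap L x)\<^sup>2 \<partial>lborel)"
    have E0: "E \<ge> 0" unfolding E_def by simp
    have ABE: "A \<le> C0 * E" "B \<le> C0 * E" using C0(2)[OF u S] by (auto simp: A_def B_def E_def)
    obtain K where K: "compact K" "K \<subseteq> S" "\<And>x. x \<notin> K \<Longrightarrow> u x = 0" "\<And>x. x \<notin> K \<Longrightarrow> G x = 0"
        "\<And>x. x \<notin> K \<Longrightarrow> Lap L x = 0"
      using C2_compact_support[OF u] by blast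
    have K0: "0 \<notin> K" using K S by blast
    have KR: "x \<notin> K" if "x \<notin> cball 0 R" for x using that K(2) SR by blast
    note cont = continuous_intros C1_compactD(2,3)[OF u1]
    have meas: "f \<in> borel_measurable lborel" if "continuous_on UNIV f" for f :: "'a \<Rightarrow> real"
      using borel_measurable_continuous_onI[OF that] by simp
    define p where "p x = norm x powr (a - 2) * \<bar>u x\<bar>" for x
    define g where "g x = norm x powr (a - 1) * norm (G x)" for x
    have sq: "(norm x powr b)\<^sup>2 = norm x powr (2 * b)" for b and x :: 'a
      by (simp add: power2_eq_square powr_add[symmetric])
    have e: "2 * (a - 1) = \<alpha> - 2" "2 * (a - 2) = \<alpha> - 4" by (simp_all add: a_def)
    have p2: "(p x)\<^sup>2 = norm x powr (\<alpha> - 4) * (u x)\<^sup>2" for x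
      unfolding p_def power_mult_distrib sq e by simp
    have g2: "(g x)\<^sup>2 = norm x powr (\<alpha> - 2) * (G x \<bullet> G x)" for x
      unfolding g_def power_mult_distrib sq e by (simp add: power2_norm_eq_inner)
    have mp: "p \<in> borel_measurable lborel" unfolding p_def
      by (intro meas continuous_on_norm_powr_mult[OF _ K(1) K0]) (auto intro!: cont simp: K)
    have mg: "g \<in> borel_measurable lborel" unfolding g_def
      by (intro meas continuous_on_norm_powr_mult[OF _ K(1) K0]) (auto intro!: cont simp: K)
    have ip: "integrable lborel (\<lambda>x. (p x)\<^sup>2)" unfolding p2
      by (rule integrable_norm_powr_mult[OF _ K(1) K0]) (auto intro!: cont simp: K)
    have ig: "integrable lborel (\<lambda>x. (g x)\<^sup>2)" unfolding g2
      by (rule integrable_norm_powr_mult[OF _ K(1) K0]) (auto intro!: cont simp: K)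
    have bp: "(\<integral>x. norm x ^ j * p x \<partial>lborel) \<le> k j * sqrt C0 * sqrt E" for j
    proof -
      have "(\<integral>x. norm x ^ j * p x \<partial>lborel) \<le> k j * sqrt (\<integral>x. (p x)\<^sup>2 \<partial>lborel)"
        unfolding k_def by (rule integral_le_sqrt_support[OF mp ip R]) (simp add: p_def K(3)[OF KR] del: mem_cball)
      also have "\<dots> \<le> k j * sqrt (C0 * E)"
        using ABE(1) k0 unfolding p2 A_def by (intro mult_left_mono real_sqrt_le_mono)
      finally show ?thesis by (simp add: real_sqrt_mult mult.assoc)
    qed
    have bg: "(\<integral>x. norm x ^ j * g x \<partial>lborel) \<le> k j * sqrt C0 * sqrt E" for j
    proof -
      have "(\<integral>x. norm x ^ j * g x \<partial>lborel) \<le> k j * sqrt (\<integral>x. (g x)\<^sup>2 \<partial>lborel)"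
        unfolding k_def by (rule integral_le_sqrt_support[OF mg ig R]) (simp add: g_def K(4)[OF KR] del: mem_cball)
      also have "\<dots> \<le> k j * sqrt (C0 * E)"
        using ABE(2) k0 unfolding g2 B_def by (intro mult_left_mono real_sqrt_le_mono)
      finally show ?thesis by (simp add: real_sqrt_mult mult.assoc)
    qed
    have ijp: "integrable lborel (\<lambda>x. norm x ^ j * p x)" for j
      by (rule integrable_compact_support[OF _ K(1)])
        (auto intro!: continuous_intros continuous_on_norm_powr_mult[OF _ K(1) K0] C1_compactD(3)[OF u1] simp: p_def K)
    have ijg: "integrable lborel (\<lambda>x. norm x ^ j * g x)" for j
      by (rule integrable_compact_support[OF _ K(1)])
        (auto intro!: continuous_intros continuous_on_norm_powr_mult[OF _ K(1) K0] C1_compactD(2)[OF u1] simp: g_def K)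
    define G' where "G' = (\<lambda>x. norm x powr a *\<^sub>R G x + norm x powr (a - 2) *\<^sub>R ((a * u x) *\<^sub>R x))"
    have v: "C1_compact S (\<lambda>x. norm x powr a * u x) G'"
      unfolding G'_def by (rule C1_compact_norm_powr_mult[OF u1 S])
    have x2: "norm x powr a = norm x ^ 2 * norm x powr (a - 2)" "norm x powr a = norm x ^ 1 * norm x powr (a - 1)" for x :: 'a
    proof -
      have "norm x powr (a - 2 + 2) = norm x powr (a - 2) * norm x powr 2" by (rule powr_add)
      then show "norm x powr a = norm x ^ 2 * norm x powr (a - 2)" by simp
      have "norm x powr (a - 1 + 1) = norm x powr (a - 1) * norm x powr 1" by (rule powr_add)
      then show "norm x powr a = norm x ^ 1 * norm x powr (a - 1)" by simp
    qed
    have "(\<integral>x. \<bar>norm x powr a * u x\<bar> \<partial>lborel) = (\<integral>x. norm x ^ 2 * p x \<partial>lborel)"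
      by (intro Bochner_Integration.integral_cong refl) (simp add: abs_mult p_def x2(1)[unfolded power2_eq_square] power2_eq_square mult.assoc)
    also have "\<dots> \<le> k 2 * sqrt C0 * sqrt E" by (rule bp)
    also have "\<dots> \<le> C * sqrt E" unfolding C_def using E0 by (intro mult_right_mono) auto
    finally have 1: "(\<integral>x. \<bar>norm x powr a * u x\<bar> \<partial>lborel) \<le> C * sqrt E" .
    have "(\<integral>x. norm (G' x) \<partial>lborel) \<le> (\<integral>x. norm x ^ 1 * g x + \<bar>a\<bar> * (norm x ^ 1 * p x) \<partial>lborel)"
    proof (rule integral_mono)
      show "integrable lborel (\<lambda>x. norm (G' x))" by (rule C1_compact_integrable(2)[OF v])
      show "integrable lborel (\<lambda>x. norm x ^ 1 * g x + \<bar>a\<bar> * (norm x ^ 1 * p x))"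
        by (intro Bochner_Integration.integrable_add integrable_mult_right ijp ijg)
      show "norm (G' x) \<le> norm x ^ 1 * g x + \<bar>a\<bar> * (norm x ^ 1 * p x)" for x
      proof -
        have "norm (G' x) \<le> norm x powr a * norm (G x) + norm x powr (a - 2) * (\<bar>a\<bar> * \<bar>u x\<bar> * norm x)"
          unfolding G'_def by (rule order_trans[OF norm_triangle_ineq]) (simp add: abs_mult)
        also have "\<dots> = norm x ^ 1 * g x + \<bar>a\<bar> * (norm x ^ 1 * p x)"
          unfolding x2(2)[of x] g_def p_def by (simp add: mult_ac)
        finally show ?thesis .
      qed
    qed
    also have "\<dots> = (\<integral>x. norm x ^ 1 * g x \<partial>lborel) + \<bar>a\<bar> * (\<integral>x. norm x ^ 1 * p x \<partial>lborel)"
      by (subst Bochner_Integration.integral_add[OF ijg integrable_mult_right[OF ijp]]) simp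
    also have "\<dots> \<le> k 1 * sqrt C0 * sqrt E + \<bar>a\<bar> * (k 1 * sqrt C0 * sqrt E)"
      by (intro add_mono mult_left_mono bp bg) simp
    also have "\<dots> = (k 1 * sqrt C0 + \<bar>a\<bar> * (k 1 * sqrt C0)) * sqrt E" by (simp add: algebra_simps)
    also have "\<dots> \<le> C * sqrt E" unfolding C_def using E0 by (intro mult_right_mono) auto
    finally have 2: "(\<integral>x. norm (G' x) \<partial>lborel) \<le> C * sqrt E" .
    show "\<exists>G'. C1_compact S (\<lambda>x. norm x powr (\<alpha> / 2) * u x) G' \<and>
      (\<integral>x. \<bar>norm x powr (\<alpha> / 2) * u x\<bar> \<partial>lborel) \<le> C * sqrt (\<integral>x. norm x powr \<alpha> * (Lap L x)\<^sup>2 \<partial>lborel) \<and>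
      (\<integral>x. norm (G' x) \<partial>lborel) \<le> C * sqrt (\<integral>x. norm x powr \<alpha> * (Lap L x)\<^sup>2 \<partial>lborel)"
      using v 1 2 unfolding a_def E_def by blast
  qed
qed

section \<open>Convergence in the mean\<close>

text \<open>Minkowski's inequality up to a factor, which is enough for integrability and for convergence
  to zero.\<close>

lemma abs_add_powr_le:
  fixes a b q :: real
  assumes "q > 0"
  shows "\<bar>a + b\<bar> powr q \<le> 2 powr q * (\<bar>a\<bar> powr q + \<bar>b\<bar> powr q)"
proof -
  have "\<bar>a + b\<bar> powr q \<le> (2 * max \<bar>a\<bar> \<bar>b\<bar>) powr q"
    using assms by (intro powr_mono2) (auto simp: max_def)
  also have "\<dots> = 2 powr q * (max \<bar>a\<bar> \<bar>b\<bar>) powr q" by (simp add: powr_mult)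
  also have "(max \<bar>a\<bar> \<bar>b\<bar>) powr q \<le> \<bar>a\<bar> powr q + \<bar>b\<bar> powr q" by (simp add: max_def)
  finally show ?thesis by simp
qed

lemma integrable_abs_add_powr:
  fixes f g :: "'a \<Rightarrow> real"
  assumes q: "q > 0" and m: "f \<in> borel_measurable M" "g \<in> borel_measurable M"
    and i: "integrable M (\<lambda>x. \<bar>f x\<bar> powr q)" "integrable M (\<lambda>x. \<bar>g x\<bar> powr q)"
  shows "integrable M (\<lambda>x. \<bar>f x + g x\<bar> powr q)"
    and "(\<integral>x. \<bar>f x + g x\<bar> powr q \<partial>M) \<le> 2 powr q * ((\<integral>x. \<bar>f x\<bar> powr q \<partial>M) + (\<integral>x. \<bar>g x\<bar> powr q \<partial>M))"
proof -
  have i2: "integrable M (\<lambda>x. 2 powr q * (\<bar>f x\<bar> powr q + \<bar>g x\<bar> powr q))"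
    by (intro integrable_mult_right Bochner_Integration.integrable_add i)
  have [measurable]: "f \<in> borel_measurable M" "g \<in> borel_measurable M" by (fact m)+
  show i3: "integrable M (\<lambda>x. \<bar>f x + g x\<bar> powr q)"
  proof (rule Bochner_Integration.integrable_bound[OF i2])
    show "AE x in M. norm (\<bar>f x + g x\<bar> powr q) \<le> norm (2 powr q * (\<bar>f x\<bar> powr q + \<bar>g x\<bar> powr q))"
      by (rule AE_I2) (use abs_add_powr_le[OF q] in simp)
  qed simp
  have "(\<integral>x. \<bar>f x + g x\<bar> powr q \<partial>M) \<le> (\<integral>x. 2 powr q * (\<bar>f x\<bar> powr q + \<bar>g x\<bar> powr q) \<partial>M)"
    by (rule integral_mono[OF i3 i2]) (rule abs_add_powr_le[OF q])
  then show "(\<integral>x. \<bar>f x + g x\<bar> powr q \<partial>M) \<le> 2 powr q * ((\<integral>x. \<bar>f x\<bar> powr q \<partial>M) + (\<integral>x. \<bar>g x\<bar> powr q \<partial>M))"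
    by (simp add: Bochner_Integration.integral_add[OF i])
qed

text \<open>The powers of 1/2 are such that the integrals of \<open>(2^k |d k|)^p\<close> are summable.  Hence almost
  everywhere \<open>|d k x| \<le> 2^(-k)\<close> for all large \<open>k\<close>.\<close>

lemma AE_summable_increments:
  fixes d :: "nat \<Rightarrow> 'a \<Rightarrow> real"
  assumes p: "p > 0" and m [measurable]: "\<And>k. d k \<in> borel_measurable M"
    and i: "\<And>k. integrable M (\<lambda>x. \<bar>d k x\<bar> powr p)"
    and small: "\<And>k. (\<integral>x. \<bar>d k x\<bar> powr p \<partial>M) \<le> (1/2) ^ k * (1/2) powr (p * real k)"
  shows "AE x in M. summable (\<lambda>k. \<bar>d k x\<bar>)"
proof -
  define e where "e k x = 2 powr (p * real k) * \<bar>d k x\<bar> powr p" for k x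
  have ie: "integrable M (e k)" for k unfolding e_def[abs_def] by (intro integrable_mult_right i)
  have e0: "e k x \<ge> 0" for k x by (simp add: e_def)
  have Ie: "(\<integral>x. e k x \<partial>M) \<le> (1/2) ^ k" for k
  proof -
    have "(\<integral>x. e k x \<partial>M) = 2 powr (p * real k) * (\<integral>x. \<bar>d k x\<bar> powr p \<partial>M)" by (simp add: e_def)
    also have "\<dots> \<le> 2 powr (p * real k) * ((1/2) ^ k * (1/2) powr (p * real k))" by (rule mult_left_mono[OF small]) simp
    also have "\<dots> = (1/2) ^ k * (2 powr (p * real k) * (1/2) powr (p * real k))" by simp
    also have "2 powr (p * real k) * (1/2) powr (p * real k) = (1::real)" by (simp add: powr_mult[symmetric])
    finally show ?thesis by simp
  qed
  have "(\<integral>\<^sup>+x. (\<Sum>k. ennreal (e k x)) \<partial>M) = (\<Sum>k. (\<integral>\<^sup>+x. ennreal (e k x) \<partial>M))"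
    by (rule nn_integral_suminf) (use ie in simp)
  also have "\<dots> \<le> (\<Sum>k. ennreal ((1/2) ^ k))"
  proof (rule suminf_le)
    show "(\<integral>\<^sup>+x. ennreal (e k x) \<partial>M) \<le> ennreal ((1/2) ^ k)" for k
      using Ie[of k] by (subst nn_integral_eq_integral[OF ie]) (auto simp: e0 intro!: ennreal_leI)
  qed auto
  also have "\<dots> = ennreal (\<Sum>k. (1/2) ^ k)"
    by (rule suminf_ennreal_eq) (auto simp: summable_geometric intro!: summable_sums)
  also have "\<dots> < \<infinity>" by simp
  finally have "(\<integral>\<^sup>+x. (\<Sum>k. ennreal (e k x)) \<partial>M) \<noteq> \<infinity>" by simp
  then have "AE x in M. (\<Sum>k. ennreal (e k x)) \<noteq> \<infinity>"
    by (rule nn_integral_PInf_AE[rotated]) (use ie in simp)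
  then show ?thesis
  proof eventually_elim
    case (elim x)
    have s: "summable (\<lambda>k. e k x)" using elim by (intro summable_suminf_not_top e0) simp
    have "\<forall>\<^sub>F k in sequentially. e k x < 1"
      by (rule order_tendstoD(2)[OF summable_LIMSEQ_zero[OF s]]) simp
    then have "\<forall>\<^sub>F k in sequentially. norm \<bar>d k x\<bar> \<le> (1/2) ^ k"
    proof eventually_elim
      case (elim k)
      have ek: "e k x = (2 ^ k * \<bar>d k x\<bar>) powr p"
        by (simp add: e_def powr_mult powr_realpow[symmetric] powr_powr mult.commute)
      have "2 ^ k * \<bar>d k x\<bar> < 1"
      proof (rule ccontr)
        assume "\<not> 2 ^ k * \<bar>d k x\<bar> < 1"
        then have "1 powr p \<le> (2 ^ k * \<bar>d k x\<bar>) powr p" using p by (intro powr_mono2) auto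
        then show False using elim unfolding ek by simp
      qed
      then show ?case by (simp add: field_simps power_divide)
    qed
    then show ?case
      by (rule summable_comparison_test_ev) (simp add: summable_geometric)
  qed
qed

text \<open>Completeness of \<open>L\<^sup>p\<close>.  A sufficiently fast subsequence converges almost everywhere, and by
  Fatou's lemma its pointwise limit is the limit in the mean of the whole sequence.\<close>

lemma Lp_Cauchy_convergent:
  fixes u :: "nat \<Rightarrow> 'a \<Rightarrow> real"
  assumes p: "p > 0" and m [measurable]: "\<And>n. u n \<in> borel_measurable M"
    and i: "\<And>n k. integrable M (\<lambda>x. \<bar>u n x - u k x\<bar> powr p)"
    and C: "\<And>e. e > 0 \<Longrightarrow> \<exists>N. \<forall>n\<ge>N. \<forall>k\<ge>N. (\<integral>x. \<bar>u n x - u k x\<bar> powr p \<partial>M) < e"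
  shows "\<exists>f\<in>borel_measurable M. (\<forall>n. integrable M (\<lambda>x. \<bar>u n x - f x\<bar> powr p)) \<and>
    (\<lambda>n. \<integral>x. \<bar>u n x - f x\<bar> powr p \<partial>M) \<longlonglongrightarrow> 0 \<and>
    (\<exists>s. strict_mono s \<and> (AE x in M. (\<lambda>n. u (s n) x) \<longlonglongrightarrow> f x))"
proof -
  define e where "e k = (1/2) ^ k * (1/2) powr (p * real k)" for k :: nat
  have "\<forall>k. \<exists>N. \<forall>n\<ge>N. \<forall>l\<ge>N. (\<integral>x. \<bar>u n x - u l x\<bar> powr p \<partial>M) < e k"
    by (intro allI C) (simp add: e_def)
  then obtain N where N: "\<And>k n l. n \<ge> N k \<Longrightarrow> l \<ge> N k \<Longrightarrow> (\<integral>x. \<bar>u n x - u l x\<bar> powr p \<partial>M) < e k"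
    by metis
  \<comment> \<open>The summand \<open>k\<close> makes \<open>r\<close> strictly increasing.\<close>
  define r where "r k = (\<Sum>j\<le>k. N j) + k" for k
  have r: "strict_mono r" by (rule strict_mono_Suc_iff[THEN iffD2]) (simp add: r_def)
  have rN: "r k \<ge> N k" for k unfolding r_def by (simp add: member_le_sum trans_le_add1)
  define d where "d k x = u (r (Suc k)) x - u (r k) x" for k x
  have "AE x in M. summable (\<lambda>k. \<bar>d k x\<bar>)"
  proof (rule AE_summable_increments[OF p])
    show "d k \<in> borel_measurable M" for k unfolding d_def[abs_def] by simp
    show "integrable M (\<lambda>x. \<bar>d k x\<bar> powr p)" for k unfolding d_def by (rule i)
    have "r (Suc k) \<ge> N k" for k using rN[of k] strict_monoD[OF r, of k "Suc k"] by simp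
    then show "(\<integral>x. \<bar>d k x\<bar> powr p \<partial>M) \<le> (1/2) ^ k * (1/2) powr (p * real k)" for k
      unfolding d_def using N[of k "r (Suc k)" "r k"] rN[of k] by (simp add: e_def less_imp_le)
  qed
  then have conv: "AE x in M. convergent (\<lambda>k. u (r k) x)"
  proof eventually_elim
    case (elim x)
    then have "summable (\<lambda>k. d k x)" by (rule summable_rabs_cancel)
    then have "convergent (\<lambda>n. \<Sum>k<n. d k x)" by (simp add: summable_iff_convergent)
    moreover have "(\<Sum>k<n. d k x) = u (r n) x - u (r 0) x" for n
      unfolding d_def by (rule sum_lessThan_telescope)
    ultimately have "convergent (\<lambda>n. u (r n) x - u (r 0) x)" by simp
    then show ?case using convergent_add[OF _ convergent_const[of "u (r 0) x"]] by fastforce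
  qed
  define f where "f x = lim (\<lambda>k. u (r k) x)" for x
  have mf [measurable]: "f \<in> borel_measurable M" unfolding f_def[abs_def] by measurable
  have lim: "AE x in M. (\<lambda>k. u (r k) x) \<longlonglongrightarrow> f x"
    using conv by eventually_elim (simp add: f_def convergent_LIMSEQ_iff)
  have Fatou: "(\<integral>\<^sup>+x. ennreal (\<bar>u n x - f x\<bar> powr p) \<partial>M) \<le> ennreal c"
    if c: "\<forall>l\<ge>n0. (\<integral>x. \<bar>u n x - u l x\<bar> powr p \<partial>M) \<le> c" for n n0 c
  proof -
    have "(\<integral>\<^sup>+x. ennreal (\<bar>u n x - f x\<bar> powr p) \<partial>M) = (\<integral>\<^sup>+x. liminf (\<lambda>k. ennreal (\<bar>u n x - u (r k) x\<bar> powr p)) \<partial>M)"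
    proof (rule nn_integral_cong_AE)
      show "AE x in M. ennreal (\<bar>u n x - f x\<bar> powr p) = liminf (\<lambda>k. ennreal (\<bar>u n x - u (r k) x\<bar> powr p))"
        using lim
      proof eventually_elim
        case (elim x)
        have "(\<lambda>k. ennreal (\<bar>u n x - u (r k) x\<bar> powr p)) \<longlonglongrightarrow> ennreal (\<bar>u n x - f x\<bar> powr p)"
          using p by (intro tendsto_ennrealI tendsto_powr' tendsto_intros elim) auto
        then show ?case by (rule lim_imp_Liminf[OF sequentially_bot, symmetric])
      qed
    qed
    also have "\<dots> \<le> liminf (\<lambda>k. \<integral>\<^sup>+x. ennreal (\<bar>u n x - u (r k) x\<bar> powr p) \<partial>M)"
      by (rule nn_integral_liminf) simp
    also have "\<dots> \<le> liminf (\<lambda>k. ennreal c)"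
    proof (rule Liminf_mono)
      have "\<forall>\<^sub>F k in sequentially. k \<ge> n0" by (rule eventually_ge_at_top)
      then show "\<forall>\<^sub>F k in sequentially. (\<integral>\<^sup>+x. ennreal (\<bar>u n x - u (r k) x\<bar> powr p) \<partial>M) \<le> ennreal c"
      proof eventually_elim
        case (elim k)
        then have "r k \<ge> n0" using seq_suble[OF r, of k] by simp
        then show ?case using c by (subst nn_integral_eq_integral[OF i]) (auto intro!: ennreal_leI)
      qed
    qed
    also have "\<dots> = ennreal c" by (simp add: Liminf_const)
    finally show ?thesis .
  qed
  have int_if: "integrable M (\<lambda>x. \<bar>u n x - f x\<bar> powr p) \<and> (\<integral>x. \<bar>u n x - f x\<bar> powr p \<partial>M) \<le> c"
    if c: "\<forall>l\<ge>n0. (\<integral>x. \<bar>u n x - u l x\<bar> powr p \<partial>M) \<le> c" for n n0 c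
  proof -
    have "(\<integral>x. \<bar>u n x - u n0 x\<bar> powr p \<partial>M) \<le> c" using c by simp
    then have c0: "c \<ge> 0" by (rule order_trans[rotated]) simp
    note F = Fatou[OF c]
    have int: "integrable M (\<lambda>x. \<bar>u n x - f x\<bar> powr p)"
    proof (rule integrableI_bounded)
      show "(\<integral>\<^sup>+x. ennreal (norm (\<bar>u n x - f x\<bar> powr p)) \<partial>M) < \<infinity>"
        using le_less_trans[OF F ennreal_less_top] by simp
    qed simp
    moreover have "(\<integral>x. \<bar>u n x - f x\<bar> powr p \<partial>M) \<le> c"
      using F c0 by (subst (asm) nn_integral_eq_integral[OF int]) (auto simp: ennreal_le_iff)
    ultimately show ?thesis by blast
  qed
  have small: "\<exists>N. \<forall>n\<ge>N. integrable M (\<lambda>x. \<bar>u n x - f x\<bar> powr p) \<and> (\<integral>x. \<bar>u n x - f x\<bar> powr p \<partial>M) \<le> e" if e: "e > 0" for e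
  proof -
    obtain n0 where n0: "\<forall>n\<ge>n0. \<forall>k\<ge>n0. (\<integral>x. \<bar>u n x - u k x\<bar> powr p \<partial>M) < e" using C[OF e] by blast
    have "integrable M (\<lambda>x. \<bar>u n x - f x\<bar> powr p) \<and> (\<integral>x. \<bar>u n x - f x\<bar> powr p \<partial>M) \<le> e" if "n \<ge> n0" for n
      by (rule int_if[of n0]) (use n0 that in \<open>auto intro: less_imp_le\<close>)
    then show ?thesis by blast
  qed
  obtain n1 where n1: "integrable M (\<lambda>x. \<bar>u n1 x - f x\<bar> powr p)" using small[of 1] by auto
  have int_all: "integrable M (\<lambda>x. \<bar>u n x - f x\<bar> powr p)" for n
    using integrable_abs_add_powr(1)[OF p _ _ i[of n n1] n1] by simp
  have "(\<lambda>n. \<integral>x. \<bar>u n x - f x\<bar> powr p \<partial>M) \<longlonglongrightarrow> 0"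
  proof (rule LIMSEQ_I)
    fix e :: real assume "e > 0"
    then obtain n0 where "\<forall>n\<ge>n0. (\<integral>x. \<bar>u n x - f x\<bar> powr p \<partial>M) \<le> e / 2" using small[of "e / 2"] by auto
    then show "\<exists>no. \<forall>n\<ge>no. norm ((\<integral>x. \<bar>u n x - f x\<bar> powr p \<partial>M) - 0) < e"
      using \<open>e > 0\<close> by (intro exI[of _ n0]) (auto simp: abs_of_nonneg intro: le_less_trans)
  qed
  then show ?thesis using mf int_all r lim by blast
qed

lemma Lp_limit_of_bounded:
  fixes u :: "nat \<Rightarrow> 'a \<Rightarrow> real"
  assumes P: "P > 0" and m [measurable]: "\<And>n. u n \<in> borel_measurable M" and mf [measurable]: "f \<in> borel_measurable M"
    and lim: "AE x in M. (\<lambda>n. u n x) \<longlonglongrightarrow> f x"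
    and i: "\<And>n. integrable M (\<lambda>x. \<bar>u n x\<bar> powr P)" and B: "\<And>n. (\<integral>x. \<bar>u n x\<bar> powr P \<partial>M) \<le> B n" "B \<longlonglongrightarrow> b"
  shows "integrable M (\<lambda>x. \<bar>f x\<bar> powr P)" "(\<integral>x. \<bar>f x\<bar> powr P \<partial>M) \<le> b"
proof -
  have B0: "B n \<ge> 0" for n by (rule order_trans[OF _ B(1)[of n]]) simp
  have b0: "b \<ge> 0" by (rule LIMSEQ_le_const[OF B(2)]) (use B0 in auto)
  have "(\<integral>\<^sup>+x. ennreal (\<bar>f x\<bar> powr P) \<partial>M) = (\<integral>\<^sup>+x. liminf (\<lambda>k. ennreal (\<bar>u k x\<bar> powr P)) \<partial>M)"
  proof (rule nn_integral_cong_AE)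
    show "AE x in M. ennreal (\<bar>f x\<bar> powr P) = liminf (\<lambda>k. ennreal (\<bar>u k x\<bar> powr P))"
      using lim
    proof eventually_elim
      case (elim x)
      have "(\<lambda>k. ennreal (\<bar>u k x\<bar> powr P)) \<longlonglongrightarrow> ennreal (\<bar>f x\<bar> powr P)"
        using P by (intro tendsto_ennrealI tendsto_powr' tendsto_intros elim) auto
      then show ?case by (rule lim_imp_Liminf[OF sequentially_bot, symmetric])
    qed
  qed
  also have "\<dots> \<le> liminf (\<lambda>k. \<integral>\<^sup>+x. ennreal (\<bar>u k x\<bar> powr P) \<partial>M)"
    by (rule nn_integral_liminf) simp
  also have "\<dots> \<le> liminf (\<lambda>k. ennreal (B k))"
  proof (rule Liminf_mono, rule always_eventually, rule allI)
    show "(\<integral>\<^sup>+x. ennreal (\<bar>u k x\<bar> powr P) \<partial>M) \<le> ennreal (B k)" for k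
      using B(1) by (subst nn_integral_eq_integral[OF i]) (auto intro!: ennreal_leI)
  qed
  also have "\<dots> = ennreal b"
    by (rule lim_imp_Liminf[OF sequentially_bot]) (intro tendsto_ennrealI B(2))
  finally have F: "(\<integral>\<^sup>+x. ennreal (\<bar>f x\<bar> powr P) \<partial>M) \<le> ennreal b" .
  show int: "integrable M (\<lambda>x. \<bar>f x\<bar> powr P)"
  proof (rule integrableI_bounded)
    show "(\<integral>\<^sup>+x. ennreal (norm (\<bar>f x\<bar> powr P)) \<partial>M) < \<infinity>"
      using le_less_trans[OF F ennreal_less_top] by simp
  qed simp
  show "(\<integral>x. \<bar>f x\<bar> powr P \<partial>M) \<le> b"
    using F b0 by (subst (asm) nn_integral_eq_integral[OF int]) (auto simp: ennreal_le_iff)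
qed

text \<open>The pointwise bound \<open>|y|^q \<le> t^q (1 + |y / t|^P)\<close> takes the place of Hoelder's inequality; the
  parameter \<open>t\<close> makes the result scale like a norm.\<close>

lemma (in finite_measure) integrable_lower_exponent:
  fixes f :: "'a \<Rightarrow> real"
  assumes q: "0 < q" "q \<le> P" and m [measurable]: "f \<in> borel_measurable M"
    and i: "integrable M (\<lambda>x. \<bar>f x\<bar> powr P)"
  shows "integrable M (\<lambda>x. \<bar>f x\<bar> powr q)"
    and "t > 0 \<Longrightarrow> (\<integral>x. \<bar>f x\<bar> powr P \<partial>M) \<le> t powr P \<Longrightarrow> (\<integral>x. \<bar>f x\<bar> powr q \<partial>M) \<le> t powr q * (measure M (space M) + 1)"
proof -
  have key: "\<bar>f x\<bar> powr q \<le> t powr q * (1 + t powr (- P) * \<bar>f x\<bar> powr P)" if t: "t > 0" for t x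
  proof (cases "\<bar>f x\<bar> \<le> t")
    case True
    then have "\<bar>f x\<bar> powr q \<le> t powr q * 1" using q powr_mono2[of q "\<bar>f x\<bar>" t] by simp
    also have "\<dots> \<le> t powr q * (1 + t powr (- P) * \<bar>f x\<bar> powr P)" by (rule mult_left_mono) simp_all
    finally show ?thesis .
  next
    case False
    then have "1 powr P \<le> (\<bar>f x\<bar> / t) powr P \<and> (\<bar>f x\<bar> / t) powr q \<le> (\<bar>f x\<bar> / t) powr P"
      using q t by (intro conjI powr_mono2 powr_mono) auto
    then have "\<bar>f x\<bar> powr q / t powr q \<le> \<bar>f x\<bar> powr P / t powr P" using t by (simp add: powr_divide)
    then have "\<bar>f x\<bar> powr q \<le> t powr q * (t powr (- P) * \<bar>f x\<bar> powr P)"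
      using t by (simp add: powr_minus field_simps)
    also have "\<dots> \<le> t powr q * (1 + t powr (- P) * \<bar>f x\<bar> powr P)" by (rule mult_left_mono) simp_all
    finally show ?thesis .
  qed
  have i2: "integrable M (\<lambda>x. t powr q * (1 + t powr (- P) * \<bar>f x\<bar> powr P))" for t
    by (intro integrable_mult_right Bochner_Integration.integrable_add integrable_const i)
  show i3: "integrable M (\<lambda>x. \<bar>f x\<bar> powr q)"
  proof (rule Bochner_Integration.integrable_bound[OF i2[of 1]])
    show "AE x in M. norm (\<bar>f x\<bar> powr q) \<le> norm (1 powr q * (1 + 1 powr (- P) * \<bar>f x\<bar> powr P))"
      by (rule AE_I2) (use key[of 1] in simp)
  qed simp
  assume t: "t > 0" "(\<integral>x. \<bar>f x\<bar> powr P \<partial>M) \<le> t powr P"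
  have "(\<integral>x. \<bar>f x\<bar> powr q \<partial>M) \<le> (\<integral>x. t powr q * (1 + t powr (- P) * \<bar>f x\<bar> powr P) \<partial>M)"
    by (rule integral_mono[OF i3 i2 key[OF t(1)]])
  also have "\<dots> = t powr q * (measure M (space M) + t powr (- P) * (\<integral>x. \<bar>f x\<bar> powr P \<partial>M))"
    using i by simp
  also have "\<dots> \<le> t powr q * (measure M (space M) + t powr (- P) * t powr P)"
    by (intro mult_left_mono add_left_mono t(2)) simp_all
  also have "t powr (- P) * t powr P = 1" using t(1) by (simp flip: powr_add)
  finally show "(\<integral>x. \<bar>f x\<bar> powr q \<partial>M) \<le> t powr q * (measure M (space M) + 1)" .
qed

text \<open>A theorem of Vitali type.  Truncated at a height \<open>K\<close>, the differences converge by dominated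
  convergence; what exceeds \<open>K\<close> contributes at most \<open>K^(q-P)\<close> times a bound for the integrals of
  their \<open>P\<close>-th powers, and this is small for large \<open>K\<close>.\<close>

lemma (in finite_measure) Lq_convergence_of_AE_bounded:
  fixes u :: "nat \<Rightarrow> 'a \<Rightarrow> real"
  assumes q: "0 < q" "q < P" and m [measurable]: "\<And>n. u n \<in> borel_measurable M" and mf [measurable]: "f \<in> borel_measurable M"
    and lim: "AE x in M. (\<lambda>n. u n x) \<longlonglongrightarrow> f x"
    and i: "\<And>n. integrable M (\<lambda>x. \<bar>u n x\<bar> powr P)" and B: "\<And>n. (\<integral>x. \<bar>u n x\<bar> powr P \<partial>M) \<le> B"
  shows "(\<lambda>n. \<integral>x. \<bar>u n x - f x\<bar> powr q \<partial>M) \<longlonglongrightarrow> 0"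
proof -
  have P: "P > 0" using q by simp
  note f = Lp_limit_of_bounded[OF P m mf lim i B tendsto_const]
  define w where "w n x = u n x - f x" for n x
  have mw [measurable]: "w n \<in> borel_measurable M" for n unfolding w_def[abs_def] by simp
  have fm: "integrable M (\<lambda>x. \<bar>- f x\<bar> powr P)" "(\<integral>x. \<bar>- f x\<bar> powr P \<partial>M) \<le> B" using f by simp_all
  have iw: "integrable M (\<lambda>x. \<bar>w n x\<bar> powr P)" for n
    using integrable_abs_add_powr(1)[OF P _ _ i[of n] fm(1)] by (simp add: w_def)
  define B' where "B' = 2 powr P * (B + B)"
  have Bw: "(\<integral>x. \<bar>w n x\<bar> powr P \<partial>M) \<le> B'" for n
  proof -
    have "(\<integral>x. \<bar>w n x\<bar> powr P \<partial>M) \<le> 2 powr P * ((\<integral>x. \<bar>u n x\<bar> powr P \<partial>M) + (\<integral>x. \<bar>- f x\<bar> powr P \<partial>M))"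
      using integrable_abs_add_powr(2)[OF P _ _ i[of n] fm(1)] by (simp add: w_def)
    also have "\<dots> \<le> B'" unfolding B'_def using B fm(2) by (intro mult_left_mono add_mono) auto
    finally show ?thesis .
  qed
  have B'0: "B' \<ge> 0" by (rule order_trans[OF _ Bw[of 0]]) simp
  have iq: "integrable M (\<lambda>x. \<bar>w n x\<bar> powr q)" for n
    by (rule integrable_lower_exponent(1)[of q P]) (use q iw in auto)
  have key: "\<bar>w n x\<bar> powr q \<le> (min \<bar>w n x\<bar> K) powr q + K powr (q - P) * \<bar>w n x\<bar> powr P" if "K > 0" for K n x
  proof (cases "\<bar>w n x\<bar> \<le> K")
    case False
    then have "\<bar>w n x\<bar> powr (q - P) \<le> K powr (q - P)" using q that by (intro powr_mono2') auto
    then have "\<bar>w n x\<bar> powr (q - P) * \<bar>w n x\<bar> powr P \<le> K powr (q - P) * \<bar>w n x\<bar> powr P"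
      by (rule mult_right_mono) simp
    moreover have "\<bar>w n x\<bar> powr (q - P) * \<bar>w n x\<bar> powr P = \<bar>w n x\<bar> powr q" by (simp flip: powr_add)
    ultimately show ?thesis by (simp add: add_increasing)
  qed (use that in \<open>simp add: min_def\<close>)
  have tr: "(\<lambda>n. \<integral>x. (min \<bar>w n x\<bar> K) powr q \<partial>M) \<longlonglongrightarrow> 0" if "K > 0" for K
  proof -
    have "(\<lambda>n. \<integral>x. (min \<bar>w n x\<bar> K) powr q \<partial>M) \<longlonglongrightarrow> (\<integral>x. 0 \<partial>M)"
    proof (rule integral_dominated_convergence[where w = "\<lambda>x. K powr q"])
      show "AE x in M. (\<lambda>n. (min \<bar>w n x\<bar> K) powr q) \<longlonglongrightarrow> 0"
        using lim
      proof eventually_elim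
        case (elim x)
        have "(\<lambda>n. min \<bar>w n x\<bar> K) \<longlonglongrightarrow> min \<bar>f x - f x\<bar> K" unfolding w_def by (intro tendsto_intros elim)
        then have "(\<lambda>n. min \<bar>w n x\<bar> K) \<longlonglongrightarrow> 0" using that by simp
        then have "(\<lambda>n. (min \<bar>w n x\<bar> K) powr q) \<longlonglongrightarrow> 0 powr q"
          using q that by (intro tendsto_powr' tendsto_const) auto
        then show ?case by simp
      qed
      show "AE x in M. norm ((min \<bar>w n x\<bar> K) powr q) \<le> K powr q" for n
        using q that by (auto intro!: AE_I2 powr_mono2)
    qed auto
    then show ?thesis by simp
  qed
  show ?thesis
  proof (rule LIMSEQ_I)
    fix e :: real assume e: "e > 0"
    have "((\<lambda>K. K powr (q - P) * B') \<longlongrightarrow> 0 * B') at_top"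
      using q by (intro tendsto_mult tendsto_const tendsto_neg_powr filterlim_ident) simp
    then have "\<forall>\<^sub>F K in at_top. K powr (q - P) * B' < e / 2" using e by (intro order_tendstoD(2)) auto
    then have "\<forall>\<^sub>F K in at_top. K powr (q - P) * B' < e / 2 \<and> K > 0" using eventually_gt_at_top[of 0] by eventually_elim simp
    then obtain K where K: "K powr (q - P) * B' < e / 2" "K > 0" unfolding eventually_at_top_linorder by blast
    obtain n0 where n0: "\<And>n. n \<ge> n0 \<Longrightarrow> (\<integral>x. (min \<bar>w n x\<bar> K) powr q \<partial>M) < e / 2"
      using order_tendstoD(2)[OF tr[OF K(2)], of "e / 2"] e by (auto simp: eventually_sequentially)
    have "norm ((\<integral>x. \<bar>w n x\<bar> powr q \<partial>M) - 0) < e" if "n \<ge> n0" for n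
    proof -
      have imin: "integrable M (\<lambda>x. (min \<bar>w n x\<bar> K) powr q)"
      proof (rule Bochner_Integration.integrable_bound[OF integrable_const[of "K powr q"]])
        show "AE x in M. norm ((min \<bar>w n x\<bar> K) powr q) \<le> norm (K powr q)"
          using q K(2) by (auto intro!: AE_I2 powr_mono2)
      qed simp
      have "(\<integral>x. \<bar>w n x\<bar> powr q \<partial>M) \<le> (\<integral>x. (min \<bar>w n x\<bar> K) powr q + K powr (q - P) * \<bar>w n x\<bar> powr P \<partial>M)"
        by (rule integral_mono[OF iq _ key[OF K(2)]])
          (intro Bochner_Integration.integrable_add integrable_mult_right imin iw)
      also have "\<dots> = (\<integral>x. (min \<bar>w n x\<bar> K) powr q \<partial>M) + K powr (q - P) * (\<integral>x. \<bar>w n x\<bar> powr P \<partial>M)"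
        by (subst Bochner_Integration.integral_add[OF imin integrable_mult_right[OF iw]]) simp
      also have "\<dots> \<le> (\<integral>x. (min \<bar>w n x\<bar> K) powr q \<partial>M) + K powr (q - P) * B'"
        by (intro add_left_mono mult_left_mono Bw) simp
      also have "\<dots> < e" using n0[OF that] K(1) by simp
      finally show ?thesis by simp
    qed
    then show "\<exists>no. \<forall>n\<ge>no. norm ((\<integral>x. \<bar>u n x - f x\<bar> powr q \<partial>M) - 0) < e" unfolding w_def by blast
  qed
qed

section \<open>Compactness in the space of integrable functions\<close>

text \<open>Not normalised: the mean value over the ball, times the volume of the ball.\<close>

definition ball_average :: "('a::euclidean_space \<Rightarrow> real) \<Rightarrow> real \<Rightarrow> 'a \<Rightarrow> real" where
  "ball_average f r x = (\<integral>h. indicator (ball 0 r) h * f (x + h) \<partial>lborel)"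

lemma integrable_translate:
  fixes f :: "'a::euclidean_space \<Rightarrow> real"
  assumes f: "integrable lborel f"
  shows "integrable lborel (\<lambda>h. f (x + h))"
proof -
  have m: "f \<in> borel_measurable borel" using borel_measurable_integrable[OF f] by simp
  have "integrable (distr lborel borel ((+) x)) f" using f by (simp add: lborel_distr_plus)
  then show ?thesis using m by (subst (asm) integrable_distr_eq) auto
qed

lemma integrable_indicator_ball_mult:
  fixes f :: "'a::euclidean_space \<Rightarrow> real"
  assumes f: "integrable lborel f"
  shows "integrable lborel (\<lambda>h. indicator (ball c r) h * f h)"
proof (rule Bochner_Integration.integrable_bound[OF f])
  have "(indicator (ball c r) :: 'a \<Rightarrow> real) \<in> borel_measurable borel"
    by (intro borel_measurable_indicator borel_open open_ball)
  then show "(\<lambda>h. indicator (ball c r) h * f h) \<in> borel_measurable lborel"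
    using borel_measurable_integrable[OF f] by simp
qed (auto simp: indicator_def)

context
  fixes f :: "'a::euclidean_space \<Rightarrow> real" and G S A
  assumes f: "C1_compact S f G" and A: "(\<integral>x. \<bar>f x\<bar> \<partial>lborel) \<le> A" "(\<integral>x. norm (G x) \<partial>lborel) \<le> A"
begin

lemma L1_bound_nonneg: "A \<ge> 0"
  by (rule order_trans[OF _ A(1)]) simp

lemma integrable_ball_average: "integrable lborel (\<lambda>h. indicator (ball 0 r) h * f (x + h))"
  by (rule integrable_indicator_ball_mult[OF integrable_translate[OF C1_compact_integrable(1)[OF f]]])

lemma ball_average_bounded: "\<bar>ball_average f r x\<bar> \<le> A"
proof -
  have i: "integrable lborel (\<lambda>h. \<bar>f (h + x)\<bar>)"
    using integrable_translate[OF C1_compact_integrable(1)[OF f], of x] by (simp add: add.commute)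
  have "\<bar>ball_average f r x\<bar> \<le> (\<integral>h. \<bar>indicator (ball 0 r) h * f (x + h)\<bar> \<partial>lborel)"
    unfolding ball_average_def by (rule integral_abs_bound)
  also have "\<dots> \<le> (\<integral>h. \<bar>f (h + x)\<bar> \<partial>lborel)"
  proof (rule integral_mono[OF _ i])
    show "integrable lborel (\<lambda>h. \<bar>indicator (ball 0 r) h * f (x + h)\<bar>)"
      by (rule integrable_abs[OF integrable_ball_average])
  qed (simp add: indicator_def add.commute)
  also have "\<dots> = (\<integral>h. \<bar>f h\<bar> \<partial>lborel)"
  proof (rule integral_translate)
    have "f \<in> borel_measurable borel" using C1_compactD(3)[OF f] by (rule borel_measurable_continuous_onI)
    then show "(\<lambda>h. \<bar>f h\<bar>) \<in> borel_measurable borel" by simp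
  qed
  finally show ?thesis using A(1) by simp
qed

lemma ball_average_Lipschitz: "\<bar>ball_average f r x - ball_average f r y\<bar> \<le> norm (x - y) * A"
proof -
  have [measurable]: "f \<in> borel_measurable borel" using C1_compactD(3)[OF f] by (rule borel_measurable_continuous_onI)
  have "ball_average f r x - ball_average f r y
      = (\<integral>h. indicator (ball 0 r) h * f (x + h) - indicator (ball 0 r) h * f (y + h) \<partial>lborel)"
    unfolding ball_average_def
    by (rule Bochner_Integration.integral_diff[symmetric]) (rule integrable_ball_average)+
  then have "ennreal \<bar>ball_average f r x - ball_average f r y\<bar>
      = ennreal (norm (\<integral>h. indicator (ball 0 r) h * f (x + h) - indicator (ball 0 r) h * f (y + h) \<partial>lborel))" by simp
  also have "\<dots> \<le> (\<integral>\<^sup>+h. ennreal (norm (indicator (ball 0 r) h * f (x + h) - indicator (ball 0 r) h * f (y + h))) \<partial>lborel)"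
    by (rule integral_norm_bound_ennreal) (intro Bochner_Integration.integrable_diff integrable_ball_average)
  also have "\<dots> \<le> (\<integral>\<^sup>+h. ennreal \<bar>f ((h + y) + (x - y)) - f (h + y)\<bar> \<partial>lborel)"
    by (intro nn_integral_mono ennreal_leI) (simp add: indicator_def add.commute)
  also have "\<dots> = (\<integral>\<^sup>+h. ennreal \<bar>f (h + (x - y)) - f h\<bar> \<partial>lborel)"
    by (rule nn_integral_translate[of "\<lambda>h. ennreal \<bar>f (h + (x - y)) - f h\<bar>" y]) measurable
  also have "\<dots> \<le> ennreal (norm (x - y) * (\<integral>x. norm (G x) \<partial>lborel))"
    by (rule nn_integral_translation_difference_le[OF f])
  also have "\<dots> \<le> ennreal (norm (x - y) * A)" by (intro ennreal_leI mult_left_mono A(2)) simp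
  finally show ?thesis using L1_bound_nonneg by (subst (asm) ennreal_le_iff) auto
qed

lemma continuous_ball_average: "continuous_on UNIV (ball_average f r)"
proof (rule continuous_onI)
  fix x :: 'a and e :: real assume e: "e > 0"
  show "\<exists>d>0. \<forall>x'\<in>UNIV. dist x' x < d \<longrightarrow> dist (ball_average f r x') (ball_average f r x) \<le> e"
  proof (intro exI[of _ "e / (A + 1)"] conjI ballI impI)
    show "0 < e / (A + 1)" using e L1_bound_nonneg by simp
    fix x' assume "dist x' x < e / (A + 1)"
    then have "norm (x' - x) * A \<le> (e / (A + 1)) * A"
      using L1_bound_nonneg by (intro mult_right_mono) (auto simp: dist_norm)
    also have "\<dots> \<le> e" using e L1_bound_nonneg by (simp add: field_simps)
    finally show "dist (ball_average f r x') (ball_average f r x) \<le> e"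
      using ball_average_Lipschitz[of r x' x] by (simp add: dist_real_def)
  qed
qed

lemma integral_ball_average_difference_le:
  assumes r: "r > 0"
  defines "V \<equiv> unit_ball_vol (real DIM('a)) * r ^ DIM('a)"
  shows "(\<integral>\<^sup>+x. ennreal \<bar>V * f x - ball_average f r x\<bar> \<partial>lborel) \<le> ennreal (V * (r * A))"
proof -
  have V: "V > 0" using r by (simp add: V_def)
  have iB: "integrable lborel (\<lambda>h. indicator (ball (0::'a) r) h :: real)"
    using r by (intro integrable_real_indicator) (auto simp: emeasure_ball intro: borel_open)
  have mV: "measure lborel (ball (0::'a) r) = V"
    using r by (simp add: measure_def emeasure_ball V_def)
  have le: "ennreal \<bar>V * f x - ball_average f r x\<bar> \<le> (\<integral>\<^sup>+h. indicator (ball 0 r) h * ennreal \<bar>f (x + h) - f x\<bar> \<partial>lborel)" for x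
  proof -
    have "V * f x = (\<integral>h. indicator (ball (0::'a) r) h * f x \<partial>lborel)"
      using mV by simp
    then have "V * f x - ball_average f r x = (\<integral>h. indicator (ball 0 r) h * f x - indicator (ball 0 r) h * f (x + h) \<partial>lborel)"
      unfolding ball_average_def
      by (subst Bochner_Integration.integral_diff[OF integrable_mult_left[OF iB] integrable_ball_average]) simp
    then have "ennreal \<bar>V * f x - ball_average f r x\<bar>
        = ennreal (norm (\<integral>h. indicator (ball 0 r) h * f x - indicator (ball 0 r) h * f (x + h) \<partial>lborel))" by simp
    also have "\<dots> \<le> (\<integral>\<^sup>+h. ennreal (norm (indicator (ball 0 r) h * f x - indicator (ball 0 r) h * f (x + h))) \<partial>lborel)"
      by (rule integral_norm_bound_ennreal) (intro Bochner_Integration.integrable_diff integrable_ball_average integrable_mult_left iB)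
    also have "\<dots> = (\<integral>\<^sup>+h. indicator (ball 0 r) h * ennreal \<bar>f (x + h) - f x\<bar> \<partial>lborel)"
      by (intro nn_integral_cong) (simp add: indicator_def abs_minus_commute)
    finally show ?thesis .
  qed
  have "(\<integral>\<^sup>+x. ennreal \<bar>V * f x - ball_average f r x\<bar> \<partial>lborel)
      \<le> (\<integral>\<^sup>+x. (\<integral>\<^sup>+h. indicator (ball 0 r) h * ennreal \<bar>f (x + h) - f x\<bar> \<partial>lborel) \<partial>lborel)"
    by (rule nn_integral_mono) (rule le)
  also have "\<dots> \<le> ennreal (V * (r * (\<integral>x. norm (G x) \<partial>lborel)))"
    unfolding V_def using nn_integral_ball_difference_le[OF f, of r] r by simp
  also have "\<dots> \<le> ennreal (V * (r * A))"
    using V r by (intro ennreal_leI mult_left_mono A(2)) auto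
  finally show ?thesis .
qed

end

text \<open>Averages over balls of a fixed radius are uniformly bounded and equally Lipschitz.  A diagonal
  subsequence makes them converge at the points of a countable dense set, for all radii
  \<open>1 / (j + 1)\<close>, hence everywhere, and by dominated convergence in \<open>L\<^sup>1\<close>.  As the radius tends to
  zero, the normalised averages approximate the functions in \<open>L\<^sup>1\<close> at a rate that depends only on \<open>A\<close>.\<close>

lemma L1_compactness:
  fixes f :: "nat \<Rightarrow> 'a::euclidean_space \<Rightarrow> real"
  assumes f: "\<And>n. C1_compact (cball 0 R) (f n) (G n)"
    and A: "\<And>n. (\<integral>x. \<bar>f n x\<bar> \<partial>lborel) \<le> A" "\<And>n. (\<integral>x. norm (G n x) \<partial>lborel) \<le> A"
  shows "\<exists>k. strict_mono (k :: nat \<Rightarrow> nat) \<and> (\<forall>e>0. \<exists>N. \<forall>m\<ge>N. \<forall>n\<ge>N. (\<integral>x. \<bar>f (k m) x - f (k n) x\<bar> \<partial>lborel) < e)"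
proof -
  have A0: "A \<ge> 0" by (rule L1_bound_nonneg[OF f A])
  define r where "r j = 1 / real (Suc j)" for j
  have r: "r j > 0" "r j \<le> 1" for j by (auto simp: r_def)
  obtain D :: "'a set" where D: "countable D" "D \<subseteq> UNIV" "UNIV \<subseteq> closure D"
    by (rule separable[of "UNIV :: 'a set"])
  define \<F> where "\<F> n = (\<lambda>(x, j). ball_average (f n) (r j) x)" for n
  obtain k where k: "strict_mono (k::nat \<Rightarrow> nat)" "\<And>z. z \<in> D \<times> (UNIV :: nat set) \<Longrightarrow> \<exists>l. (\<lambda>n. \<F> (k n) z) \<longlonglongrightarrow> l"
  proof (rule function_convergent_subsequence[of "D \<times> (UNIV :: nat set)" \<F> A])
    show "countable (D \<times> (UNIV :: nat set))" using D by auto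
    show "norm (\<F> n z) \<le> A" for n z
      unfolding \<F>_def by (cases z) (simp add: ball_average_bounded[OF f A])
  qed blast
  define a where "a j n x = ball_average (f (k n)) (r j) x" for j n x
  have aD: "Cauchy (\<lambda>n. a j n x)" if "x \<in> D" for j x
    using k(2)[of "(x, j)"] that by (auto simp: \<F>_def a_def intro: convergent_Cauchy convergentI)
  have aC: "convergent (\<lambda>n. a j n x)" for j x
  proof (rule Cauchy_convergent, rule metric_CauchyI)
    fix e :: real assume e: "e > 0"
    have "x \<in> closure D" using D(3) by blast
    moreover have "e / (3 * (A + 1)) > 0" using e A0 by simp
    ultimately obtain y where y: "y \<in> D" "dist y x < e / (3 * (A + 1))" unfolding closure_approachable by blast
    have nA: "norm (x - y) * A < e / 3"
    proof -
      have "norm (x - y) * A \<le> norm (x - y) * (A + 1)" by (intro mult_left_mono) auto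
      also have "\<dots> < e / (3 * (A + 1)) * (A + 1)" using y(2) A0 by (intro mult_strict_right_mono) (auto simp: dist_norm norm_minus_commute)
      also have "\<dots> = e / 3" using A0 by (simp add: field_simps)
      finally show ?thesis .
    qed
    have L: "\<bar>a j n x - a j n y\<bar> < e / 3" for n
      unfolding a_def using ball_average_Lipschitz[OF f A, of "k n" "r j" x y] nA by linarith
    obtain M where M: "\<And>m n. m \<ge> M \<Longrightarrow> n \<ge> M \<Longrightarrow> dist (a j m y) (a j n y) < e / 3"
      using metric_CauchyD[OF aD[OF y(1), of j], of "e / 3"] e by auto
    show "\<exists>M. \<forall>m\<ge>M. \<forall>n\<ge>M. dist (a j m x) (a j n x) < e"
    proof (intro exI[of _ M] allI impI)
      fix m n assume "m \<ge> M" "n \<ge> M"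
      then show "dist (a j m x) (a j n x) < e" using M[of m n] L[of m] L[of n] unfolding dist_real_def by linarith
    qed
  qed
  define g where "g j x = lim (\<lambda>n. a j n x)" for j x
  have ag: "(\<lambda>n. a j n x) \<longlonglongrightarrow> g j x" for j x using aC unfolding g_def by (simp add: convergent_LIMSEQ_iff)
  have ca: "continuous_on UNIV (a j n)" for j n unfolding a_def by (rule continuous_ball_average[OF f A])
  have ma: "a j n \<in> borel_measurable borel" for j n by (rule borel_measurable_continuous_onI[OF ca])
  have mg: "g j \<in> borel_measurable borel" for j by (rule borel_measurable_LIMSEQ_real[OF ag ma])
  have fzero: "f n x = 0" if "x \<notin> cball 0 R" for n x
    using C1_compact_support[OF f[of n]] that by blast
  have asupp: "a j n x = 0" if "x \<notin> cball 0 (R + 1)" for j n x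
  proof -
    have z: "indicator (ball 0 (r j)) h * f (k n) (x + h) = 0" for h
    proof (cases "h \<in> ball 0 (r j)")
      case True
      then have "norm h < 1" using r(2)[of j] by simp
      moreover have "norm x \<le> norm (x + h) + norm h" by (rule norm_triangle_ineq4[of "x + h" h, simplified])
      ultimately have "x + h \<notin> cball 0 R" using that by simp
      then show ?thesis using fzero by simp
    qed simp
    show ?thesis unfolding a_def ball_average_def z by simp
  qed
  have aB: "\<bar>a j n x\<bar> \<le> A * indicator (cball 0 (R + 1)) x" for j n x
    using asupp[of x j n] ball_average_bounded[OF f A, of "k n" "r j" x] by (cases "x \<in> cball 0 (R + 1)") (simp_all add: a_def)
  have iB: "integrable lborel (\<lambda>x. indicator (cball (0::'a) (R + 1)) x :: real)"
    using emeasure_compact_finite[of "cball (0::'a) (R + 1)"] by (intro integrable_real_indicator) (auto intro: borel_closed)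
  have iBA: "integrable lborel (\<lambda>x. A * indicator (cball (0::'a) (R + 1)) x)" by (rule integrable_mult_right[OF iB])
  have ia: "integrable lborel (a j n)" for j n
    by (rule Bochner_Integration.integrable_bound[OF iBA]) (use ma aB A0 in \<open>auto simp: abs_of_nonneg\<close>)
  have gB: "\<bar>g j x\<bar> \<le> A * indicator (cball 0 (R + 1)) x" for j x
    by (rule LIMSEQ_le_const2[OF tendsto_rabs[OF ag]]) (use aB in blast)
  have ig: "integrable lborel (g j)" for j
    by (rule Bochner_Integration.integrable_bound[OF iBA]) (use mg gB A0 in \<open>auto simp: abs_of_nonneg\<close>)
  have conv: "(\<lambda>n. \<integral>x. \<bar>a j n x - g j x\<bar> \<partial>lborel) \<longlonglongrightarrow> 0" for j
  proof -
    have "(\<lambda>n. \<integral>x. \<bar>a j n x - g j x\<bar> \<partial>lborel) \<longlonglongrightarrow> (\<integral>x. 0 \<partial>(lborel :: 'a measure))"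
    proof (rule integral_dominated_convergence[where w = "\<lambda>x. 2 * (A * indicator (cball (0::'a) (R + 1)) x)"])
      show "integrable lborel (\<lambda>x. 2 * (A * indicator (cball (0::'a) (R + 1)) x))" by (rule integrable_mult_right[OF iBA])
      show "AE x in lborel. (\<lambda>n. \<bar>a j n x - g j x\<bar>) \<longlonglongrightarrow> 0"
      proof (rule AE_I2)
        fix x
        have "(\<lambda>n. \<bar>a j n x - g j x\<bar>) \<longlonglongrightarrow> \<bar>g j x - g j x\<bar>" by (intro tendsto_intros ag)
        then show "(\<lambda>n. \<bar>a j n x - g j x\<bar>) \<longlonglongrightarrow> 0" by simp
      qed
      show "AE x in lborel. norm \<bar>a j n x - g j x\<bar> \<le> 2 * (A * indicator (cball (0::'a) (R + 1)) x)" for n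
      proof (rule AE_I2)
        fix x show "norm \<bar>a j n x - g j x\<bar> \<le> 2 * (A * indicator (cball (0::'a) (R + 1)) x)"
          using aB[of j n x] gB[of j x] unfolding real_norm_def by linarith
      qed
    qed (use ma mg in auto)
    then show ?thesis by simp
  qed
  define V where "V j = unit_ball_vol (real DIM('a)) * r j ^ DIM('a)" for j
  have V: "V j > 0" for j using r by (simp add: V_def)
  have if': "integrable lborel (f n)" for n by (rule C1_compact_integrable(1)[OF f])
  have iva: "integrable lborel (\<lambda>x. \<bar>V j * f (k n) x - a j n x\<bar>)" for j n
    by (intro integrable_abs Bochner_Integration.integrable_diff integrable_mult_right if' ia)
  have va: "(\<integral>x. \<bar>V j * f (k n) x - a j n x\<bar> \<partial>lborel) \<le> V j * (r j * A)" for j n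
  proof -
    have "(\<integral>\<^sup>+x. ennreal \<bar>V j * f (k n) x - a j n x\<bar> \<partial>lborel) \<le> ennreal (V j * (r j * A))"
      unfolding a_def V_def by (rule integral_ball_average_difference_le[OF f A r(1)])
    moreover have "0 \<le> V j * (r j * A)" using V[of j] r(1)[of j] A0 by simp
    ultimately show ?thesis
      by (subst (asm) nn_integral_eq_integral[OF iva]) (auto simp: ennreal_le_iff)
  qed
  have main: "V j * (\<integral>x. \<bar>f (k m) x - f (k n) x\<bar> \<partial>lborel) \<le> 2 * (V j * (r j * A))
      + (\<integral>x. \<bar>a j m x - g j x\<bar> \<partial>lborel) + (\<integral>x. \<bar>a j n x - g j x\<bar> \<partial>lborel)" for j m n
  proof -
    have i1: "integrable lborel (\<lambda>x. \<bar>a j n x - g j x\<bar>)" for n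
      by (intro integrable_abs Bochner_Integration.integrable_diff ia ig)
    have "V j * (\<integral>x. \<bar>f (k m) x - f (k n) x\<bar> \<partial>lborel) = (\<integral>x. V j * \<bar>f (k m) x - f (k n) x\<bar> \<partial>lborel)" by simp
    also have "\<dots> \<le> (\<integral>x. (\<bar>V j * f (k m) x - a j m x\<bar> + \<bar>V j * f (k n) x - a j n x\<bar>)
        + (\<bar>a j m x - g j x\<bar> + \<bar>a j n x - g j x\<bar>) \<partial>lborel)"
    proof (rule integral_mono)
      show "integrable lborel (\<lambda>x. V j * \<bar>f (k m) x - f (k n) x\<bar>)"
        by (intro integrable_mult_right integrable_abs Bochner_Integration.integrable_diff if')
      show "integrable lborel (\<lambda>x. (\<bar>V j * f (k m) x - a j m x\<bar> + \<bar>V j * f (k n) x - a j n x\<bar>)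
        + (\<bar>a j m x - g j x\<bar> + \<bar>a j n x - g j x\<bar>))"
        by (intro Bochner_Integration.integrable_add iva i1)
      fix x
      have "V j * \<bar>f (k m) x - f (k n) x\<bar> = \<bar>V j * f (k m) x - V j * f (k n) x\<bar>"
        using V[of j] by (simp add: abs_mult flip: right_diff_distrib)
      then show "V j * \<bar>f (k m) x - f (k n) x\<bar> \<le> (\<bar>V j * f (k m) x - a j m x\<bar> + \<bar>V j * f (k n) x - a j n x\<bar>)
        + (\<bar>a j m x - g j x\<bar> + \<bar>a j n x - g j x\<bar>)" by linarith
    qed
    also have "\<dots> = ((\<integral>x. \<bar>V j * f (k m) x - a j m x\<bar> \<partial>lborel) + (\<integral>x. \<bar>V j * f (k n) x - a j n x\<bar> \<partial>lborel))
        + ((\<integral>x. \<bar>a j m x - g j x\<bar> \<partial>lborel) + (\<integral>x. \<bar>a j n x - g j x\<bar> \<partial>lborel))"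
      by (simp only: Bochner_Integration.integral_add iva i1 Bochner_Integration.integrable_add)
    finally show ?thesis using va[of j m] va[of j n] by linarith
  qed
  have cau: "\<exists>N. \<forall>m\<ge>N. \<forall>n\<ge>N. (\<integral>x. \<bar>f (k m) x - f (k n) x\<bar> \<partial>lborel) < e" if e: "e > 0" for e
  proof -
    have "(\<lambda>j. 2 * (r j * A)) \<longlonglongrightarrow> 2 * (0 * A)"
      unfolding r_def by (intro tendsto_intros LIMSEQ_Suc[OF lim_inverse_n'])
    from order_tendstoD(2)[OF this, of "e / 2"]
    have "\<forall>\<^sub>F j in sequentially. 2 * (r j * A) < e / 2" using e by simp
    then obtain j where j: "2 * (r j * A) < e / 2" unfolding eventually_sequentially by blast
    have Ve: "V j * e / 4 > 0" using V[of j] e by simp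
    then have "\<forall>\<^sub>F n in sequentially. (\<integral>x. \<bar>a j n x - g j x\<bar> \<partial>lborel) < V j * e / 4"
      by (intro order_tendstoD(2)[OF conv])
    then obtain N where N: "\<And>n. n \<ge> N \<Longrightarrow> (\<integral>x. \<bar>a j n x - g j x\<bar> \<partial>lborel) < V j * e / 4"
      unfolding eventually_sequentially by blast
    have "(\<integral>x. \<bar>f (k m) x - f (k n) x\<bar> \<partial>lborel) < e" if "m \<ge> N" "n \<ge> N" for m n
    proof -
      have "V j * (2 * (r j * A)) < V j * (e / 2)" using j V[of j] by (intro mult_strict_left_mono)
      then have "V j * (\<integral>x. \<bar>f (k m) x - f (k n) x\<bar> \<partial>lborel) < V j * e"
        using main[of j m n] N[OF that(1)] N[OF that(2)] by (simp add: algebra_simps)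
      then show ?thesis using V[of j] by (simp add: mult_less_cancel_left_pos)
    qed
    then show ?thesis by blast
  qed
  show ?thesis by (intro exI[of _ k] conjI allI impI k(1) cau)
qed

section \<open>Completions that embed into a Lebesgue space\<close>

locale seminormed_function_space =
  fixes V :: "('a \<Rightarrow> real) set" and p :: "('a \<Rightarrow> real) \<Rightarrow> real"
  assumes V_add: "f \<in> V \<Longrightarrow> g \<in> V \<Longrightarrow> (\<lambda>x. f x + g x) \<in> V"
    and V_scale: "f \<in> V \<Longrightarrow> (\<lambda>x. c * f x) \<in> V"
    and p_add: "f \<in> V \<Longrightarrow> g \<in> V \<Longrightarrow> p (\<lambda>x. f x + g x) \<le> p f + p g"
    and p_scale: "f \<in> V \<Longrightarrow> p (\<lambda>x. c * f x) = \<bar>c\<bar> * p f"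
    and p_nonneg: "f \<in> V \<Longrightarrow> p f \<ge> 0"
begin

lemma V_diff: "f \<in> V \<Longrightarrow> g \<in> V \<Longrightarrow> (\<lambda>x. f x - g x) \<in> V"
  using V_add[of f "\<lambda>x. (-1) * g x"] V_scale[of g "-1"] by simp

lemma p_diff_commute: "f \<in> V \<Longrightarrow> g \<in> V \<Longrightarrow> p (\<lambda>x. f x - g x) = p (\<lambda>x. g x - f x)"
  using p_scale[OF V_diff[of f g], of "-1"] by simp

lemma p_zero: "f \<in> V \<Longrightarrow> p (\<lambda>x. 0) = 0"
  using p_scale[of f 0] by simp

lemma p_triangle:
  assumes "f \<in> V" "g \<in> V" "h \<in> V"
  shows "p (\<lambda>x. f x - h x) \<le> p (\<lambda>x. f x - g x) + p (\<lambda>x. g x - h x)"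
  using p_add[OF V_diff[OF assms(1,2)] V_diff[OF assms(2,3)]] by simp

lemma p_reverse_triangle:
  assumes "f \<in> V" "g \<in> V"
  shows "\<bar>p f - p g\<bar> \<le> p (\<lambda>x. f x - g x)"
proof -
  have "p f \<le> p (\<lambda>x. f x - g x) + p g" using p_add[OF V_diff[OF assms] assms(2)] by simp
  moreover have "p g \<le> p (\<lambda>x. f x - g x) + p f"
    using p_add[OF V_diff[OF assms(2,1)] assms(1)] p_diff_commute[OF assms] by simp
  ultimately show ?thesis by linarith
qed

lemma cauchy_seqs_V: "u \<in> cauchy_seqs V p \<Longrightarrow> u n \<in> V"
  by (simp add: cauchy_seqs_def)

lemma cauchy_seqs_Cauchy:
  assumes "u \<in> cauchy_seqs V p" "e > 0"
  shows "\<exists>N. \<forall>m\<ge>N. \<forall>n\<ge>N. p (\<lambda>x. u m x - u n x) < e"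
  using assms by (simp add: cauchy_seqs_def)

lemma const_cauchy: "f \<in> V \<Longrightarrow> (\<lambda>n. f) \<in> cauchy_seqs V p"
  by (simp add: cauchy_seqs_def p_zero)

lemma cauchy_seqs_add:
  assumes u: "u \<in> cauchy_seqs V p" and v: "v \<in> cauchy_seqs V p"
  shows "(\<lambda>n x. u n x + v n x) \<in> cauchy_seqs V p"
  unfolding cauchy_seqs_def
proof (intro CollectI conjI allI impI)
  show "(\<lambda>x. u n x + v n x) \<in> V" for n by (intro V_add cauchy_seqs_V[OF u] cauchy_seqs_V[OF v])
  fix e :: real assume "e > 0"
  then have e2: "e / 2 > 0" by simp
  obtain N1 where N1: "\<And>m n. m \<ge> N1 \<Longrightarrow> n \<ge> N1 \<Longrightarrow> p (\<lambda>x. u m x - u n x) < e / 2"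
    using cauchy_seqs_Cauchy[OF u e2] by blast
  obtain N2 where N2: "\<And>m n. m \<ge> N2 \<Longrightarrow> n \<ge> N2 \<Longrightarrow> p (\<lambda>x. v m x - v n x) < e / 2"
    using cauchy_seqs_Cauchy[OF v e2] by blast
  show "\<exists>M. \<forall>m\<ge>M. \<forall>n\<ge>M. p (\<lambda>x. u m x + v m x - (u n x + v n x)) < e"
  proof (intro exI[of _ "max N1 N2"] allI impI)
    fix m n assume mn: "m \<ge> max N1 N2" "n \<ge> max N1 N2"
    have "p (\<lambda>x. (u m x - u n x) + (v m x - v n x)) \<le> p (\<lambda>x. u m x - u n x) + p (\<lambda>x. v m x - v n x)"
      by (intro p_add V_diff cauchy_seqs_V[OF u] cauchy_seqs_V[OF v])
    also have "\<dots> < e" using N1[of m n] N2[of m n] mn by simp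
    finally show "p (\<lambda>x. u m x + v m x - (u n x + v n x)) < e" by (simp add: algebra_simps)
  qed
qed

lemma cauchy_seqs_scale:
  assumes u: "u \<in> cauchy_seqs V p"
  shows "(\<lambda>n x. c * u n x) \<in> cauchy_seqs V p"
  unfolding cauchy_seqs_def
proof (intro CollectI conjI allI impI)
  show "(\<lambda>x. c * u n x) \<in> V" for n by (intro V_scale cauchy_seqs_V[OF u])
  fix e :: real assume e: "e > 0"
  then have e2: "e / (\<bar>c\<bar> + 1) > 0" by simp
  obtain N where N: "\<And>m n. m \<ge> N \<Longrightarrow> n \<ge> N \<Longrightarrow> p (\<lambda>x. u m x - u n x) < e / (\<bar>c\<bar> + 1)"
    using cauchy_seqs_Cauchy[OF u e2] by blast
  show "\<exists>M. \<forall>m\<ge>M. \<forall>n\<ge>M. p (\<lambda>x. c * u m x - c * u n x) < e"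
  proof (intro exI[of _ N] allI impI)
    fix m n assume mn: "m \<ge> N" "n \<ge> N"
    have "p (\<lambda>x. c * (u m x - u n x)) = \<bar>c\<bar> * p (\<lambda>x. u m x - u n x)"
      by (intro p_scale V_diff cauchy_seqs_V[OF u])
    also have "\<dots> \<le> (\<bar>c\<bar> + 1) * p (\<lambda>x. u m x - u n x)"
      by (intro mult_right_mono p_nonneg V_diff cauchy_seqs_V[OF u]) simp
    also have "\<dots> < (\<bar>c\<bar> + 1) * (e / (\<bar>c\<bar> + 1))" by (intro mult_strict_left_mono N mn) simp
    finally show "p (\<lambda>x. c * u m x - c * u n x) < e" by (simp add: right_diff_distrib)
  qed
qed

lemma cauchy_seqs_diff:
  assumes u: "u \<in> cauchy_seqs V p" and v: "v \<in> cauchy_seqs V p"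
  shows "(\<lambda>n x. u n x - v n x) \<in> cauchy_seqs V p"
  using cauchy_seqs_add[OF u cauchy_seqs_scale[OF v, of "-1"]] by simp

lemma cauchy_rel_iff:
  "(u, v) \<in> cauchy_rel V p \<longleftrightarrow> u \<in> cauchy_seqs V p \<and> v \<in> cauchy_seqs V p \<and> (\<lambda>n. p (\<lambda>x. u n x - v n x)) \<longlonglongrightarrow> 0"
  by (simp add: cauchy_rel_def)

lemma equiv_cauchy_rel: "equiv (cauchy_seqs V p) (cauchy_rel V p)"
proof (rule equivI)
  show "cauchy_rel V p \<subseteq> cauchy_seqs V p \<times> cauchy_seqs V p" by (auto simp: cauchy_rel_def)
  show "refl_on (cauchy_seqs V p) (cauchy_rel V p)"
    by (rule refl_onI) (simp add: cauchy_rel_iff p_zero[OF cauchy_seqs_V])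
  show "sym (cauchy_rel V p)"
  proof (rule symI)
    fix u v assume "(u, v) \<in> cauchy_rel V p"
    then have c: "u \<in> cauchy_seqs V p" "v \<in> cauchy_seqs V p" "(\<lambda>n. p (\<lambda>x. u n x - v n x)) \<longlonglongrightarrow> 0"
      by (auto simp: cauchy_rel_iff)
    have "p (\<lambda>x. v n x - u n x) = p (\<lambda>x. u n x - v n x)" for n
      by (intro p_diff_commute cauchy_seqs_V c)
    then show "(v, u) \<in> cauchy_rel V p" using c by (simp add: cauchy_rel_iff)
  qed
  show "trans (cauchy_rel V p)"
  proof (rule transI)
    fix u v w assume uv: "(u, v) \<in> cauchy_rel V p" and vw: "(v, w) \<in> cauchy_rel V p"
    then have c: "u \<in> cauchy_seqs V p" "v \<in> cauchy_seqs V p" "w \<in> cauchy_seqs V p" by (auto simp: cauchy_rel_iff)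
    have "(\<lambda>n. p (\<lambda>x. u n x - w n x)) \<longlonglongrightarrow> 0"
    proof (rule tendsto_sandwich[OF _ _ tendsto_const])
      show "(\<lambda>n. p (\<lambda>x. u n x - v n x) + p (\<lambda>x. v n x - w n x)) \<longlonglongrightarrow> 0"
        using tendsto_add[of "\<lambda>n. p (\<lambda>x. u n x - v n x)" 0 sequentially "\<lambda>n. p (\<lambda>x. v n x - w n x)" 0] uv vw
        by (simp add: cauchy_rel_iff)
    qed (use p_triangle p_nonneg V_diff cauchy_seqs_V[OF c(1)] cauchy_seqs_V[OF c(2)] cauchy_seqs_V[OF c(3)] in \<open>auto intro!: always_eventually\<close>)
    then show "(u, w) \<in> cauchy_rel V p" using c by (simp add: cauchy_rel_iff)
  qed
qed

lemma class_of_in_completion: "u \<in> cauchy_seqs V p \<Longrightarrow> cauchy_rel V p `` {u} \<in> completion V p"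
  unfolding completion_def by (rule quotientI)

lemma self_in_class: "u \<in> cauchy_seqs V p \<Longrightarrow> u \<in> cauchy_rel V p `` {u}"
  using equiv_class_self[OF equiv_cauchy_rel] .

lemma completion_nonempty: "X \<in> completion V p \<Longrightarrow> \<exists>u. u \<in> X"
  using in_quotient_imp_non_empty[OF equiv_cauchy_rel] unfolding completion_def by blast

lemma completion_class:
  assumes "X \<in> completion V p" "u \<in> X"
  shows "u \<in> cauchy_seqs V p" "X = cauchy_rel V p `` {u}"
proof -
  show u: "u \<in> cauchy_seqs V p"
    using in_quotient_imp_subset[OF equiv_cauchy_rel] assms unfolding completion_def by blast
  obtain v where v: "v \<in> cauchy_seqs V p" "X = cauchy_rel V p `` {v}"
    using assms(1) unfolding completion_def by (rule quotientE)
  then show "X = cauchy_rel V p `` {u}"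
    using assms(2) equiv_class_eq[OF equiv_cauchy_rel, of v u] by simp
qed

lemma completion_mem_iff:
  assumes "X \<in> completion V p" "u \<in> X"
  shows "v \<in> X \<longleftrightarrow> (u, v) \<in> cauchy_rel V p"
  using completion_class(2)[OF assms] by blast

lemma p_convergent:
  assumes u: "u \<in> cauchy_seqs V p"
  shows "convergent (\<lambda>n. p (u n))"
proof (rule Cauchy_convergent, rule metric_CauchyI)
  fix e :: real assume "e > 0"
  then obtain N where N: "\<And>m n. m \<ge> N \<Longrightarrow> n \<ge> N \<Longrightarrow> p (\<lambda>x. u m x - u n x) < e"
    using cauchy_seqs_Cauchy[OF u] by blast
  have "dist (p (u m)) (p (u n)) < e" if "m \<ge> N" "n \<ge> N" for m n
    using p_reverse_triangle[OF cauchy_seqs_V[OF u] cauchy_seqs_V[OF u], of m n] N[OF that]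
    unfolding dist_real_def by linarith
  then show "\<exists>M. \<forall>m\<ge>M. \<forall>n\<ge>M. dist (p (u m)) (p (u n)) < e" by blast
qed

lemma compl_norm_lim:
  assumes X: "X \<in> completion V p" and u: "u \<in> X"
  shows "(\<lambda>n. p (u n)) \<longlonglongrightarrow> compl_norm p X"
proof -
  have uc: "u \<in> cauchy_seqs V p" by (rule completion_class(1)[OF X u])
  obtain r where r: "(\<lambda>n. p (u n)) \<longlonglongrightarrow> r" using p_convergent[OF uc] unfolding convergent_def by blast
  have all: "(\<lambda>n. p (v n)) \<longlonglongrightarrow> r" if v: "v \<in> X" for v
  proof -
    have uv: "(u, v) \<in> cauchy_rel V p" using completion_mem_iff[OF X u] v by simp
    then have vc: "v \<in> cauchy_seqs V p" by (simp add: cauchy_rel_iff)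
    have "(\<lambda>n. p (u n) - p (v n)) \<longlonglongrightarrow> 0"
    proof (rule Lim_null_comparison)
      show "(\<lambda>n. p (\<lambda>x. u n x - v n x)) \<longlonglongrightarrow> 0" using uv by (simp add: cauchy_rel_iff)
      show "\<forall>\<^sub>F n in sequentially. norm (p (u n) - p (v n)) \<le> p (\<lambda>x. u n x - v n x)"
        by (rule always_eventually) (simp add: p_reverse_triangle cauchy_seqs_V[OF uc] cauchy_seqs_V[OF vc])
    qed
    from tendsto_diff[OF r this] show ?thesis by simp
  qed
  have "compl_norm p X = r"
    unfolding compl_norm_def
  proof (rule the_equality)
    show "\<forall>u\<in>X. (\<lambda>n. p (u n)) \<longlonglongrightarrow> r" using all by blast
    show "r' = r" if "\<forall>u\<in>X. (\<lambda>n. p (u n)) \<longlonglongrightarrow> r'" for r'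
      using that u LIMSEQ_unique[OF _ r] by blast
  qed
  then show ?thesis using r by simp
qed

lemma compl_norm_nonneg: "X \<in> completion V p \<Longrightarrow> compl_norm p X \<ge> 0"
proof -
  assume X: "X \<in> completion V p"
  obtain u where u: "u \<in> X" using completion_nonempty[OF X] by blast
  show ?thesis
    by (rule LIMSEQ_le_const[OF compl_norm_lim[OF X u]])
      (use p_nonneg[OF cauchy_seqs_V[OF completion_class(1)[OF X u]]] in blast)
qed

lemma compl_of_mem:
  assumes "f \<in> V"
  shows "compl_of V p f \<in> completion V p" "(\<lambda>n. f) \<in> compl_of V p f"
  unfolding compl_of_def using class_of_in_completion self_in_class const_cauchy[OF assms] by blast+

lemma compl_add_eq:
  assumes X: "X \<in> completion V p" "u \<in> X" and Y: "Y \<in> completion V p" "v \<in> Y"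
  shows "compl_add V p X Y = cauchy_rel V p `` {\<lambda>n x. u n x + v n x}"
proof -
  note u = completion_class(1)[OF X] and v = completion_class(1)[OF Y]
  have "cauchy_rel V p `` {\<lambda>n x. u' n x + v' n x} = cauchy_rel V p `` {\<lambda>n x. u n x + v n x}"
    if u': "u' \<in> X" and v': "v' \<in> Y" for u' v'
  proof (rule equiv_class_eq[OF equiv_cauchy_rel])
    note uc = completion_class(1)[OF X(1) u'] and vc = completion_class(1)[OF Y(1) v']
    have l: "(\<lambda>n. p (\<lambda>x. u' n x - u n x)) \<longlonglongrightarrow> 0" "(\<lambda>n. p (\<lambda>x. v' n x - v n x)) \<longlonglongrightarrow> 0"
      using completion_mem_iff[OF X(1) u', of u] completion_mem_iff[OF Y(1) v', of v] X Y by (auto simp: cauchy_rel_iff)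
    have "(\<lambda>n. p (\<lambda>x. u' n x + v' n x - (u n x + v n x))) \<longlonglongrightarrow> 0"
    proof (rule tendsto_sandwich[OF _ _ tendsto_const])
      show "(\<lambda>n. p (\<lambda>x. u' n x - u n x) + p (\<lambda>x. v' n x - v n x)) \<longlonglongrightarrow> 0"
        using tendsto_add[OF l] by simp
      show "\<forall>\<^sub>F n in sequentially. 0 \<le> p (\<lambda>x. u' n x + v' n x - (u n x + v n x))"
        by (intro always_eventually allI p_nonneg V_diff V_add cauchy_seqs_V[OF u] cauchy_seqs_V[OF v] cauchy_seqs_V[OF uc] cauchy_seqs_V[OF vc])
      show "\<forall>\<^sub>F n in sequentially. p (\<lambda>x. u' n x + v' n x - (u n x + v n x)) \<le> p (\<lambda>x. u' n x - u n x) + p (\<lambda>x. v' n x - v n x)"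
      proof (intro always_eventually allI)
        fix n
        have "p (\<lambda>x. (u' n x - u n x) + (v' n x - v n x)) \<le> p (\<lambda>x. u' n x - u n x) + p (\<lambda>x. v' n x - v n x)"
          by (intro p_add V_diff cauchy_seqs_V[OF u] cauchy_seqs_V[OF v] cauchy_seqs_V[OF uc] cauchy_seqs_V[OF vc])
        then show "p (\<lambda>x. u' n x + v' n x - (u n x + v n x)) \<le> p (\<lambda>x. u' n x - u n x) + p (\<lambda>x. v' n x - v n x)"
          by (simp add: algebra_simps)
      qed
    qed
    then show "(\<lambda>n x. u' n x + v' n x, \<lambda>n x. u n x + v n x) \<in> cauchy_rel V p"
      by (simp add: cauchy_rel_iff cauchy_seqs_add u v uc vc)
  qed
  then show ?thesis unfolding compl_add_def using X(2) Y(2) by blast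
qed

lemma compl_scale_eq:
  assumes X: "X \<in> completion V p" "u \<in> X"
  shows "compl_scale V p c X = cauchy_rel V p `` {\<lambda>n x. c * u n x}"
proof -
  note u = completion_class(1)[OF X]
  have "cauchy_rel V p `` {\<lambda>n x. c * u' n x} = cauchy_rel V p `` {\<lambda>n x. c * u n x}"
    if u': "u' \<in> X" for u'
  proof (rule equiv_class_eq[OF equiv_cauchy_rel])
    note uc = completion_class(1)[OF X(1) u']
    have l: "(\<lambda>n. p (\<lambda>x. u' n x - u n x)) \<longlonglongrightarrow> 0"
      using completion_mem_iff[OF X(1) u', of u] X by (auto simp: cauchy_rel_iff)
    have "p (\<lambda>x. c * u' n x - c * u n x) = \<bar>c\<bar> * p (\<lambda>x. u' n x - u n x)" for n
      using p_scale[OF V_diff[OF cauchy_seqs_V[OF uc] cauchy_seqs_V[OF u]], of c n n] by (simp add: right_diff_distrib)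
    then have "(\<lambda>n. p (\<lambda>x. c * u' n x - c * u n x)) \<longlonglongrightarrow> 0"
      using tendsto_mult_left[OF l, of "\<bar>c\<bar>"] by simp
    then show "(\<lambda>n x. c * u' n x, \<lambda>n x. c * u n x) \<in> cauchy_rel V p"
      by (simp add: cauchy_rel_iff cauchy_seqs_scale u uc)
  qed
  then show ?thesis unfolding compl_scale_def using X(2) by blast
qed

end

lemma AE_LIMSEQ_subseq_of_Lp:
  fixes u :: "nat \<Rightarrow> 'a \<Rightarrow> real"
  assumes P: "P > 0" and i: "\<And>n. integrable M (\<lambda>x. \<bar>u n x - f x\<bar> powr P)"
    and lim: "(\<lambda>n. \<integral>x. \<bar>u n x - f x\<bar> powr P \<partial>M) \<longlonglongrightarrow> 0"
  shows "\<exists>s. strict_mono (s :: nat \<Rightarrow> nat) \<and> (AE x in M. (\<lambda>n. u (s n) x) \<longlonglongrightarrow> f x)"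
proof -
  have "(\<lambda>n. \<integral>x. norm (\<bar>u n x - f x\<bar> powr P) \<partial>M) \<longlonglongrightarrow> 0" using lim by simp
  from tendsto_L1_AE_subseq[OF i this]
  obtain s where s: "strict_mono (s :: nat \<Rightarrow> nat)" "AE x in M. (\<lambda>n. \<bar>u (s n) x - f x\<bar> powr P) \<longlonglongrightarrow> 0" by blast
  from s(2) have "AE x in M. (\<lambda>n. u (s n) x) \<longlonglongrightarrow> f x"
  proof eventually_elim
    case (elim x)
    have "(\<lambda>n. (\<bar>u (s n) x - f x\<bar> powr P) powr (1 / P)) \<longlonglongrightarrow> 0 powr (1 / P)"
      using P by (intro tendsto_powr' elim tendsto_const) auto
    then have "(\<lambda>n. \<bar>u (s n) x - f x\<bar>) \<longlonglongrightarrow> 0" using P by (simp add: powr_powr)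
    then have "(\<lambda>n. u (s n) x - f x) \<longlonglongrightarrow> 0" by (rule tendsto_rabs_zero_cancel)
    then show ?case by (rule LIM_zero_cancel)
  qed
  then show ?thesis using s(1) by blast
qed

text \<open>The assumption \<open>closable\<close> is what makes the extension of the inclusion to the completion
  injective.\<close>

locale closable_embedding = seminormed_function_space V p + finite_measure M
  for V :: "('a \<Rightarrow> real) set" and p and M :: "'a measure" +
  fixes P C :: real
  assumes P1: "P \<ge> 1" and C0: "C \<ge> 0"
    and V_measurable: "f \<in> V \<Longrightarrow> f \<in> borel_measurable M"
    and V_integrable: "f \<in> V \<Longrightarrow> integrable M (\<lambda>x. \<bar>f x\<bar> powr P)"
    and V_bound: "f \<in> V \<Longrightarrow> (\<integral>x. \<bar>f x\<bar> powr P \<partial>M) \<le> (C * p f) powr P"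
    and closable: "u \<in> cauchy_seqs V p \<Longrightarrow> (\<lambda>n. \<integral>x. \<bar>u n x\<bar> powr P \<partial>M) \<longlonglongrightarrow> 0 \<Longrightarrow> (\<lambda>n. p (u n)) \<longlonglongrightarrow> 0"
begin

definition Lp_limit :: "(nat \<Rightarrow> 'a \<Rightarrow> real) \<Rightarrow> ('a \<Rightarrow> real) \<Rightarrow> bool" where
  "Lp_limit u f \<longleftrightarrow> f \<in> borel_measurable M \<and> (\<forall>n. u n \<in> borel_measurable M) \<and>
     (\<forall>n. integrable M (\<lambda>x. \<bar>u n x - f x\<bar> powr P)) \<and> (\<lambda>n. \<integral>x. \<bar>u n x - f x\<bar> powr P \<partial>M) \<longlonglongrightarrow> 0"

lemma Ppos: "P > 0" using P1 by simp

lemma Lp_limit_add: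
  assumes u: "Lp_limit u f" and v: "Lp_limit v g"
  shows "Lp_limit (\<lambda>n x. u n x + v n x) (\<lambda>x. f x + g x)"
proof -
  have m: "f \<in> borel_measurable M" "g \<in> borel_measurable M" "u n \<in> borel_measurable M" "v n \<in> borel_measurable M" for n
    using u v by (auto simp: Lp_limit_def)
  have i: "integrable M (\<lambda>x. \<bar>u n x - f x\<bar> powr P)" "integrable M (\<lambda>x. \<bar>v n x - g x\<bar> powr P)" for n
    using u v by (auto simp: Lp_limit_def)
  have mm: "(\<lambda>x. u n x - f x) \<in> borel_measurable M" "(\<lambda>x. v n x - g x) \<in> borel_measurable M" for n
    by (intro borel_measurable_diff m)+
  have e: "\<bar>u n x + v n x - (f x + g x)\<bar> = \<bar>(u n x - f x) + (v n x - g x)\<bar>" for n x by simp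
  note T = integrable_abs_add_powr[OF Ppos mm i]
  have "(\<lambda>n. \<integral>x. \<bar>u n x + v n x - (f x + g x)\<bar> powr P \<partial>M) \<longlonglongrightarrow> 0"
  proof (rule tendsto_sandwich[OF _ _ tendsto_const])
    have "(\<lambda>n. 2 powr P * ((\<integral>x. \<bar>u n x - f x\<bar> powr P \<partial>M) + (\<integral>x. \<bar>v n x - g x\<bar> powr P \<partial>M))) \<longlonglongrightarrow> 2 powr P * (0 + 0)"
      using u v by (intro tendsto_intros) (auto simp: Lp_limit_def)
    then show "(\<lambda>n. 2 powr P * ((\<integral>x. \<bar>u n x - f x\<bar> powr P \<partial>M) + (\<integral>x. \<bar>v n x - g x\<bar> powr P \<partial>M))) \<longlonglongrightarrow> 0" by simp
    show "\<forall>\<^sub>F n in sequentially. (\<integral>x. \<bar>u n x + v n x - (f x + g x)\<bar> powr P \<partial>M)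
        \<le> 2 powr P * ((\<integral>x. \<bar>u n x - f x\<bar> powr P \<partial>M) + (\<integral>x. \<bar>v n x - g x\<bar> powr P \<partial>M))"
      unfolding e by (intro always_eventually allI T(2))
  qed simp
  moreover have "integrable M (\<lambda>x. \<bar>u n x + v n x - (f x + g x)\<bar> powr P)" for n unfolding e by (rule T(1))
  ultimately show ?thesis unfolding Lp_limit_def using m by simp
qed

lemma Lp_limit_scale:
  assumes u: "Lp_limit u f"
  shows "Lp_limit (\<lambda>n x. c * u n x) (\<lambda>x. c * f x)"
proof -
  have e: "\<bar>c * u n x - c * f x\<bar> powr P = \<bar>c\<bar> powr P * \<bar>u n x - f x\<bar> powr P" for n x
    by (simp add: abs_mult powr_mult flip: right_diff_distrib)
  have "(\<lambda>n. \<bar>c\<bar> powr P * (\<integral>x. \<bar>u n x - f x\<bar> powr P \<partial>M)) \<longlonglongrightarrow> \<bar>c\<bar> powr P * 0"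
    using u by (intro tendsto_intros) (auto simp: Lp_limit_def)
  moreover have "(\<lambda>x. c * f x) \<in> borel_measurable M" "(\<lambda>x. c * u n x) \<in> borel_measurable M" for n
    using u by (auto simp: Lp_limit_def intro!: borel_measurable_times)
  ultimately show ?thesis using u unfolding Lp_limit_def e by simp
qed

lemma Lp_limit_cong:
  assumes u: "Lp_limit u f" and uv: "(u, v) \<in> cauchy_rel V p"
  shows "Lp_limit v f"
proof -
  have uv': "u \<in> cauchy_seqs V p" "v \<in> cauchy_seqs V p" "(\<lambda>n. p (\<lambda>x. u n x - v n x)) \<longlonglongrightarrow> 0"
    using uv by (auto simp: cauchy_rel_iff)
  have d: "(\<lambda>x. v n x - u n x) \<in> V" for n by (intro V_diff cauchy_seqs_V uv')
  have "Lp_limit (\<lambda>n x. v n x - u n x) (\<lambda>x. 0)"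
    unfolding Lp_limit_def
  proof (intro conjI allI)
    have "(\<lambda>n. p (\<lambda>x. v n x - u n x)) \<longlonglongrightarrow> 0"
      using uv'(3) p_diff_commute[OF cauchy_seqs_V[OF uv'(1)] cauchy_seqs_V[OF uv'(2)]] by simp
    then have l: "(\<lambda>n. C * p (\<lambda>x. v n x - u n x)) \<longlonglongrightarrow> C * 0" by (intro tendsto_intros)
    have "(\<lambda>n. (C * p (\<lambda>x. v n x - u n x)) powr P) \<longlonglongrightarrow> (C * 0) powr P"
      using Ppos C0 p_nonneg[OF d] by (intro tendsto_powr' l tendsto_const) auto
    then have l2: "(\<lambda>n. (C * p (\<lambda>x. v n x - u n x)) powr P) \<longlonglongrightarrow> 0" by simp
    show "(\<lambda>n. \<integral>x. \<bar>v n x - u n x - 0\<bar> powr P \<partial>M) \<longlonglongrightarrow> 0"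
      by (rule tendsto_sandwich[OF _ _ tendsto_const l2]) (use V_bound[OF d] in \<open>auto intro!: always_eventually\<close>)
    show "integrable M (\<lambda>x. \<bar>v n x - u n x - 0\<bar> powr P)" for n using V_integrable[OF d] by simp
    show "(\<lambda>x. v n x - u n x) \<in> borel_measurable M" for n by (rule V_measurable[OF d])
  qed simp
  from Lp_limit_add[OF u this] show ?thesis by simp
qed

lemma Lp_limit_zero_imp_AE:
  assumes z: "Lp_limit (\<lambda>n x. 0) f"
  shows "AE x in M. f x = 0"
proof -
  have i: "integrable M (\<lambda>x. \<bar>f x\<bar> powr P)" and l: "(\<lambda>n::nat. \<integral>x. \<bar>f x\<bar> powr P \<partial>M) \<longlonglongrightarrow> 0"
    using z by (auto simp: Lp_limit_def)
  have "(\<integral>x. \<bar>f x\<bar> powr P \<partial>M) = 0" using l by (simp add: LIMSEQ_const_iff)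
  then have "AE x in M. \<bar>f x\<bar> powr P = 0"
    using integral_nonneg_eq_0_iff_AE[OF i] by simp
  then show ?thesis by eventually_elim simp
qed

lemma Lp_limit_unique:
  assumes "Lp_limit u f" "Lp_limit u g"
  shows "AE x in M. f x = g x"
proof -
  have "Lp_limit (\<lambda>n x. 0) (\<lambda>x. f x - g x)"
    using Lp_limit_add[OF assms(1) Lp_limit_scale[OF assms(2), of "-1"]] by simp
  then have "AE x in M. f x - g x = 0" by (rule Lp_limit_zero_imp_AE)
  then show ?thesis by eventually_elim simp
qed

lemma Lp_limit_exists:
  assumes u: "u \<in> cauchy_seqs V p"
  shows "\<exists>f. Lp_limit u f"
proof -
  note uV = cauchy_seqs_V[OF u]
  have "\<exists>f\<in>borel_measurable M. (\<forall>n. integrable M (\<lambda>x. \<bar>u n x - f x\<bar> powr P)) \<and>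
    (\<lambda>n. \<integral>x. \<bar>u n x - f x\<bar> powr P \<partial>M) \<longlonglongrightarrow> 0 \<and>
    (\<exists>s. strict_mono s \<and> (AE x in M. (\<lambda>n. u (s n) x) \<longlonglongrightarrow> f x))"
  proof (rule Lp_Cauchy_convergent[OF Ppos])
    show "u n \<in> borel_measurable M" for n by (rule V_measurable[OF uV])
    show "integrable M (\<lambda>x. \<bar>u n x - u k x\<bar> powr P)" for n k by (rule V_integrable[OF V_diff[OF uV uV]])
    fix e :: real assume e: "e > 0"
    define d where "d = e powr (1 / P) / (C + 1)"
    have d: "d > 0" using e C0 by (simp add: d_def)
    obtain N where N: "\<And>m n. m \<ge> N \<Longrightarrow> n \<ge> N \<Longrightarrow> p (\<lambda>x. u m x - u n x) < d"
      using cauchy_seqs_Cauchy[OF u d] by blast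
    have "(\<integral>x. \<bar>u m x - u n x\<bar> powr P \<partial>M) < e" if "m \<ge> N" "n \<ge> N" for m n
    proof -
      have p0: "p (\<lambda>x. u m x - u n x) \<ge> 0" by (rule p_nonneg[OF V_diff[OF uV uV]])
      have "C * p (\<lambda>x. u m x - u n x) \<le> (C + 1) * p (\<lambda>x. u m x - u n x)"
        using p0 by (intro mult_right_mono) auto
      also have "\<dots> < (C + 1) * d" using N[OF that] C0 by (intro mult_strict_left_mono) auto
      also have "\<dots> = e powr (1 / P)" using C0 by (simp add: d_def)
      finally have lt: "C * p (\<lambda>x. u m x - u n x) < e powr (1 / P)" .
      have "(\<integral>x. \<bar>u m x - u n x\<bar> powr P \<partial>M) \<le> (C * p (\<lambda>x. u m x - u n x)) powr P"
        by (rule V_bound[OF V_diff[OF uV uV]])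
      also have "\<dots> < (e powr (1 / P)) powr P"
        using lt Ppos C0 p0 by (intro powr_less_mono2) auto
      also have "\<dots> = e" using e Ppos by (simp add: powr_powr)
      finally show ?thesis .
    qed
    then show "\<exists>N. \<forall>n\<ge>N. \<forall>k\<ge>N. (\<integral>x. \<bar>u n x - u k x\<bar> powr P \<partial>M) < e" by blast
  qed
  then show ?thesis unfolding Lp_limit_def using V_measurable[OF uV] by blast
qed

text \<open>The limit is the same for all Cauchy sequences in the class, by \<open>Lp_limit_cong\<close>.\<close>

definition embed :: "(nat \<Rightarrow> 'a \<Rightarrow> real) set \<Rightarrow> 'a \<Rightarrow> real" where
  "embed X = (SOME f. \<forall>u\<in>X. Lp_limit u f)"

lemma embed_limit:
  assumes X: "X \<in> completion V p" and u: "u \<in> X"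
  shows "Lp_limit u (embed X)"
proof -
  obtain f where f: "Lp_limit u f" using Lp_limit_exists[OF completion_class(1)[OF X u]] by blast
  have "\<forall>v\<in>X. Lp_limit v f" using Lp_limit_cong[OF f] completion_mem_iff[OF X u] by blast
  then have "\<forall>v\<in>X. Lp_limit v (embed X)" unfolding embed_def by (rule someI[of "\<lambda>f. \<forall>u\<in>X. Lp_limit u f"])
  then show ?thesis using u by blast
qed

lemma embed_measurable: "X \<in> completion V p \<Longrightarrow> embed X \<in> borel_measurable M"
  using embed_limit completion_nonempty unfolding Lp_limit_def by blast

lemma embed_bound:
  assumes X: "X \<in> completion V p"
  shows "integrable M (\<lambda>x. \<bar>embed X x\<bar> powr P)" "(\<integral>x. \<bar>embed X x\<bar> powr P \<partial>M) \<le> (C * compl_norm p X) powr P"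
proof -
  obtain u where u: "u \<in> X" using completion_nonempty[OF X] by blast
  note uc = completion_class(1)[OF X u]
  note uV = cauchy_seqs_V[OF uc]
  have L: "\<And>n. integrable M (\<lambda>x. \<bar>u n x - embed X x\<bar> powr P)" "(\<lambda>n. \<integral>x. \<bar>u n x - embed X x\<bar> powr P \<partial>M) \<longlonglongrightarrow> 0"
    using embed_limit[OF X u] by (auto simp: Lp_limit_def)
  obtain s where s: "strict_mono (s :: nat \<Rightarrow> nat)" "AE x in M. (\<lambda>n. u (s n) x) \<longlonglongrightarrow> embed X x"
    using AE_LIMSEQ_subseq_of_Lp[OF Ppos L] by blast
  have l: "(\<lambda>n. C * p (u (s n))) \<longlonglongrightarrow> C * compl_norm p X"
    using LIMSEQ_subseq_LIMSEQ[OF compl_norm_lim[OF X u] s(1)] by (intro tendsto_intros) (simp add: o_def)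
  have l2: "(\<lambda>n. (C * p (u (s n))) powr P) \<longlonglongrightarrow> (C * compl_norm p X) powr P"
    using Ppos C0 p_nonneg[OF uV] by (intro tendsto_powr' l tendsto_const) auto
  note B = Lp_limit_of_bounded[OF Ppos V_measurable[OF uV] embed_measurable[OF X] s(2) V_integrable[OF uV] V_bound[OF uV] l2]
  show "integrable M (\<lambda>x. \<bar>embed X x\<bar> powr P)" "(\<integral>x. \<bar>embed X x\<bar> powr P \<partial>M) \<le> (C * compl_norm p X) powr P"
    by (fact B)+
qed

lemma embed_compl_of:
  assumes f: "f \<in> V"
  shows "AE x in M. embed (compl_of V p f) x = f x"
proof (rule Lp_limit_unique)
  show "Lp_limit (\<lambda>n. f) (embed (compl_of V p f))" by (rule embed_limit[OF compl_of_mem[OF f]])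
  show "Lp_limit (\<lambda>n. f) f" unfolding Lp_limit_def using V_measurable[OF f] by simp
qed

lemma embed_add:
  assumes X: "X \<in> completion V p" and Y: "Y \<in> completion V p"
  shows "AE x in M. embed (compl_add V p X Y) x = embed X x + embed Y x"
proof -
  obtain u where u: "u \<in> X" using completion_nonempty[OF X] by blast
  obtain v where v: "v \<in> Y" using completion_nonempty[OF Y] by blast
  have c: "(\<lambda>n x. u n x + v n x) \<in> cauchy_seqs V p"
    by (intro cauchy_seqs_add completion_class(1)[OF X u] completion_class(1)[OF Y v])
  have "Lp_limit (\<lambda>n x. u n x + v n x) (embed (compl_add V p X Y))"
    unfolding compl_add_eq[OF X u Y v] by (intro embed_limit class_of_in_completion self_in_class c)
  then show ?thesis by (rule Lp_limit_unique) (intro Lp_limit_add embed_limit X Y u v)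
qed

lemma embed_scale:
  assumes X: "X \<in> completion V p"
  shows "AE x in M. embed (compl_scale V p c X) x = c * embed X x"
proof -
  obtain u where u: "u \<in> X" using completion_nonempty[OF X] by blast
  have c: "(\<lambda>n x. c * u n x) \<in> cauchy_seqs V p"
    by (intro cauchy_seqs_scale completion_class(1)[OF X u])
  have "Lp_limit (\<lambda>n x. c * u n x) (embed (compl_scale V p c X))"
    unfolding compl_scale_eq[OF X u] by (intro embed_limit class_of_in_completion self_in_class c)
  then show ?thesis by (rule Lp_limit_unique) (intro Lp_limit_scale embed_limit X u)
qed

lemma embed_inj:
  assumes X: "X \<in> completion V p" and Y: "Y \<in> completion V p" and eq: "AE x in M. embed X x = embed Y x"
  shows "X = Y"
proof -
  obtain u where u: "u \<in> X" using completion_nonempty[OF X] by blast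
  obtain v where v: "v \<in> Y" using completion_nonempty[OF Y] by blast
  note uc = completion_class(1)[OF X u] and vc = completion_class(1)[OF Y v]
  have dc: "(\<lambda>n x. u n x - v n x) \<in> cauchy_seqs V p" by (rule cauchy_seqs_diff[OF uc vc])
  have L: "Lp_limit (\<lambda>n x. u n x - v n x) (\<lambda>x. embed X x - embed Y x)"
    using Lp_limit_add[OF embed_limit[OF X u] Lp_limit_scale[OF embed_limit[OF Y v], of "-1"]] by simp
  have "(\<integral>x. \<bar>u n x - v n x - (embed X x - embed Y x)\<bar> powr P \<partial>M) = (\<integral>x. \<bar>u n x - v n x\<bar> powr P \<partial>M)" for n
  proof (rule integral_cong_AE)
    show "AE x in M. \<bar>u n x - v n x - (embed X x - embed Y x)\<bar> powr P = \<bar>u n x - v n x\<bar> powr P"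
      using eq by eventually_elim simp
    have [measurable]: "u n \<in> borel_measurable M" "v n \<in> borel_measurable M" "embed X \<in> borel_measurable M" "embed Y \<in> borel_measurable M"
      by (intro V_measurable cauchy_seqs_V uc vc embed_measurable X Y)+
    show "(\<lambda>x. \<bar>u n x - v n x - (embed X x - embed Y x)\<bar> powr P) \<in> borel_measurable M" by measurable
    show "(\<lambda>x. \<bar>u n x - v n x\<bar> powr P) \<in> borel_measurable M" by measurable
  qed
  then have "(\<lambda>n. \<integral>x. \<bar>u n x - v n x\<bar> powr P \<partial>M) \<longlonglongrightarrow> 0" using L by (simp add: Lp_limit_def)
  from closable[OF dc this] have "(u, v) \<in> cauchy_rel V p" using uc vc by (simp add: cauchy_rel_iff)
  then show ?thesis
    using completion_class(2)[OF X u] completion_class(2)[OF Y v] equiv_class_eq[OF equiv_cauchy_rel] by simp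
qed

lemma embed_lower_exponent:
  assumes X: "X \<in> completion V p" and q: "1 \<le> q" "q \<le> P"
  shows "integrable M (\<lambda>x. \<bar>embed X x\<bar> powr q)"
    "(\<integral>x. \<bar>embed X x\<bar> powr q \<partial>M) powr (1 / q) \<le> (measure M (space M) + 1) powr (1 / q) * C * compl_norm p X"
proof -
  have q0: "q > 0" using q by simp
  show "integrable M (\<lambda>x. \<bar>embed X x\<bar> powr q)"
    by (rule integrable_lower_exponent(1)[OF q0 q(2) embed_measurable[OF X] embed_bound(1)[OF X]])
  define k where "k = (measure M (space M) + 1) powr (1 / q)"
  have "measure M (space M) + 1 > 0" using measure_nonneg[of M "space M"] by linarith
  then have k: "k > 0" unfolding k_def by simp
  have "(\<integral>x. \<bar>embed X x\<bar> powr q \<partial>M) powr (1 / q) \<le> k * C * compl_norm p X + e" if e: "e > 0" for e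
  proof -
    \<comment> \<open>The slack \<open>e / k\<close> keeps \<open>t\<close> positive when the norm vanishes.\<close>
    define t where "t = C * compl_norm p X + e / k"
    have t: "t > 0" "C * compl_norm p X \<le> t" using C0 compl_norm_nonneg[OF X] e k by (auto simp: t_def add_nonneg_pos)
    have "(\<integral>x. \<bar>embed X x\<bar> powr P \<partial>M) \<le> t powr P"
      using C0 compl_norm_nonneg[OF X] t Ppos by (intro order_trans[OF embed_bound(2)[OF X]] powr_mono2) auto
    then have "(\<integral>x. \<bar>embed X x\<bar> powr q \<partial>M) \<le> t powr q * (measure M (space M) + 1)"
      by (rule integrable_lower_exponent(2)[OF q0 q(2) embed_measurable[OF X] embed_bound(1)[OF X] t(1)])
    then have "(\<integral>x. \<bar>embed X x\<bar> powr q \<partial>M) powr (1 / q) \<le> (t powr q * (measure M (space M) + 1)) powr (1 / q)"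
      using q0 by (intro powr_mono2) auto
    also have "\<dots> = t * k" using t q0 by (simp add: powr_mult powr_powr k_def)
    also have "\<dots> = k * C * compl_norm p X + e" using k by (simp add: t_def algebra_simps)
    finally show ?thesis .
  qed
  then show "(\<integral>x. \<bar>embed X x\<bar> powr q \<partial>M) powr (1 / q) \<le> (measure M (space M) + 1) powr (1 / q) * C * compl_norm p X"
    unfolding k_def[symmetric] by (rule field_le_epsilon)
qed

text \<open>Each class is replaced by an element of \<open>V\<close> that is close to it in \<open>L^P\<close>, so that compactness has to
  be known for sequences in \<open>V\<close> only.\<close>

lemma embed_compact:
  assumes compactness: "\<And>\<phi> B. (\<And>n. \<phi> n \<in> V) \<Longrightarrow> (\<And>n. p (\<phi> n) \<le> B) \<Longrightarrow>
      \<exists>s f. strict_mono (s :: nat \<Rightarrow> nat) \<and> f \<in> borel_measurable M \<and> (AE x in M. (\<lambda>n. \<phi> (s n) x) \<longlonglongrightarrow> f x)"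
    and q: "1 \<le> q" "q < P"
    and X: "\<And>n. X n \<in> completion V p" "\<And>n. compl_norm p (X n) \<le> B"
  shows "\<exists>s f. strict_mono (s :: nat \<Rightarrow> nat) \<and> f \<in> borel_measurable M \<and> integrable M (\<lambda>x. \<bar>f x\<bar> powr q) \<and>
      (\<lambda>n. \<integral>x. \<bar>embed (X (s n)) x - f x\<bar> powr q \<partial>M) \<longlonglongrightarrow> 0"
proof -
  have q0: "q > 0" using q by simp
  define Q where "Q n \<phi> \<longleftrightarrow> \<phi> \<in> V \<and> p \<phi> \<le> B + 1 \<and> integrable M (\<lambda>x. \<bar>\<phi> x - embed (X n) x\<bar> powr P) \<and>
      (\<integral>x. \<bar>\<phi> x - embed (X n) x\<bar> powr P \<partial>M) \<le> (1 / real (Suc n)) powr P" for n \<phi>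
  have ex: "\<exists>\<phi>. Q n \<phi>" for n
  proof -
    obtain u where u: "u \<in> X n" using completion_nonempty[OF X(1)] by blast
    have L: "\<And>k. integrable M (\<lambda>x. \<bar>u k x - embed (X n) x\<bar> powr P)" "(\<lambda>k. \<integral>x. \<bar>u k x - embed (X n) x\<bar> powr P \<partial>M) \<longlonglongrightarrow> 0"
      using embed_limit[OF X(1) u] by (auto simp: Lp_limit_def)
    have "\<forall>\<^sub>F k in sequentially. p (u k) < B + 1"
      by (rule order_tendstoD(2)[OF compl_norm_lim[OF X(1) u]]) (use X(2)[of n] in simp)
    moreover have "\<forall>\<^sub>F k in sequentially. (\<integral>x. \<bar>u k x - embed (X n) x\<bar> powr P \<partial>M) < (1 / real (Suc n)) powr P"
      by (rule order_tendstoD(2)[OF L(2)]) simp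
    ultimately have "\<forall>\<^sub>F k in sequentially. p (u k) < B + 1 \<and> (\<integral>x. \<bar>u k x - embed (X n) x\<bar> powr P \<partial>M) < (1 / real (Suc n)) powr P"
      by eventually_elim simp
    then obtain k where "p (u k) < B + 1" "(\<integral>x. \<bar>u k x - embed (X n) x\<bar> powr P \<partial>M) < (1 / real (Suc n)) powr P"
      unfolding eventually_sequentially by blast
    then show ?thesis
      using L(1)[of k] cauchy_seqs_V[OF completion_class(1)[OF X(1) u], of k] by (intro exI[of _ "u k"]) (auto simp: Q_def)
  qed
  obtain \<phi> where "\<And>n. Q n (\<phi> n)" using choice[of Q] ex by blast
  then have \<phi>: "\<And>n. \<phi> n \<in> V" "\<And>n. p (\<phi> n) \<le> B + 1"
      "\<And>n. integrable M (\<lambda>x. \<bar>\<phi> n x - embed (X n) x\<bar> powr P)"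
      "\<And>n. (\<integral>x. \<bar>\<phi> n x - embed (X n) x\<bar> powr P \<partial>M) \<le> (1 / real (Suc n)) powr P"
    unfolding Q_def by blast+
  obtain s f where s: "strict_mono (s :: nat \<Rightarrow> nat)" and mf: "f \<in> borel_measurable M"
      and lim: "AE x in M. (\<lambda>n. \<phi> (s n) x) \<longlonglongrightarrow> f x"
    using compactness[of \<phi> "B + 1", OF \<phi>(1,2)] by blast
  note m\<phi> = V_measurable[OF \<phi>(1)] and mX = embed_measurable[OF X(1)]
  have b: "(\<integral>x. \<bar>\<phi> (s n) x\<bar> powr P \<partial>M) \<le> (C * (B + 1)) powr P" for n
    using C0 Ppos p_nonneg[OF \<phi>(1)] \<phi>(2)
    by (intro order_trans[OF V_bound[OF \<phi>(1)]] powr_mono2 mult_left_mono mult_nonneg_nonneg) auto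
  have l1: "(\<lambda>n. \<integral>x. \<bar>\<phi> (s n) x - f x\<bar> powr q \<partial>M) \<longlonglongrightarrow> 0"
    by (rule Lq_convergence_of_AE_bounded[OF q0 q(2) m\<phi> mf lim V_integrable[OF \<phi>(1)] b])
  have fP: "integrable M (\<lambda>x. \<bar>f x\<bar> powr P)"
    by (rule Lp_limit_of_bounded(1)[OF Ppos m\<phi> mf lim V_integrable[OF \<phi>(1)] b tendsto_const])
  have fq: "integrable M (\<lambda>x. \<bar>f x\<bar> powr q)"
    by (rule integrable_lower_exponent(1)[OF q0 _ mf fP]) (use q in simp)
  have md: "(\<lambda>x. embed (X n) x - \<phi> n x) \<in> borel_measurable M" for n by (intro borel_measurable_diff m\<phi> mX)
  have md2: "(\<lambda>x. \<phi> (s n) x - f x) \<in> borel_measurable M" for n by (intro borel_measurable_diff m\<phi> mf)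
  have iP: "integrable M (\<lambda>x. \<bar>embed (X n) x - \<phi> n x\<bar> powr P)" for n using \<phi>(3)[of n] by (simp add: abs_minus_commute)
  have iq: "integrable M (\<lambda>x. \<bar>embed (X n) x - \<phi> n x\<bar> powr q)" for n
    by (rule integrable_lower_exponent(1)[OF q0 _ md iP]) (use q in simp)
  have le: "(\<integral>x. \<bar>embed (X n) x - \<phi> n x\<bar> powr q \<partial>M) \<le> (1 / real (Suc n)) powr q * (measure M (space M) + 1)" for n
    by (rule integrable_lower_exponent(2)[OF q0 _ md iP]) (use q \<phi>(4)[of n] in \<open>simp_all add: abs_minus_commute\<close>)
  have "(\<lambda>n. (1 / real (Suc n)) powr q * (measure M (space M) + 1)) \<longlonglongrightarrow> 0 powr q * (measure M (space M) + 1)"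
    using q0 by (intro tendsto_mult tendsto_powr' tendsto_const LIMSEQ_Suc[OF lim_inverse_n']) auto
  then have l2: "(\<lambda>n. (1 / real (Suc n)) powr q * (measure M (space M) + 1)) \<longlonglongrightarrow> 0" by simp
  have l3: "(\<lambda>n. \<integral>x. \<bar>embed (X n) x - \<phi> n x\<bar> powr q \<partial>M) \<longlonglongrightarrow> 0"
  proof (rule tendsto_sandwich[OF _ _ tendsto_const l2])
    show "\<forall>\<^sub>F n in sequentially. (\<integral>x. \<bar>embed (X n) x - \<phi> n x\<bar> powr q \<partial>M) \<le> (1 / real (Suc n)) powr q * (measure M (space M) + 1)"
      by (intro always_eventually allI le)
  qed simp
  have l4: "(\<lambda>n. \<integral>x. \<bar>embed (X (s n)) x - \<phi> (s n) x\<bar> powr q \<partial>M) \<longlonglongrightarrow> 0"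
    using LIMSEQ_subseq_LIMSEQ[OF l3 s] by (simp add: o_def)
  have i2: "integrable M (\<lambda>x. \<bar>\<phi> (s n) x - f x\<bar> powr q)" for n
  proof (rule integrable_lower_exponent(1)[OF q0 _ md2])
    have "integrable M (\<lambda>x. \<bar>- f x\<bar> powr P)" using fP by simp
    from integrable_abs_add_powr(1)[OF Ppos m\<phi>[of "s n"] _ V_integrable[OF \<phi>(1)] this] mf
    show "integrable M (\<lambda>x. \<bar>\<phi> (s n) x - f x\<bar> powr P)" by simp
  qed (use q in simp)
  have "(\<lambda>n. \<integral>x. \<bar>embed (X (s n)) x - f x\<bar> powr q \<partial>M) \<longlonglongrightarrow> 0"
  proof (rule tendsto_sandwich[OF _ _ tendsto_const])
    have "(\<lambda>n. 2 powr q * ((\<integral>x. \<bar>embed (X (s n)) x - \<phi> (s n) x\<bar> powr q \<partial>M) + (\<integral>x. \<bar>\<phi> (s n) x - f x\<bar> powr q \<partial>M))) \<longlonglongrightarrow> 2 powr q * (0 + 0)"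
      by (intro tendsto_intros l1 l4)
    then show "(\<lambda>n. 2 powr q * ((\<integral>x. \<bar>embed (X (s n)) x - \<phi> (s n) x\<bar> powr q \<partial>M) + (\<integral>x. \<bar>\<phi> (s n) x - f x\<bar> powr q \<partial>M))) \<longlonglongrightarrow> 0" by simp
    show "\<forall>\<^sub>F n in sequentially. (\<integral>x. \<bar>embed (X (s n)) x - f x\<bar> powr q \<partial>M)
        \<le> 2 powr q * ((\<integral>x. \<bar>embed (X (s n)) x - \<phi> (s n) x\<bar> powr q \<partial>M) + (\<integral>x. \<bar>\<phi> (s n) x - f x\<bar> powr q \<partial>M))"
    proof (intro always_eventually allI)
      fix n
      show "(\<integral>x. \<bar>embed (X (s n)) x - f x\<bar> powr q \<partial>M)
        \<le> 2 powr q * ((\<integral>x. \<bar>embed (X (s n)) x - \<phi> (s n) x\<bar> powr q \<partial>M) + (\<integral>x. \<bar>\<phi> (s n) x - f x\<bar> powr q \<partial>M))"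
        using integrable_abs_add_powr(2)[OF q0 md md2 iq i2, of "s n" n] by simp
    qed
  qed simp
  then show ?thesis using s mf fq by blast
qed

end

section \<open>Test functions and the weighted energy\<close>

lemma has_derivative_frechet:
  assumes "f differentiable_on UNIV"
  shows "(f has_derivative frechet_derivative f (at x)) (at x)"
  using assms by (simp add: differentiable_on_def frechet_derivative_works[symmetric])

lemma C_k_continuous: "C_k k f \<Longrightarrow> continuous_on UNIV f"
  by (cases k) (auto intro: differentiable_imp_continuous_on)

lemma partial_deriv_add:
  assumes "f differentiable_on UNIV" "g differentiable_on UNIV"
  shows "partial_deriv b (\<lambda>x. f x + g x) = (\<lambda>x. partial_deriv b f x + partial_deriv b g x)"
proof
  fix x
  have "((\<lambda>x. f x + g x) has_derivative (\<lambda>h. frechet_derivative f (at x) h + frechet_derivative g (at x) h)) (at x)"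
    by (intro has_derivative_add has_derivative_frechet assms)
  then have "(\<lambda>h. frechet_derivative f (at x) h + frechet_derivative g (at x) h) = frechet_derivative (\<lambda>x. f x + g x) (at x)"
    by (rule frechet_derivative_at)
  from fun_cong[OF this, of b]
  show "partial_deriv b (\<lambda>x. f x + g x) x = partial_deriv b f x + partial_deriv b g x"
    by (simp add: partial_deriv_def)
qed

lemma partial_deriv_scale:
  assumes "f differentiable_on UNIV"
  shows "partial_deriv b (\<lambda>x. c * f x) = (\<lambda>x. c * partial_deriv b f x)"
proof
  fix x
  have "((\<lambda>x. c * f x) has_derivative (\<lambda>h. c * frechet_derivative f (at x) h)) (at x)"
    by (intro has_derivative_mult_right has_derivative_frechet assms)
  then have "(\<lambda>h. c * frechet_derivative f (at x) h) = frechet_derivative (\<lambda>x. c * f x) (at x)"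
    by (rule frechet_derivative_at)
  from fun_cong[OF this, of b]
  show "partial_deriv b (\<lambda>x. c * f x) x = c * partial_deriv b f x"
    by (simp add: partial_deriv_def)
qed

lemma C_k_add: "C_k k f \<Longrightarrow> C_k k g \<Longrightarrow> C_k k (\<lambda>x. f x + g x)"
proof (induction k arbitrary: f g)
  case 0
  then show ?case by (simp add: continuous_on_add)
next
  case (Suc k)
  then show ?case by (simp add: partial_deriv_add differentiable_on_add)
qed

lemma C_k_scale: "C_k k f \<Longrightarrow> C_k k (\<lambda>x. c * f x)"
proof (induction k arbitrary: f)
  case 0
  then show ?case by (simp add: continuous_on_mult_left)
next
  case (Suc k)
  then have d: "f differentiable_on UNIV" by simp
  have "(\<lambda>x. c * f x) differentiable_on UNIV"
    unfolding differentiable_on_def differentiable_def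
    using has_derivative_mult_right[OF has_derivative_frechet[OF d], of c] by blast
  with Suc show ?case by (simp add: partial_deriv_scale)
qed

lemma C_k_sum:
  assumes "finite I" "I \<noteq> {}" "\<And>i. i \<in> I \<Longrightarrow> C_k k (f i)"
  shows "C_k k (\<lambda>x. \<Sum>i\<in>I. f i x)"
  using assms
proof (induction I rule: finite_ne_induct)
  case (insert i I)
  then show ?case using C_k_add[of k "f i" "\<lambda>x. \<Sum>i\<in>I. f i x"] by simp
qed simp

lemma C_k_laplacian:
  assumes "C_k (Suc (Suc k)) f"
  shows "C_k k (laplacian f)"
proof -
  have "C_k k (\<lambda>x. \<Sum>b\<in>Basis. partial_deriv b (partial_deriv b f) x)"
    by (rule C_k_sum) (use assms in auto)
  then show ?thesis by (simp add: laplacian_def[abs_def])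
qed

lemma laplacian_add:
  assumes f: "C_k 2 f" and g: "C_k 2 g"
  shows "laplacian (\<lambda>x. f x + g x) x = laplacian f x + laplacian g x"
proof -
  have d: "f differentiable_on UNIV" "g differentiable_on UNIV"
    "\<And>b. b \<in> Basis \<Longrightarrow> partial_deriv b f differentiable_on UNIV" "\<And>b. b \<in> Basis \<Longrightarrow> partial_deriv b g differentiable_on UNIV"
    using f g by (auto simp: numeral_2_eq_2)
  show ?thesis unfolding laplacian_def by (simp add: partial_deriv_add d sum.distrib)
qed

lemma laplacian_scale:
  assumes f: "C_k 2 f"
  shows "laplacian (\<lambda>x. c * f x) x = c * laplacian f x"
proof -
  have d: "f differentiable_on UNIV"
    "\<And>b. b \<in> Basis \<Longrightarrow> partial_deriv b f differentiable_on UNIV"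
    using f by (auto simp: numeral_2_eq_2)
  show ?thesis unfolding laplacian_def by (simp add: partial_deriv_scale d sum_distrib_left)
qed

definition grad :: "('a::euclidean_space \<Rightarrow> real) \<Rightarrow> 'a \<Rightarrow> 'a" where
  "grad f x = (\<Sum>b\<in>Basis. partial_deriv b f x *\<^sub>R b)"

lemma GDERIV_grad:
  assumes d: "f differentiable_on UNIV"
  shows "GDERIV f x :> grad f x"
proof -
  let ?D = "frechet_derivative f (at x)"
  have D: "(f has_derivative ?D) (at x)" by (rule has_derivative_frechet[OF d])
  interpret linear ?D using D by (rule has_derivative_linear)
  have "?D h = h \<bullet> grad f x" for h
  proof -
    have "?D h = ?D (\<Sum>b\<in>Basis. (h \<bullet> b) *\<^sub>R b)" by (simp add: euclidean_representation)
    also have "\<dots> = (\<Sum>b\<in>Basis. (h \<bullet> b) * ?D b)" by (simp add: sum scale)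
    also have "\<dots> = h \<bullet> grad f x" by (simp add: grad_def inner_sum_right partial_deriv_def mult.commute)
    finally show ?thesis .
  qed
  then have "?D = (\<lambda>h. h \<bullet> grad f x)" by blast
  then show ?thesis using D by (simp add: gderiv_def)
qed

lemma C2_compact_of_C_k:
  assumes f: "C_k 2 f" and K: "compact K" "K \<subseteq> S" "\<And>x. x \<notin> K \<Longrightarrow> f x = 0"
  shows "C2_compact S f (grad f) (\<lambda>b. partial_deriv b (partial_deriv b f))"
proof -
  have d: "f differentiable_on UNIV"
    "\<And>b. b \<in> Basis \<Longrightarrow> partial_deriv b f differentiable_on UNIV"
    "\<And>b. b \<in> Basis \<Longrightarrow> continuous_on UNIV (partial_deriv b (partial_deriv b f))"
    using f by (auto simp: numeral_2_eq_2)
  have c: "\<And>b. b \<in> Basis \<Longrightarrow> continuous_on UNIV (partial_deriv b f)"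
    by (rule differentiable_imp_continuous_on[OF d(2)])
  have bg: "b \<bullet> grad f x = partial_deriv b f x" if "b \<in> Basis" for b x
  proof -
    have "b \<bullet> grad f x = (\<Sum>c\<in>Basis. partial_deriv c f x * (b \<bullet> c))" by (simp add: grad_def inner_sum_right)
    also have "\<dots> = (\<Sum>c\<in>Basis. if c = b then partial_deriv c f x else 0)"
      by (intro sum.cong refl) (use that in \<open>auto simp: inner_Basis\<close>)
    also have "\<dots> = partial_deriv b f x" using that by simp
    finally show ?thesis .
  qed
  show ?thesis
    unfolding C2_compact_def C1_compact_def
  proof (intro conjI ballI allI)
    show "GDERIV f x :> grad f x" for x by (rule GDERIV_grad[OF d(1)])
    show "continuous_on UNIV (grad f)" unfolding grad_def[abs_def] by (intro continuous_intros c)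
    show "\<exists>K. compact K \<and> K \<subseteq> S \<and> (\<forall>x. x \<notin> K \<longrightarrow> f x = 0)" using K by blast
    fix b :: 'a assume b: "b \<in> Basis"
    show "continuous_on UNIV (partial_deriv b (partial_deriv b f))" by (rule d(3)[OF b])
    fix x
    have "((\<lambda>t. partial_deriv b f (x + t *\<^sub>R b)) has_real_derivative b \<bullet> grad (partial_deriv b f) x) (at 0)"
      by (rule GDERIV_along_line) (simp add: GDERIV_grad[OF d(2)[OF b]])
    moreover have "b \<bullet> grad (partial_deriv b f) x = partial_deriv b (partial_deriv b f) x"
    proof -
      have "b \<bullet> grad (partial_deriv b f) x = (\<Sum>c\<in>Basis. partial_deriv c (partial_deriv b f) x * (b \<bullet> c))" by (simp add: grad_def inner_sum_right)
      also have "\<dots> = (\<Sum>c\<in>Basis. if c = b then partial_deriv c (partial_deriv b f) x else 0)"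
        by (intro sum.cong refl) (use b in \<open>auto simp: inner_Basis\<close>)
      also have "\<dots> = partial_deriv b (partial_deriv b f) x" using b by simp
      finally show ?thesis .
    qed
    ultimately show "((\<lambda>t. b \<bullet> grad f (x + t *\<^sub>R b)) has_real_derivative partial_deriv b (partial_deriv b f) x) (at 0)"
      using bg[OF b] by simp
  qed
qed

lemma Lap_laplacian: "Lap (\<lambda>b. partial_deriv b (partial_deriv b f)) x = laplacian f x"
  by (simp add: laplacian_def)

lemma test_functionsD:
  assumes "f \<in> test_functions S"
  shows "C_k k f" "compact (closure {x. f x \<noteq> 0})" "closure {x. f x \<noteq> 0} \<subseteq> S"
    "x \<notin> closure {x. f x \<noteq> 0} \<Longrightarrow> f x = 0"
  using assms closure_subset[of "{x. f x \<noteq> 0}"] by (auto simp: test_functions_def)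

lemma test_functionsI:
  assumes "\<And>k. C_k k f" "compact K" "K \<subseteq> S" "\<And>x. x \<notin> K \<Longrightarrow> f x = 0"
  shows "f \<in> test_functions S"
proof -
  have "{x. f x \<noteq> 0} \<subseteq> K" using assms(4) by blast
  then have sub: "closure {x. f x \<noteq> 0} \<subseteq> K" using compact_imp_closed[OF assms(2)] by (rule closure_minimal)
  then have "compact (closure {x. f x \<noteq> 0})"
    using compact_closure bounded_subset[OF compact_imp_bounded[OF assms(2)]] \<open>{x. f x \<noteq> 0} \<subseteq> K\<close> by blast
  then show ?thesis using assms(1,3) sub by (auto simp: test_functions_def)
qed

lemma C2_compact_test_function:
  assumes f: "f \<in> test_functions S"
  shows "C2_compact S f (grad f) (\<lambda>b. partial_deriv b (partial_deriv b f))"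
  by (rule C2_compact_of_C_k[OF test_functionsD(1)[OF f] test_functionsD(2,3)[OF f] test_functionsD(4)[OF f]])

lemma test_functions_add:
  assumes f: "f \<in> test_functions S" and g: "g \<in> test_functions S"
  shows "(\<lambda>x. f x + g x) \<in> test_functions S"
proof (rule test_functionsI)
  show "compact (closure {x. f x \<noteq> 0} \<union> closure {x. g x \<noteq> 0})"
    using test_functionsD(2)[OF f] test_functionsD(2)[OF g] by (rule compact_Un)
  show "closure {x. f x \<noteq> 0} \<union> closure {x. g x \<noteq> 0} \<subseteq> S"
    using test_functionsD(3)[OF f] test_functionsD(3)[OF g] by (rule Un_least)
  show "f x + g x = 0" if "x \<notin> closure {x. f x \<noteq> 0} \<union> closure {x. g x \<noteq> 0}" for x
  proof -
    have xf: "x \<notin> closure {x. f x \<noteq> 0}" and xg: "x \<notin> closure {x. g x \<noteq> 0}" using that by blast+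
    show ?thesis using test_functionsD(4)[OF f xf] test_functionsD(4)[OF g xg] by simp
  qed
qed (intro C_k_add test_functionsD(1)[OF f] test_functionsD(1)[OF g])

lemma test_functions_scale:
  assumes f: "f \<in> test_functions S"
  shows "(\<lambda>x. c * f x) \<in> test_functions S"
proof (rule test_functionsI[OF _ test_functionsD(2,3)[OF f]])
  show "C_k k (\<lambda>x. c * f x)" for k by (rule C_k_scale[OF test_functionsD(1)[OF f]])
  show "c * f x = 0" if "x \<notin> closure {x. f x \<noteq> 0}" for x
    using test_functionsD(4)[OF f that] by simp
qed

text \<open>Used to apply the results on test functions to \<open>\<Delta>f\<close> itself, hence to take four derivatives of \<open>f\<close>.\<close>

lemma test_functions_laplacian:
  assumes f: "f \<in> test_functions S"
  shows "laplacian f \<in> test_functions S"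
proof -
  obtain K where K: "compact K" "K \<subseteq> S" "\<And>x. x \<notin> K \<Longrightarrow> Lap (\<lambda>b. partial_deriv b (partial_deriv b f)) x = 0"
    using C2_compact_support[OF C2_compact_test_function[OF f]] by blast
  show ?thesis
    by (rule test_functionsI[OF C_k_laplacian[OF test_functionsD(1)[OF f]] K(1,2)])
      (rule K(3)[unfolded Lap_laplacian])
qed

lemma lebesgue_on_integral_eq:
  fixes f :: "'a::euclidean_space \<Rightarrow> real"
  assumes f: "continuous_on UNIV f" and K: "compact K" "K \<subseteq> \<Omega>" "\<And>x. x \<notin> K \<Longrightarrow> f x = 0" and \<Omega>: "open \<Omega>"
  shows "integrable (lebesgue_on \<Omega>) f" "(\<integral>x. f x \<partial>lebesgue_on \<Omega>) = (\<integral>x. f x \<partial>lborel)"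
proof -
  have S: "\<Omega> \<inter> space lebesgue \<in> sets lebesgue" using \<Omega> by simp
  have e: "(\<lambda>x. indicator \<Omega> x *\<^sub>R f x) = f" using K by (auto simp: fun_eq_iff indicator_def)
  have i: "integrable lborel f" by (rule integrable_compact_support[OF f K(1,3)])
  have m: "f \<in> borel_measurable lborel" by (rule borel_measurable_integrable[OF i])
  show "integrable (lebesgue_on \<Omega>) f"
    unfolding integrable_restrict_space[OF S] e using i m by (simp add: integrable_completion)
  show "(\<integral>x. f x \<partial>lebesgue_on \<Omega>) = (\<integral>x. f x \<partial>lborel)"
    unfolding integral_restrict_space[OF S] e using m by (simp add: integral_completion)
qed

context
  fixes \<Omega> :: "'a::euclidean_space set" and \<alpha> :: real
  assumes \<Omega>: "open \<Omega>"
begin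

abbreviation (input) energy :: "('a \<Rightarrow> real) \<Rightarrow> ('a \<Rightarrow> real) \<Rightarrow> real" where
  "energy f g \<equiv> (\<integral>x. norm x powr \<alpha> * (laplacian f x * laplacian g x) \<partial>lborel)"

lemma weighted_laplacian_continuous:
  assumes f: "f \<in> test_functions (\<Omega> - {0})"
  shows "continuous_on UNIV (\<lambda>x. norm x powr s * laplacian f x)"
proof -
  note L = test_functions_laplacian[OF f]
  show ?thesis
    by (rule continuous_on_norm_powr_mult[OF C_k_continuous[OF test_functionsD(1)[OF L]] test_functionsD(2)[OF L] _ test_functionsD(4)[OF L]])
      (use test_functionsD(3)[OF L] in auto)
qed

lemma norm_powr_square: "(norm x powr (s / 2) * y)\<^sup>2 = norm x powr s * (y::real)\<^sup>2"
  using powr_add[of "norm x" "s / 2" "s / 2"] by (simp add: power2_eq_square mult_ac)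

lemma norm_2_sq:
  assumes f: "f \<in> test_functions (\<Omega> - {0})"
  shows "norm_2 \<alpha> \<Omega> f = sqrt (\<integral>x. norm x powr \<alpha> * (laplacian f x)\<^sup>2 \<partial>lborel)"
    and "integrable lborel (\<lambda>x. norm x powr \<alpha> * (laplacian f x)\<^sup>2)"
proof -
  note L = test_functions_laplacian[OF f]
  let ?K = "closure {x. laplacian f x \<noteq> 0}"
  have e: "norm x powr \<alpha> * (laplacian f x)\<^sup>2 = (norm x powr (\<alpha> / 2) * laplacian f x)\<^sup>2" for x
    by (rule norm_powr_square[symmetric])
  have c: "continuous_on UNIV (\<lambda>x. norm x powr \<alpha> * (laplacian f x)\<^sup>2)"
    unfolding e by (intro continuous_intros weighted_laplacian_continuous[OF f])
  have K1: "compact ?K" by (rule test_functionsD(2)[OF L])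
  have K2: "?K \<subseteq> \<Omega>" using test_functionsD(3)[OF L] by blast
  have K3: "norm x powr \<alpha> * (laplacian f x)\<^sup>2 = 0" if "x \<notin> ?K" for x
    using test_functionsD(4)[OF L that] by simp
  note K = K1 K2 K3
  show "norm_2 \<alpha> \<Omega> f = sqrt (\<integral>x. norm x powr \<alpha> * (laplacian f x)\<^sup>2 \<partial>lborel)"
    unfolding norm_2_def by (rule arg_cong[of _ _ sqrt]) (rule lebesgue_on_integral_eq(2)[OF c K \<Omega>])
  show "integrable lborel (\<lambda>x. norm x powr \<alpha> * (laplacian f x)\<^sup>2)"
    by (rule integrable_compact_support[OF c K(1,3)])
qed

lemma energy_Cauchy_Schwarz:
  assumes f: "f \<in> test_functions (\<Omega> - {0})" and g: "g \<in> test_functions (\<Omega> - {0})"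
  shows "integrable lborel (\<lambda>x. norm x powr \<alpha> * (laplacian f x * laplacian g x))"
    and "\<bar>\<integral>x. norm x powr \<alpha> * (laplacian f x * laplacian g x) \<partial>lborel\<bar> \<le> norm_2 \<alpha> \<Omega> f * norm_2 \<alpha> \<Omega> g"
proof -
  let ?w = "\<lambda>f x. norm x powr (\<alpha> / 2) * laplacian f x"
  have m: "?w f \<in> borel_measurable lborel" if "f \<in> test_functions (\<Omega> - {0})" for f
    using borel_measurable_continuous_onI[OF weighted_laplacian_continuous[OF that]] by simp
  have e: "norm x powr \<alpha> * (laplacian f x * laplacian g x) = ?w f x * ?w g x" for x
    using powr_add[of "norm x" "\<alpha> / 2" "\<alpha> / 2"] by (simp add: mult_ac)
  have i: "integrable lborel (\<lambda>x. (?w f x)\<^sup>2)" if "f \<in> test_functions (\<Omega> - {0})" for f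
    unfolding norm_powr_square by (rule norm_2_sq(2)[OF that])
  note CS = integral_Cauchy_Schwarz[OF m[OF f] m[OF g] i[OF f] i[OF g]]
  show "integrable lborel (\<lambda>x. norm x powr \<alpha> * (laplacian f x * laplacian g x))"
    unfolding e by (rule CS(1))
  have "\<bar>\<integral>x. ?w f x * ?w g x \<partial>lborel\<bar> \<le> sqrt ((\<integral>x. (?w f x)\<^sup>2 \<partial>lborel) * (\<integral>x. (?w g x)\<^sup>2 \<partial>lborel))"
    by (rule real_le_rsqrt) (use CS(2) in simp)
  then show "\<bar>\<integral>x. norm x powr \<alpha> * (laplacian f x * laplacian g x) \<partial>lborel\<bar> \<le> norm_2 \<alpha> \<Omega> f * norm_2 \<alpha> \<Omega> g"
    unfolding e norm_2_sq(1)[OF f] norm_2_sq(1)[OF g] norm_powr_square real_sqrt_mult .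
qed

lemma norm_2_power2:
  assumes f: "f \<in> test_functions (\<Omega> - {0})"
  shows "(norm_2 \<alpha> \<Omega> f)\<^sup>2 = (\<integral>x. norm x powr \<alpha> * (laplacian f x * laplacian f x) \<partial>lborel)"
  unfolding norm_2_sq(1)[OF f] by (simp add: power2_eq_square)

lemma seminormed_test_functions:
  "seminormed_function_space (test_functions (\<Omega> - {0})) (norm_2 \<alpha> \<Omega>)"
proof
  fix f g :: "'a \<Rightarrow> real" and c
  assume f: "f \<in> test_functions (\<Omega> - {0})"
  show "(\<lambda>x. c * f x) \<in> test_functions (\<Omega> - {0})" by (rule test_functions_scale[OF f])
  show n0: "norm_2 \<alpha> \<Omega> f \<ge> 0" unfolding norm_2_sq(1)[OF f] by simp
  show "norm_2 \<alpha> \<Omega> (\<lambda>x. c * f x) = \<bar>c\<bar> * norm_2 \<alpha> \<Omega> f"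
  proof -
    have "(\<integral>x. norm x powr \<alpha> * (c * laplacian f x)\<^sup>2 \<partial>lborel) = c\<^sup>2 * (\<integral>x. norm x powr \<alpha> * (laplacian f x)\<^sup>2 \<partial>lborel)"
      by (simp add: power_mult_distrib mult.left_commute[of _ "c\<^sup>2"])
    then show ?thesis
      unfolding norm_2_sq(1)[OF f] norm_2_sq(1)[OF test_functions_scale[OF f]] laplacian_scale[OF test_functionsD(1)[OF f]]
      by (simp add: real_sqrt_mult)
  qed
  assume g: "g \<in> test_functions (\<Omega> - {0})"
  show fg: "(\<lambda>x. f x + g x) \<in> test_functions (\<Omega> - {0})" by (rule test_functions_add[OF f g])
  have g0: "norm_2 \<alpha> \<Omega> g \<ge> 0" unfolding norm_2_sq(1)[OF g] by simp
  note i = norm_2_sq(2)[OF f] norm_2_sq(2)[OF g] energy_Cauchy_Schwarz(1)[OF f g]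
  have "(norm_2 \<alpha> \<Omega> (\<lambda>x. f x + g x))\<^sup>2 = (\<integral>x. (norm x powr \<alpha> * (laplacian f x)\<^sup>2 + norm x powr \<alpha> * (laplacian g x)\<^sup>2)
      + 2 * (norm x powr \<alpha> * (laplacian f x * laplacian g x)) \<partial>lborel)"
    unfolding norm_2_power2[OF fg] laplacian_add[OF test_functionsD(1)[OF f] test_functionsD(1)[OF g]]
    by (intro Bochner_Integration.integral_cong refl) (simp add: power2_eq_square algebra_simps)
  also have "\<dots> = (norm_2 \<alpha> \<Omega> f)\<^sup>2 + (norm_2 \<alpha> \<Omega> g)\<^sup>2 + 2 * energy f g"
    using i unfolding norm_2_sq(1)[OF f] norm_2_sq(1)[OF g] by simp
  also have "\<dots> \<le> (norm_2 \<alpha> \<Omega> f)\<^sup>2 + (norm_2 \<alpha> \<Omega> g)\<^sup>2 + 2 * (norm_2 \<alpha> \<Omega> f * norm_2 \<alpha> \<Omega> g)"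
    using energy_Cauchy_Schwarz(2)[OF f g] by simp
  also have "\<dots> = (norm_2 \<alpha> \<Omega> f + norm_2 \<alpha> \<Omega> g)\<^sup>2" by (simp add: power2_sum)
  finally show "norm_2 \<alpha> \<Omega> (\<lambda>x. f x + g x) \<le> norm_2 \<alpha> \<Omega> f + norm_2 \<alpha> \<Omega> g"
    by (rule power2_le_imp_le) (use n0 g0 in simp)
qed

text \<open>With \<open>f\<close> fixed, the energy form is integration against \<open>h = \<Delta>(|x|^\<alpha> \<Delta>f)\<close>, by Green's identity
  applied twice.  So it is continuous under convergence of \<open>g\<close> alone, without its derivatives.\<close>

lemma energy_eq_integral_test:
  assumes f: "f \<in> test_functions (\<Omega> - {0})"
  obtains h K where "continuous_on UNIV h" "compact K" "K \<subseteq> \<Omega>" "0 \<notin> K" "\<And>x. x \<notin> K \<Longrightarrow> h x = 0"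
    "\<And>g. g \<in> test_functions (\<Omega> - {0}) \<Longrightarrow> energy f g = (\<integral>x. h x * g x \<partial>lborel)"
proof -
  note Lf = C2_compact_test_function[OF test_functions_laplacian[OF f]]
  obtain W T where w: "C2_compact (\<Omega> - {0}) (\<lambda>x. norm x powr \<alpha> * laplacian f x) W T"
    using C2_compact_norm_powr_mult[OF Lf, of \<alpha>] by blast
  obtain K where K: "compact K" "K \<subseteq> \<Omega> - {0}" "\<And>x. x \<notin> K \<Longrightarrow> norm x powr \<alpha> * laplacian f x = 0"
      "\<And>x. x \<notin> K \<Longrightarrow> W x = 0" "\<And>x. x \<notin> K \<Longrightarrow> Lap T x = 0"
    using C2_compact_support[OF w] by blast
  show ?thesis
  proof (rule that[of "Lap T" K])
    show "continuous_on UNIV (Lap T)" by (rule continuous_Lap[OF w])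
    fix g assume g: "g \<in> test_functions (\<Omega> - {0})"
    note g2 = C2_compact_test_function[OF g]
    note cont = continuous_intros C1_compactD(2,3)[OF C2_compactD(1)[OF w]] C1_compactD(2,3)[OF C2_compactD(1)[OF g2]]
      continuous_Lap[OF w] C_k_continuous[OF test_functionsD(1)[OF test_functions_laplacian[OF g]]]
    have i: "integrable lborel (\<lambda>x. W x \<bullet> grad g x)"
      by (rule integrable_compact_support[OF _ K(1)]) (auto intro!: cont simp: K)
    have i1: "integrable lborel (\<lambda>x. norm x powr \<alpha> * laplacian f x * laplacian g x)"
    proof (rule integrable_compact_support)
      show "continuous_on UNIV (\<lambda>x. norm x powr \<alpha> * laplacian f x * laplacian g x)"
        by (rule continuous_on_mult[OF C1_compactD(3)[OF C2_compactD(1)[OF w]]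
              C_k_continuous[OF test_functionsD(1)[OF test_functions_laplacian[OF g]]]])
      show "norm x powr \<alpha> * laplacian f x * laplacian g x = 0" if "x \<notin> K" for x
        unfolding K(3)[OF that] by simp
    qed (rule K(1))
    have i2: "integrable lborel (\<lambda>x. g x * Lap T x)"
      by (rule integrable_compact_support[OF _ K(1)]) (auto intro!: cont simp: K)
    have "(\<integral>x. norm x powr \<alpha> * laplacian f x * laplacian g x + W x \<bullet> grad g x \<partial>lborel) = 0"
      using integral_Green[OF C2_compactD(1)[OF w] g2] by (simp add: Lap_laplacian)
    moreover have "(\<integral>x. g x * Lap T x + W x \<bullet> grad g x \<partial>lborel) = 0"
      using integral_Green[OF C2_compactD(1)[OF g2] w] by (simp add: inner_commute)
    ultimately have "(\<integral>x. norm x powr \<alpha> * laplacian f x * laplacian g x \<partial>lborel) = (\<integral>x. g x * Lap T x \<partial>lborel)"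
      unfolding Bochner_Integration.integral_add[OF i1 i] Bochner_Integration.integral_add[OF i2 i] by linarith
    then show "energy f g = (\<integral>x. Lap T x * g x \<partial>lborel)" by (simp add: mult_ac)
  qed (use K in auto)
qed

end

section \<open>The weighted embedding\<close>

lemma term_le_suminf: "g k \<le> (\<Sum>k. g k :: ennreal)"
  using sum_le_suminf[of g "{k}"] by simp

text \<open>For negative \<open>l\<close> the weight on the dyadic shell of outer radius \<open>R / 2^k\<close> is at most its value at the
  inner radius, and the resulting geometric series converges because \<open>l > - N\<close>.\<close>

lemma nn_integral_norm_powr_finite:
  fixes R l :: real
  assumes l: "l > - real DIM('a::euclidean_space)" and R: "R > 0"
  shows "(\<integral>\<^sup>+x. indicator (cball (0::'a) R) x * ennreal (norm x powr l) \<partial>lborel) < \<infinity>"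
proof (cases "l \<ge> 0")
  case True
  have "(\<integral>\<^sup>+x. indicator (cball (0::'a) R) x * ennreal (norm x powr l) \<partial>lborel)
      \<le> (\<integral>\<^sup>+x. ennreal (R powr l) * indicator (cball (0::'a) R) x \<partial>lborel)"
    by (intro nn_integral_mono) (auto simp: indicator_def intro!: ennreal_leI powr_mono2 True)
  also have "\<dots> = ennreal (R powr l) * emeasure lborel (cball (0::'a) R)"
    by (rule nn_integral_cmult_indicator) (auto intro: borel_closed)
  also have "\<dots> < \<infinity>" using emeasure_compact_finite[of "cball (0::'a) R"] by (simp add: ennreal_mult_less_top)
  finally show ?thesis .
next
  case False
  define v where "v = unit_ball_vol (real DIM('a))"
  have v: "v > 0" by (simp add: v_def)
  define a where "a k = (R / 2 ^ Suc k) powr l" for k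
  have a0: "a k \<ge> 0" for k by (simp add: a_def)
  have pt: "indicator (cball (0::'a) R) x * ennreal (norm x powr l)
      \<le> (\<Sum>k. ennreal (a k) * indicator (cball (0::'a) (R / 2 ^ k)) x)" for x :: 'a
  proof (cases "x \<in> cball 0 R \<and> x \<noteq> 0")
    case True
    then have nx: "0 < norm x" "norm x \<le> R" by auto
    define k where "k = nat \<lfloor>log 2 (R / norm x)\<rfloor>"
    have "1 \<le> R / norm x" using nx by (simp add: le_divide_eq)
    then have "0 \<le> log 2 (R / norm x)" using nx R by (subst zero_le_log_cancel_iff) auto
    then have k: "real k \<le> log 2 (R / norm x)" "log 2 (R / norm x) < real k + 1" unfolding k_def by linarith+
    have "2 powr real k \<le> R / norm x" "R / norm x < 2 powr (real k + 1)"
      using k nx R by (auto simp: le_log_iff log_less_iff)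
    then have k2: "2 ^ k \<le> R / norm x" "R / norm x < 2 ^ Suc k" by (simp_all add: powr_add powr_realpow)
    have kk: "norm x \<le> R / 2 ^ k" "R / 2 ^ Suc k < norm x" using k2 nx by (simp_all add: field_simps)
    have "norm x powr l \<le> a k" unfolding a_def using kk R False by (intro powr_mono2') auto
    then have "indicator (cball (0::'a) R) x * ennreal (norm x powr l) \<le> ennreal (a k) * indicator (cball (0::'a) (R / 2 ^ k)) x"
      using kk nx by (simp add: ennreal_leI)
    also have "\<dots> \<le> (\<Sum>k. ennreal (a k) * indicator (cball (0::'a) (R / 2 ^ k)) x)"
      by (rule term_le_suminf)
    finally show ?thesis .
  qed (auto simp: indicator_def)
  have "(\<integral>\<^sup>+x. indicator (cball (0::'a) R) x * ennreal (norm x powr l) \<partial>lborel)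
      \<le> (\<integral>\<^sup>+x. (\<Sum>k. ennreal (a k) * indicator (cball (0::'a) (R / 2 ^ k)) x) \<partial>lborel)"
    by (rule nn_integral_mono) (rule pt)
  also have "\<dots> = (\<Sum>k. (\<integral>\<^sup>+x. ennreal (a k) * indicator (cball (0::'a) (R / 2 ^ k)) x \<partial>lborel))"
  proof (rule nn_integral_suminf)
    show "(\<lambda>x. ennreal (a k) * indicator (cball (0::'a) (R / 2 ^ k)) x) \<in> borel_measurable lborel" for k
      using borel_measurable_indicator[of "cball (0::'a) (R / 2 ^ k)" lborel] borel_closed[OF closed_cball, of 0 "R / 2 ^ k"]
      by (intro borel_measurable_times_ennreal) auto
  qed
  also have "\<dots> = (\<Sum>k. ennreal (a k * (v * (R / 2 ^ k) ^ DIM('a))))"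
  proof (intro suminf_cong)
    fix k
    have "(\<integral>\<^sup>+x. ennreal (a k) * indicator (cball (0::'a) (R / 2 ^ k)) x \<partial>lborel) = ennreal (a k) * emeasure lborel (cball (0::'a) (R / 2 ^ k))"
      by (rule nn_integral_cmult_indicator) (auto intro: borel_closed)
    also have "\<dots> = ennreal (a k) * ennreal (v * (R / 2 ^ k) ^ DIM('a))"
      using R by (subst emeasure_cball) (auto simp: v_def)
    also have "\<dots> = ennreal (a k * (v * (R / 2 ^ k) ^ DIM('a)))" using a0 by (simp add: ennreal_mult')
    finally show "(\<integral>\<^sup>+x. ennreal (a k) * indicator (cball (0::'a) (R / 2 ^ k)) x \<partial>lborel) = ennreal (a k * (v * (R / 2 ^ k) ^ DIM('a)))" .
  qed
  also have "\<dots> < \<infinity>"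
  proof -
    define \<rho> where "\<rho> = 2 powr (- (l + real DIM('a)))"
    define c where "c = (R / 2) powr l * (v * R ^ DIM('a))"
    have e: "a k * (v * (R / 2 ^ k) ^ DIM('a)) = c * \<rho> ^ k" for k
    proof -
      have "a k = (R / 2) powr l * (2 powr (- l)) ^ k"
      proof -
        have rk: "R / 2 ^ Suc k = (R / 2) * 2 powr (- real k)" by (simp add: powr_minus powr_realpow field_simps)
        have "a k = (R / 2) powr l * (2 powr (- real k)) powr l" unfolding a_def rk by (rule powr_mult)
        then show ?thesis by (simp add: powr_powr powr_realpow[symmetric] mult.commute)
      qed
      moreover have "(R / 2 ^ k) ^ DIM('a) = R ^ DIM('a) * (2 powr (- real DIM('a))) ^ k"
        by (simp add: power_divide powr_minus powr_realpow inverse_eq_divide power_one_over flip: power_mult)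
      moreover have "\<rho> = 2 powr (- l) * 2 powr (- real DIM('a))" unfolding \<rho>_def by (simp flip: powr_add)
      ultimately show ?thesis by (simp add: c_def power_mult_distrib mult_ac)
    qed
    have "\<rho> < 2 powr 0" unfolding \<rho>_def using l by (intro powr_less_mono) auto
    then have "summable (\<lambda>k. c * \<rho> ^ k)" by (intro summable_mult summable_geometric) (simp add: \<rho>_def)
    moreover have "0 \<le> c * \<rho> ^ k" for k using v R by (simp add: c_def \<rho>_def)
    ultimately have "(\<Sum>k. ennreal (c * \<rho> ^ k)) = ennreal (\<Sum>k. c * \<rho> ^ k)"
      by (intro suminf_ennreal_eq summable_sums) auto
    then show ?thesis unfolding e by simp
  qed
  finally show ?thesis .
qed

lemma (in finite_measure) Lq_tendsto_zero_lower_exponent: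
  fixes u :: "nat \<Rightarrow> 'a \<Rightarrow> real"
  assumes q: "0 < q" "q \<le> P" and m: "\<And>n. u n \<in> borel_measurable M" and i: "\<And>n. integrable M (\<lambda>x. \<bar>u n x\<bar> powr P)"
    and lim: "(\<lambda>n. \<integral>x. \<bar>u n x\<bar> powr P \<partial>M) \<longlonglongrightarrow> 0"
  shows "(\<lambda>n. \<integral>x. \<bar>u n x\<bar> powr q \<partial>M) \<longlonglongrightarrow> 0"
proof -
  have P: "P > 0" using q by simp
  define I where "I n = (\<integral>x. \<bar>u n x\<bar> powr P \<partial>M)" for n
  \<comment> \<open>The term \<open>1 / (n + 1)\<close> keeps \<open>t n\<close> positive when \<open>I n\<close> vanishes.\<close>
  define t where "t n = (I n + 1 / real (Suc n)) powr (1 / P)" for n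
  have I0: "I n \<ge> 0" for n by (simp add: I_def)
  have Ip: "I n + 1 / real (Suc n) > 0" for n by (rule add_nonneg_pos[OF I0]) simp
  have t: "t n > 0" for n unfolding t_def using Ip[of n] by simp
  have tP: "t n powr P = I n + 1 / real (Suc n)" for n
    unfolding t_def using P Ip[of n] by (simp add: powr_powr)
  have le: "(\<integral>x. \<bar>u n x\<bar> powr q \<partial>M) \<le> t n powr q * (measure M (space M) + 1)" for n
    by (rule integrable_lower_exponent(2)[OF q m i t]) (simp add: tP flip: I_def)
  have "(\<lambda>n. I n + 1 / real (Suc n)) \<longlonglongrightarrow> 0 + 0"
    using lim unfolding I_def[symmetric] by (intro tendsto_add LIMSEQ_Suc[OF lim_inverse_n'])
  then have l1: "(\<lambda>n. I n + 1 / real (Suc n)) \<longlonglongrightarrow> 0" by simp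
  have "t \<longlonglongrightarrow> 0 powr (1 / P)" unfolding t_def
    using P by (intro tendsto_powr' l1 tendsto_const) (auto intro!: always_eventually add_nonneg_nonneg I0)
  then have l2: "t \<longlonglongrightarrow> 0" by simp
  have "(\<lambda>n. t n powr q * (measure M (space M) + 1)) \<longlonglongrightarrow> 0 powr q * (measure M (space M) + 1)"
    using q t by (intro tendsto_mult tendsto_powr' l2 tendsto_const) (auto intro!: always_eventually less_imp_le)
  then have l3: "(\<lambda>n. t n powr q * (measure M (space M) + 1)) \<longlonglongrightarrow> 0" by simp
  show ?thesis
  proof (rule tendsto_sandwich[OF _ _ tendsto_const l3])
    show "\<forall>\<^sub>F n in sequentially. (\<integral>x. \<bar>u n x\<bar> powr q \<partial>M) \<le> t n powr q * (measure M (space M) + 1)"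
      by (intro always_eventually allI le)
  qed simp
qed

definition weighted_lebesgue :: "real \<Rightarrow> 'a::euclidean_space set \<Rightarrow> 'a measure" where
  "weighted_lebesgue l \<Omega> = density (lebesgue_on \<Omega>) (\<lambda>x. ennreal (norm x powr l))"

lemma measurable_norm_powr: "(\<lambda>x::'a::euclidean_space. norm x powr l) \<in> borel_measurable (lebesgue_on \<Omega>)"
proof -
  have "(\<lambda>x::'a. norm x powr l) \<in> borel_measurable borel" by measurable
  then have "(\<lambda>x::'a. norm x powr l) \<in> borel_measurable lebesgue" by (simp add: measurable_completion)
  then show ?thesis by (rule measurable_restrict_space1)
qed

lemma borel_measurable_weighted_lebesgue [simp]:
  "f \<in> borel_measurable (weighted_lebesgue l \<Omega>) \<longleftrightarrow> f \<in> borel_measurable (lebesgue_on \<Omega>)"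
  by (simp add: weighted_lebesgue_def)

lemma borel_imp_weighted_lebesgue:
  fixes f :: "'a::euclidean_space \<Rightarrow> real"
  assumes "f \<in> borel_measurable borel"
  shows "f \<in> borel_measurable (lebesgue_on \<Omega>)"
proof -
  have "f \<in> borel_measurable lebesgue" using assms by (simp add: measurable_completion)
  then show ?thesis by (rule measurable_restrict_space1)
qed

lemma weighted_lebesgue_integral:
  fixes f :: "'a::euclidean_space \<Rightarrow> real"
  assumes f: "f \<in> borel_measurable (lebesgue_on \<Omega>)"
  shows "integrable (weighted_lebesgue l \<Omega>) f \<longleftrightarrow> integrable (lebesgue_on \<Omega>) (\<lambda>x. norm x powr l * f x)"
    "(\<integral>x. f x \<partial>weighted_lebesgue l \<Omega>) = (\<integral>x. norm x powr l * f x \<partial>lebesgue_on \<Omega>)"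
  unfolding weighted_lebesgue_def
  using integrable_density[OF f measurable_norm_powr[of l \<Omega>]] integral_density[OF f measurable_norm_powr[of l \<Omega>]] by simp_all

text \<open>The density vanishes at the origin only.\<close>

lemma AE_weighted_lebesgue:
  fixes \<Omega> :: "'a::euclidean_space set"
  assumes \<Omega>: "open \<Omega>"
  shows "(AE x in weighted_lebesgue l \<Omega>. Q x) \<longleftrightarrow> (AE x in lebesgue_on \<Omega>. Q x)"
proof -
  have "AE x in lborel. x \<noteq> (0::'a)" by (rule AE_lborel_singleton)
  then have "AE x in lebesgue. x \<noteq> (0::'a)" by (rule AE_completion)
  then have n0: "AE x in lebesgue_on \<Omega>. x \<noteq> 0"
    using \<Omega> by (subst AE_restrict_space_iff) auto
  have "(AE x in weighted_lebesgue l \<Omega>. Q x) \<longleftrightarrow> (AE x in lebesgue_on \<Omega>. 0 < ennreal (norm x powr l) \<longrightarrow> Q x)"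
    unfolding weighted_lebesgue_def by (rule AE_density) (use measurable_norm_powr in measurable)
  also have "\<dots> \<longleftrightarrow> (AE x in lebesgue_on \<Omega>. Q x)"
  proof
    assume "AE x in lebesgue_on \<Omega>. 0 < ennreal (norm x powr l) \<longrightarrow> Q x"
    with n0 show "AE x in lebesgue_on \<Omega>. Q x" by eventually_elim simp
  next
    assume "AE x in lebesgue_on \<Omega>. Q x"
    then show "AE x in lebesgue_on \<Omega>. 0 < ennreal (norm x powr l) \<longrightarrow> Q x" by eventually_elim simp
  qed
  finally show ?thesis .
qed

lemma finite_measure_weighted_lebesgue:
  fixes \<Omega> :: "'a::euclidean_space set"
  assumes \<Omega>: "open \<Omega>" "\<Omega> \<subseteq> cball 0 R" "R > 0" and l: "l > - real DIM('a)"
  shows "finite_measure (weighted_lebesgue l \<Omega>)"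
proof
  have S: "\<Omega> \<inter> space lebesgue \<in> sets lebesgue" using \<Omega> by simp
  have m: "(\<lambda>x. ennreal (norm x powr l)) \<in> borel_measurable (lebesgue_on \<Omega>)" using measurable_norm_powr by measurable
  have "emeasure (weighted_lebesgue l \<Omega>) (space (weighted_lebesgue l \<Omega>)) = (\<integral>\<^sup>+x. ennreal (norm x powr l) * indicator \<Omega> x \<partial>lebesgue_on \<Omega>)"
    unfolding weighted_lebesgue_def by (subst emeasure_density[OF m]) auto
  also have "\<dots> = (\<integral>\<^sup>+x. ennreal (norm x powr l) * indicator \<Omega> x * indicator \<Omega> x \<partial>lebesgue)"
    by (rule nn_integral_restrict_space[OF S])
  also have "\<dots> = (\<integral>\<^sup>+x. ennreal (norm x powr l) * indicator \<Omega> x * indicator \<Omega> x \<partial>lborel)"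
    by (rule nn_integral_completion)
  also have "\<dots> \<le> (\<integral>\<^sup>+x. indicator (cball (0::'a) R) x * ennreal (norm x powr l) \<partial>lborel)"
    by (intro nn_integral_mono) (use \<Omega>(2) in \<open>auto simp: indicator_def\<close>)
  also have "\<dots> < \<infinity>" by (rule nn_integral_norm_powr_finite[OF l \<Omega>(3)])
  finally show "emeasure (weighted_lebesgue l \<Omega>) (space (weighted_lebesgue l \<Omega>)) \<noteq> \<infinity>" by simp
qed

lemma weighted_lebesgue_integral_test:
  fixes f :: "'a::euclidean_space \<Rightarrow> real"
  assumes \<Omega>: "open \<Omega>" and f: "f \<in> test_functions (\<Omega> - {0})" and P: "P > 0"
  shows "integrable (weighted_lebesgue l \<Omega>) (\<lambda>x. \<bar>f x\<bar> powr P)"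
    "integrable lborel (\<lambda>x. norm x powr l * \<bar>f x\<bar> powr P)"
    "(\<integral>x. \<bar>f x\<bar> powr P \<partial>weighted_lebesgue l \<Omega>) = (\<integral>x. norm x powr l * \<bar>f x\<bar> powr P \<partial>lborel)"
proof -
  let ?K = "closure {x. f x \<noteq> 0}"
  have K: "compact ?K" "0 \<notin> ?K" "?K \<subseteq> \<Omega>" using test_functionsD(2,3)[OF f] by auto
  have z: "\<bar>f x\<bar> powr P = 0" if "x \<notin> ?K" for x using test_functionsD(4)[OF f that] by simp
  have z2: "norm x powr l * \<bar>f x\<bar> powr P = 0" if "x \<notin> ?K" for x using z[OF that] by simp
  have c: "continuous_on UNIV (\<lambda>x. \<bar>f x\<bar> powr P)"
    by (rule continuous_on_compose2[OF continuous_on_abs_powr[OF P, of UNIV] C_k_continuous[OF test_functionsD(1)[OF f]]]) simp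
  have c2: "continuous_on UNIV (\<lambda>x. norm x powr l * \<bar>f x\<bar> powr P)"
    by (rule continuous_on_norm_powr_mult[OF c K(1,2) z])
  have m: "(\<lambda>x. \<bar>f x\<bar> powr P) \<in> borel_measurable (lebesgue_on \<Omega>)"
    by (rule borel_imp_weighted_lebesgue[OF borel_measurable_continuous_onI[OF c]])
  show "integrable lborel (\<lambda>x. norm x powr l * \<bar>f x\<bar> powr P)" by (rule integrable_compact_support[OF c2 K(1) z2])
  show "integrable (weighted_lebesgue l \<Omega>) (\<lambda>x. \<bar>f x\<bar> powr P)"
    unfolding weighted_lebesgue_integral(1)[OF m] by (rule lebesgue_on_integral_eq(1)[OF c2 K(1,3) z2 \<Omega>])
  show "(\<integral>x. \<bar>f x\<bar> powr P \<partial>weighted_lebesgue l \<Omega>) = (\<integral>x. norm x powr l * \<bar>f x\<bar> powr P \<partial>lborel)"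
    unfolding weighted_lebesgue_integral(2)[OF m] by (rule lebesgue_on_integral_eq(2)[OF c2 K(1,3) z2 \<Omega>])
qed

lemma test_function_weighted_Sobolev:
  fixes \<Omega> :: "'a::euclidean_space set"
  assumes \<Omega>: "open \<Omega>" "\<Omega> \<subseteq> cball 0 R" "R > 0"
    and N: "4 - real DIM('a) < \<alpha>" "\<alpha> < real DIM('a)" "DIM('a) \<ge> 5"
    and P: "P = 2 * real DIM('a) / (real DIM('a) - 4)" and l: "\<alpha> * P / 2 \<le> l"
  shows "\<exists>C\<ge>0. \<forall>f\<in>test_functions (\<Omega> - {0}). (\<integral>x. \<bar>f x\<bar> powr P \<partial>weighted_lebesgue l \<Omega>) \<le> (C * norm_2 \<alpha> \<Omega> f) powr P"
proof -
  obtain C1 where C1: "C1 \<ge> 0" "\<And>S u G L. C2_compact S u G L \<Longrightarrow> 0 \<notin> (S :: 'a set) \<Longrightarrow>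
    (\<integral>x. \<bar>norm x powr (\<alpha> / 2) * u x\<bar> powr P \<partial>lborel) \<le> (C1 * (\<integral>x. norm x powr \<alpha> * (Lap L x)\<^sup>2 \<partial>lborel)) powr (P / 2)"
    using weighted_Sobolev[OF N P] by blast
  have P0: "P > 0" using N(3) by (simp add: P)
  define D where "D = R powr (l - \<alpha> * P / 2)"
  have D: "D > 0" using \<Omega>(3) by (simp add: D_def)
  define C where "C = D powr (1 / P) * sqrt C1"
  have C0: "C \<ge> 0" using C1(1) by (simp add: C_def)
  show ?thesis
  proof (intro exI[of _ C] conjI ballI C0)
    fix f assume f: "f \<in> test_functions (\<Omega> - {0})"
    define E where "E = (\<integral>x. norm x powr \<alpha> * (laplacian f x)\<^sup>2 \<partial>lborel)"
    have E0: "E \<ge> 0" by (simp add: E_def)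
    have nE: "norm_2 \<alpha> \<Omega> f = sqrt E" unfolding E_def by (rule norm_2_sq(1)[OF \<Omega>(1) f])
    let ?K = "closure {x. f x \<noteq> 0}"
    have K: "compact ?K" "0 \<notin> ?K" "?K \<subseteq> \<Omega>" using test_functionsD(2,3)[OF f] by auto
    have e: "\<bar>norm x powr (\<alpha> / 2) * f x\<bar> powr P = norm x powr (\<alpha> * P / 2) * \<bar>f x\<bar> powr P" for x
      by (simp add: abs_mult powr_mult powr_powr)
    have "(\<integral>x. \<bar>f x\<bar> powr P \<partial>weighted_lebesgue l \<Omega>) = (\<integral>x. norm x powr l * \<bar>f x\<bar> powr P \<partial>lborel)"
      by (rule weighted_lebesgue_integral_test(3)[OF \<Omega>(1) f P0])
    also have "\<dots> \<le> (\<integral>x. D * (norm x powr (\<alpha> * P / 2) * \<bar>f x\<bar> powr P) \<partial>lborel)"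
    proof (rule integral_mono)
      show "integrable lborel (\<lambda>x. norm x powr l * \<bar>f x\<bar> powr P)" by (rule weighted_lebesgue_integral_test(2)[OF \<Omega>(1) f P0])
      show "integrable lborel (\<lambda>x. D * (norm x powr (\<alpha> * P / 2) * \<bar>f x\<bar> powr P))"
        by (intro integrable_mult_right weighted_lebesgue_integral_test(2)[OF \<Omega>(1) f P0])
      show "norm x powr l * \<bar>f x\<bar> powr P \<le> D * (norm x powr (\<alpha> * P / 2) * \<bar>f x\<bar> powr P)" for x
      proof (cases "x \<in> ?K")
        case True
        then have "norm x \<le> R" using K(3) \<Omega>(2) by auto
        then have "norm x powr (l - \<alpha> * P / 2) \<le> D" unfolding D_def using l by (intro powr_mono2) auto
        then have "norm x powr (l - \<alpha> * P / 2) * norm x powr (\<alpha> * P / 2) \<le> D * norm x powr (\<alpha> * P / 2)"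
          by (rule mult_right_mono) simp
        then have "norm x powr l \<le> D * norm x powr (\<alpha> * P / 2)" by (simp flip: powr_add)
        then have "norm x powr l * \<bar>f x\<bar> powr P \<le> D * norm x powr (\<alpha> * P / 2) * \<bar>f x\<bar> powr P"
          by (rule mult_right_mono) simp
        then show ?thesis by (simp only: mult.assoc)
      next
        case False
        then show ?thesis using test_functionsD(4)[OF f False] by simp
      qed
    qed
    also have "\<dots> = D * (\<integral>x. \<bar>norm x powr (\<alpha> / 2) * f x\<bar> powr P \<partial>lborel)" unfolding e by simp
    also have "\<dots> \<le> D * (C1 * E) powr (P / 2)"
    proof (rule mult_left_mono)
      have "0 \<notin> \<Omega> - {0}" by simp
      from C1(2)[OF C2_compact_test_function[OF f] this]
      show "(\<integral>x. \<bar>norm x powr (\<alpha> / 2) * f x\<bar> powr P \<partial>lborel) \<le> (C1 * E) powr (P / 2)"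
        unfolding Lap_laplacian E_def .
    qed (use D in simp)
    also have "(C1 * E) powr (P / 2) = (sqrt (C1 * E)) powr P"
      using C1(1) E0 by (simp add: powr_half_sqrt[symmetric] powr_powr)
    also have "D = (D powr (1 / P)) powr P" using D P0 by (simp add: powr_powr)
    also have "(D powr (1 / P)) powr P * (sqrt (C1 * E)) powr P = (C * norm_2 \<alpha> \<Omega> f) powr P"
      unfolding nE C_def by (simp add: real_sqrt_mult powr_mult)
    finally show "(\<integral>x. \<bar>f x\<bar> powr P \<partial>weighted_lebesgue l \<Omega>) \<le> (C * norm_2 \<alpha> \<Omega> f) powr P" .
  qed
qed

text \<open>Split the squared norm of \<open>u\<^sub>n\<close> into the energy form of \<open>u\<^sub>n\<close> with \<open>u\<^sub>m\<close> and with \<open>u\<^sub>n - u\<^sub>m\<close>.  For fixed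
  \<open>n\<close> the first part tends to zero as \<open>m\<close> grows, by \<open>energy_eq_integral_test\<close>; the second is at most
  the norm of \<open>u\<^sub>n\<close> times that of \<open>u\<^sub>n - u\<^sub>m\<close>, which is small.\<close>

lemma norm_2_closable:
  fixes \<Omega> :: "'a::euclidean_space set"
  assumes \<Omega>: "open \<Omega>" "\<Omega> \<subseteq> cball 0 R" "R > 0" and l: "l > - real DIM('a)" and P: "P \<ge> 1"
    and u: "u \<in> cauchy_seqs (test_functions (\<Omega> - {0})) (norm_2 \<alpha> \<Omega>)"
    and lim: "(\<lambda>n. \<integral>x. \<bar>u n x\<bar> powr P \<partial>weighted_lebesgue l \<Omega>) \<longlonglongrightarrow> 0"
  shows "(\<lambda>n. norm_2 \<alpha> \<Omega> (u n)) \<longlonglongrightarrow> 0"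
proof -
  interpret seminormed_function_space "test_functions (\<Omega> - {0})" "norm_2 \<alpha> \<Omega>"
    by (rule seminormed_test_functions[OF \<Omega>(1)])
  interpret finite_measure "weighted_lebesgue l \<Omega>" by (rule finite_measure_weighted_lebesgue[OF \<Omega> l])
  note uV = cauchy_seqs_V[OF u]
  have P0: "P > 0" using P by simp
  have m: "u n \<in> borel_measurable (weighted_lebesgue l \<Omega>)" for n
    using borel_imp_weighted_lebesgue[OF borel_measurable_continuous_onI[OF C_k_continuous[OF test_functionsD(1)[OF uV[of n]]]]] by simp
  have "(\<lambda>n. \<integral>x. \<bar>u n x\<bar> powr 1 \<partial>weighted_lebesgue l \<Omega>) \<longlonglongrightarrow> 0"
    by (rule Lq_tendsto_zero_lower_exponent[OF _ P m weighted_lebesgue_integral_test(1)[OF \<Omega>(1) uV P0] lim]) simp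
  then have L1: "(\<lambda>n. \<integral>x. norm x powr l * \<bar>u n x\<bar> powr 1 \<partial>lborel) \<longlonglongrightarrow> 0"
    unfolding weighted_lebesgue_integral_test(3)[OF \<Omega>(1) uV zero_less_one] .
  let ?B = "\<lambda>f g. (\<integral>x. norm x powr \<alpha> * (laplacian f x * laplacian g x) \<partial>lborel)"
  have weak: "(\<lambda>m. ?B (u n) (u m)) \<longlonglongrightarrow> 0" for n
  proof -
    obtain h K where h: "continuous_on UNIV h" "compact K" "K \<subseteq> \<Omega>" "0 \<notin> K" "\<And>x. x \<notin> K \<Longrightarrow> h x = 0"
      "\<And>g. g \<in> test_functions (\<Omega> - {0}) \<Longrightarrow> ?B (u n) g = (\<integral>x. h x * g x \<partial>lborel)"
      using energy_eq_integral_test[OF \<Omega>(1) uV[of n], where \<alpha> = \<alpha>] by blast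
    have c: "continuous_on UNIV (\<lambda>x. norm x powr (- l) * h x)"
      by (rule continuous_on_norm_powr_mult[OF h(1,2,4,5)])
    have z: "norm x powr (- l) * h x = 0" if "x \<notin> K" for x using h(5)[OF that] by simp
    obtain D where D: "D \<ge> 0" "\<And>x. \<bar>norm x powr (- l) * h x\<bar> \<le> D"
      using bounded_compact_support[OF c h(2) z] by blast
    have hD: "\<bar>h x\<bar> \<le> D * norm x powr l" for x
    proof (cases "x = 0")
      case True
      then show ?thesis using h(4,5) by simp
    next
      case False
      then have "\<bar>h x\<bar> = \<bar>norm x powr (- l) * h x\<bar> * norm x powr l"
        by (simp add: abs_mult powr_minus)
      also have "\<dots> \<le> D * norm x powr l" by (rule mult_right_mono[OF D(2)]) simp
      finally show ?thesis .
    qed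
    have "\<bar>?B (u n) (u m)\<bar> \<le> D * (\<integral>x. norm x powr l * \<bar>u m x\<bar> powr 1 \<partial>lborel)" for m
    proof -
      have i: "integrable lborel (\<lambda>x. h x * u m x)"
        by (rule integrable_compact_support[OF _ h(2)])
          (use h(5) in \<open>auto intro!: continuous_on_mult h(1) C_k_continuous[OF test_functionsD(1)[OF uV]]\<close>)
      have "\<bar>?B (u n) (u m)\<bar> = \<bar>\<integral>x. h x * u m x \<partial>lborel\<bar>" by (simp only: h(6)[OF uV])
      also have "\<dots> \<le> (\<integral>x. \<bar>h x * u m x\<bar> \<partial>lborel)" by (rule integral_abs_bound)
      also have "\<dots> \<le> (\<integral>x. D * (norm x powr l * \<bar>u m x\<bar> powr 1) \<partial>lborel)"
      proof (rule integral_mono)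
        show "integrable lborel (\<lambda>x. \<bar>h x * u m x\<bar>)" by (rule integrable_abs[OF i])
        show "integrable lborel (\<lambda>x. D * (norm x powr l * \<bar>u m x\<bar> powr 1))"
          by (intro integrable_mult_right weighted_lebesgue_integral_test(2)[OF \<Omega>(1) uV zero_less_one])
        fix x
        have "\<bar>h x * u m x\<bar> \<le> D * norm x powr l * \<bar>u m x\<bar>"
          unfolding abs_mult by (rule mult_right_mono[OF hD]) simp
        then show "\<bar>h x * u m x\<bar> \<le> D * (norm x powr l * \<bar>u m x\<bar> powr 1)" by (simp add: mult.assoc)
      qed
      finally show ?thesis by simp
    qed
    moreover have "(\<lambda>m. D * (\<integral>x. norm x powr l * \<bar>u m x\<bar> powr 1 \<partial>lborel)) \<longlonglongrightarrow> D * 0"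
      by (intro tendsto_intros L1)
    ultimately show ?thesis
      by (intro Lim_null_comparison[of "\<lambda>m. ?B (u n) (u m)" "\<lambda>m. D * (\<integral>x. norm x powr l * \<bar>u m x\<bar> powr 1 \<partial>lborel)"]) (auto intro!: always_eventually)
  qed
  have lap: "C_k 2 (u n)" for n by (rule test_functionsD(1)[OF uV])
  show ?thesis
  proof (rule LIMSEQ_I)
    fix e :: real assume e: "e > 0"
    then have e2: "e / 2 > 0" by simp
    obtain M where M: "\<And>m n. m \<ge> M \<Longrightarrow> n \<ge> M \<Longrightarrow> norm_2 \<alpha> \<Omega> (\<lambda>x. u m x - u n x) < e / 2"
      using cauchy_seqs_Cauchy[OF u e2] by blast
    have "norm_2 \<alpha> \<Omega> (u n) \<le> e / 2" if n: "n \<ge> M" for n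
    proof -
      define p where "p = norm_2 \<alpha> \<Omega> (u n)"
      have p0: "p \<ge> 0" unfolding p_def by (rule p_nonneg[OF uV])
      have le: "p\<^sup>2 - p * (e / 2) \<le> \<bar>?B (u n) (u m)\<bar>" if m: "m \<ge> M" for m
      proof -
        define d where "d = (\<lambda>x. u n x - u m x)"
        have dV: "d \<in> test_functions (\<Omega> - {0})" unfolding d_def by (rule V_diff[OF uV uV])
        have ld: "laplacian (u n) x = laplacian (u m) x + laplacian d x" for x
        proof -
          have "laplacian (\<lambda>x. u m x + d x) x = laplacian (u m) x + laplacian d x"
            by (rule laplacian_add[OF lap test_functionsD(1)[OF dV]])
          then show ?thesis by (simp add: d_def)
        qed
        note i1 = energy_Cauchy_Schwarz(1)[OF \<Omega>(1) uV uV, of \<alpha>] and i2 = energy_Cauchy_Schwarz(1)[OF \<Omega>(1) uV dV, of \<alpha>]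
        have "p\<^sup>2 = ?B (u n) (u n)" unfolding p_def by (rule norm_2_power2[OF \<Omega>(1) uV])
        also have "\<dots> = (\<integral>x. norm x powr \<alpha> * (laplacian (u n) x * laplacian (u m) x) + norm x powr \<alpha> * (laplacian (u n) x * laplacian d x) \<partial>lborel)"
          by (intro Bochner_Integration.integral_cong refl) (subst (2) ld, simp add: algebra_simps)
        also have "\<dots> = ?B (u n) (u m) + ?B (u n) d" by (rule Bochner_Integration.integral_add[OF i1 i2])
        finally have eq: "p\<^sup>2 = ?B (u n) (u m) + ?B (u n) d" .
        have "\<bar>?B (u n) d\<bar> \<le> p * norm_2 \<alpha> \<Omega> d" unfolding p_def by (rule energy_Cauchy_Schwarz(2)[OF \<Omega>(1) uV dV])
        also have "\<dots> \<le> p * (e / 2)" using M[OF n m] p0 unfolding d_def by (intro mult_left_mono) auto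
        finally show ?thesis using eq by linarith
      qed
      have "p\<^sup>2 - p * (e / 2) \<le> 0"
      proof (rule LIMSEQ_le_const)
        show "(\<lambda>m. \<bar>?B (u n) (u m)\<bar>) \<longlonglongrightarrow> 0" using tendsto_rabs[OF weak[of n]] by simp
        show "\<exists>N. \<forall>m\<ge>N. p\<^sup>2 - p * (e / 2) \<le> \<bar>?B (u n) (u m)\<bar>" using le by blast
      qed
      then have "p * (p - e / 2) \<le> 0" by (simp add: power2_eq_square algebra_simps)
      then show ?thesis using p0 e2 unfolding p_def[symmetric] by (smt (verit) mult_pos_pos)
    qed
    then show "\<exists>no. \<forall>n\<ge>no. norm (norm_2 \<alpha> \<Omega> (u n) - 0) < e"
      using e p_nonneg[OF uV] by (intro exI[of _ M]) (force simp: abs_of_nonneg)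
  qed
qed

lemma C1_compact_mono: "C1_compact S f G \<Longrightarrow> S \<subseteq> T \<Longrightarrow> C1_compact T f G"
  unfolding C1_compact_def by blast

text \<open>Compactness in \<open>L\<^sup>1\<close> is applied to \<open>|x|^(\<alpha>/2) \<phi>\<^sub>n\<close>; dividing by the weight preserves convergence
  almost everywhere.\<close>

lemma norm_2_bounded_AE_subsequence:
  fixes \<Omega> :: "'a::euclidean_space set"
  assumes \<Omega>: "open \<Omega>" "\<Omega> \<subseteq> cball 0 R" "R > 0"
    and N: "4 - real DIM('a) < \<alpha>" "\<alpha> < real DIM('a)"
    and \<phi>: "\<And>n. \<phi> n \<in> test_functions (\<Omega> - {0})" "\<And>n. norm_2 \<alpha> \<Omega> (\<phi> n) \<le> B"
  shows "\<exists>s f. strict_mono (s :: nat \<Rightarrow> nat) \<and> f \<in> borel_measurable borel \<and> (AE x in lebesgue_on \<Omega>. (\<lambda>n. \<phi> (s n) x) \<longlonglongrightarrow> f x)"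
proof -
  define a where "a = \<alpha> / 2"
  define v where "v n x = norm x powr a * \<phi> n x" for n x
  obtain C where C: "\<And>S u G L. C2_compact S u G L \<Longrightarrow> 0 \<notin> (S :: 'a set) \<Longrightarrow> S \<subseteq> cball 0 R \<Longrightarrow>
    (\<exists>G'. C1_compact S (\<lambda>x. norm x powr (\<alpha> / 2) * u x) G' \<and>
    (\<integral>x. \<bar>norm x powr (\<alpha> / 2) * u x\<bar> \<partial>lborel) \<le> C * sqrt (\<integral>x. norm x powr \<alpha> * (Lap L x)\<^sup>2 \<partial>lborel) \<and>
    (\<integral>x. norm (G' x) \<partial>lborel) \<le> C * sqrt (\<integral>x. norm x powr \<alpha> * (Lap L x)\<^sup>2 \<partial>lborel))"
    using weighted_W11_bound[OF N less_imp_le[OF \<Omega>(3)]] by blast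
  have B0: "B \<ge> 0" using \<phi>(2)[of 0] unfolding norm_2_sq(1)[OF \<Omega>(1) \<phi>(1)]
    by (rule order_trans[rotated]) simp
  define A where "A = \<bar>C\<bar> * B"
  have "\<exists>G'. C1_compact (cball 0 R) (v n) G' \<and> (\<integral>x. \<bar>v n x\<bar> \<partial>lborel) \<le> A \<and> (\<integral>x. norm (G' x) \<partial>lborel) \<le> A" for n
  proof -
    have S: "0 \<notin> \<Omega> - {0}" "\<Omega> - {0} \<subseteq> cball 0 R" using \<Omega>(2) by auto
    obtain G' where G': "C1_compact (\<Omega> - {0}) (v n) G'"
      "(\<integral>x. \<bar>v n x\<bar> \<partial>lborel) \<le> C * norm_2 \<alpha> \<Omega> (\<phi> n)" "(\<integral>x. norm (G' x) \<partial>lborel) \<le> C * norm_2 \<alpha> \<Omega> (\<phi> n)"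
      using C[OF C2_compact_test_function[OF \<phi>(1)[of n]] S]
      unfolding Lap_laplacian norm_2_sq(1)[OF \<Omega>(1) \<phi>(1)[of n], symmetric] v_def[abs_def] a_def by blast
    have "norm_2 \<alpha> \<Omega> (\<phi> n) \<ge> 0" unfolding norm_2_sq(1)[OF \<Omega>(1) \<phi>(1)] by simp
    then have "C * norm_2 \<alpha> \<Omega> (\<phi> n) \<le> \<bar>C\<bar> * norm_2 \<alpha> \<Omega> (\<phi> n)" by (intro mult_right_mono) auto
    also have "\<dots> \<le> A" unfolding A_def by (intro mult_left_mono \<phi>(2)) simp
    finally have CA: "C * norm_2 \<alpha> \<Omega> (\<phi> n) \<le> A" .
    show ?thesis
      using C1_compact_mono[OF G'(1) S(2)] order_trans[OF G'(2) CA] order_trans[OF G'(3) CA] by blast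
  qed
  then obtain G' where G': "\<And>n. C1_compact (cball 0 R) (v n) (G' n)" "\<And>n. (\<integral>x. \<bar>v n x\<bar> \<partial>lborel) \<le> A"
      "\<And>n. (\<integral>x. norm (G' n x) \<partial>lborel) \<le> A"
    by metis
  obtain k where k: "strict_mono (k :: nat \<Rightarrow> nat)"
    "\<And>e. e > 0 \<Longrightarrow> \<exists>N. \<forall>m\<ge>N. \<forall>n\<ge>N. (\<integral>x. \<bar>v (k m) x - v (k n) x\<bar> \<partial>lborel) < e"
    using L1_compactness[of R v G' A, OF G'] by blast
  have cv: "continuous_on UNIV (v n)" for n by (rule C1_compactD(3)[OF G'(1)])
  have "\<exists>g\<in>borel_measurable lborel. (\<forall>n. integrable lborel (\<lambda>x. \<bar>v (k n) x - g x\<bar> powr 1)) \<and>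
    (\<lambda>n. \<integral>x. \<bar>v (k n) x - g x\<bar> powr 1 \<partial>lborel) \<longlonglongrightarrow> 0 \<and>
    (\<exists>s. strict_mono s \<and> (AE x in lborel. (\<lambda>n. v (k (s n)) x) \<longlonglongrightarrow> g x))"
  proof (rule Lp_Cauchy_convergent)
    show "v (k n) \<in> borel_measurable lborel" for n using borel_measurable_continuous_onI[OF cv] by simp
    show "integrable lborel (\<lambda>x. \<bar>v (k n) x - v (k m) x\<bar> powr 1)" for n m
      using C1_compact_integrable(1)[OF G'(1)] by simp
    show "\<exists>N. \<forall>n\<ge>N. \<forall>m\<ge>N. (\<integral>x. \<bar>v (k n) x - v (k m) x\<bar> powr 1 \<partial>lborel) < e" if "e > 0" for e
      using k(2)[OF that] by simp
  qed simp
  then obtain g s where g: "g \<in> borel_measurable lborel" and s: "strict_mono (s :: nat \<Rightarrow> nat)"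
      and lim: "AE x in lborel. (\<lambda>n. v (k (s n)) x) \<longlonglongrightarrow> g x"
    by blast
  define f where "f x = norm x powr (- a) * g x" for x
  have mf: "f \<in> borel_measurable borel" unfolding f_def[abs_def] using g by simp
  have "AE x in lborel. x \<noteq> (0::'a)" by (rule AE_lborel_singleton)
  with lim have "AE x in lborel. (\<lambda>n. \<phi> (k (s n)) x) \<longlonglongrightarrow> f x"
  proof eventually_elim
    case (elim x)
    have "norm x powr (- a) * norm x powr a = 1" using elim by (simp add: powr_minus)
    then have "norm x powr (- a) * v n x = \<phi> n x" for n unfolding v_def by (simp flip: mult.assoc)
    moreover have "(\<lambda>n. norm x powr (- a) * v (k (s n)) x) \<longlonglongrightarrow> norm x powr (- a) * g x"
      by (intro tendsto_intros elim)
    ultimately show ?case unfolding f_def by simp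
  qed
  then have "AE x in lebesgue. (\<lambda>n. \<phi> (k (s n)) x) \<longlonglongrightarrow> f x" by (rule AE_completion)
  then have "AE x in lebesgue_on \<Omega>. (\<lambda>n. \<phi> (k (s n)) x) \<longlonglongrightarrow> f x"
    using \<Omega>(1) by (subst AE_restrict_space_iff) (auto elim: eventually_mono)
  moreover have "strict_mono (k \<circ> s)" using k(1) s by (rule strict_mono_o)
  ultimately show ?thesis using mf by (intro exI[of _ "k \<circ> s"] exI[of _ f]) simp
qed

lemma Lq_norm_weighted:
  fixes f :: "'a::euclidean_space \<Rightarrow> real"
  assumes "f \<in> borel_measurable (lebesgue_on \<Omega>)"
  shows "Lq_norm q l \<Omega> f = (\<integral>x. \<bar>f x\<bar> powr q \<partial>weighted_lebesgue l \<Omega>) powr (1 / q)"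
proof -
  have "(\<lambda>x. \<bar>f x\<bar> powr q) \<in> borel_measurable (lebesgue_on \<Omega>)" using assms by measurable
  from weighted_lebesgue_integral(2)[OF this] show ?thesis by (simp add: Lq_norm_def)
qed

lemma Lq_weighted_iff:
  fixes f :: "'a::euclidean_space \<Rightarrow> real"
  assumes q: "q > 0"
  shows "f \<in> Lq_weighted q l \<Omega> \<longleftrightarrow> f \<in> borel_measurable (lebesgue_on \<Omega>) \<and> integrable (weighted_lebesgue l \<Omega>) (\<lambda>x. \<bar>f x\<bar> powr q)"
proof -
  have e: "(norm x powr (l / q) * \<bar>f x\<bar>) powr q = norm x powr l * \<bar>f x\<bar> powr q" for x
    using q by (simp add: powr_mult powr_powr)
  have "integrable (weighted_lebesgue l \<Omega>) (\<lambda>x. \<bar>f x\<bar> powr q) \<longleftrightarrow> integrable (lebesgue_on \<Omega>) (\<lambda>x. norm x powr l * \<bar>f x\<bar> powr q)"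
    if "f \<in> borel_measurable (lebesgue_on \<Omega>)"
  proof (rule weighted_lebesgue_integral(1))
    show "(\<lambda>x. \<bar>f x\<bar> powr q) \<in> borel_measurable (lebesgue_on \<Omega>)" using that by measurable
  qed
  then show ?thesis unfolding Lq_weighted_def e mem_Collect_eq by (rule conj_cong[OF refl, symmetric])
qed

text \<open>The same map, the limit in \<open>L^P\<close>, serves for all exponents.\<close>

theorem weighted_Sobolev_embedding:
  fixes \<Omega> :: "'a::euclidean_space set"
  assumes N5: "DIM('a) \<ge> 5" and P: "P = 2 * real DIM('a) / (real DIM('a) - 4)"
    and \<alpha>: "4 - real DIM('a) < \<alpha>" "\<alpha> < real DIM('a)" and l: "l > - real DIM('a)" "\<alpha> * P / 2 \<le> l"
    and \<Omega>: "open \<Omega>" "bounded \<Omega>"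
  shows "1 \<le> q \<and> q \<le> P \<Longrightarrow> continuously_embedded \<alpha> l q \<Omega>"
    and "1 \<le> q \<and> q < P \<Longrightarrow> compactly_embedded \<alpha> l q \<Omega>"
proof -
  obtain R where R: "R > 0" "\<Omega> \<subseteq> cball 0 R"
    using \<Omega>(2) unfolding bounded_pos by (auto simp: subset_iff)
  let ?V = "test_functions (\<Omega> - {0})" and ?p = "norm_2 \<alpha> \<Omega>" and ?M = "weighted_lebesgue l \<Omega>"
  have P1: "P \<ge> 1" using N5 by (simp add: P field_simps)
  have P0: "P > 0" using P1 by simp
  obtain C where C: "C \<ge> 0" "\<And>f. f \<in> ?V \<Longrightarrow> (\<integral>x. \<bar>f x\<bar> powr P \<partial>?M) \<le> (C * ?p f) powr P"
    using test_function_weighted_Sobolev[OF \<Omega>(1) R(2,1) \<alpha> N5 P l(2)] by blast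
  interpret seminormed_function_space ?V ?p by (rule seminormed_test_functions[OF \<Omega>(1)])
  interpret finite_measure ?M by (rule finite_measure_weighted_lebesgue[OF \<Omega>(1) R(2,1) l(1)])
  interpret closable_embedding ?V ?p ?M P C
  proof
    show "1 \<le> P" by (rule P1)
    show "0 \<le> C" by (rule C(1))
    fix f assume f: "f \<in> ?V"
    show "f \<in> borel_measurable ?M"
      using borel_imp_weighted_lebesgue[OF borel_measurable_continuous_onI[OF C_k_continuous[OF test_functionsD(1)[OF f]]]] by simp
    show "integrable ?M (\<lambda>x. \<bar>f x\<bar> powr P)" by (rule weighted_lebesgue_integral_test(1)[OF \<Omega>(1) f P0])
    show "(\<integral>x. \<bar>f x\<bar> powr P \<partial>?M) \<le> (C * ?p f) powr P" by (rule C(2)[OF f])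
  next
    show "(\<lambda>n. ?p (u n)) \<longlonglongrightarrow> 0" if "u \<in> cauchy_seqs ?V ?p" "(\<lambda>n. \<integral>x. \<bar>u n x\<bar> powr P \<partial>?M) \<longlonglongrightarrow> 0" for u
      by (rule norm_2_closable[OF \<Omega>(1) R(2,1) l(1) P1 that])
  qed
  note AE = AE_weighted_lebesgue[OF \<Omega>(1), where l = l]
  have mE: "embed X \<in> borel_measurable (lebesgue_on \<Omega>)" if "X \<in> D0 \<alpha> \<Omega>" for X
    using embed_measurable that unfolding D0_def by simp
  have emb: "continuous_embedding \<alpha> l q \<Omega> embed" if q: "1 \<le> q" "q \<le> P" for q
    unfolding continuous_embedding_def Let_def
  proof (intro conjI ballI allI impI)
    have q0: "q > 0" using q by simp
    show "embed X \<in> Lq_weighted q l \<Omega>" if "X \<in> D0 \<alpha> \<Omega>" for X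
      unfolding Lq_weighted_iff[OF q0] using mE[OF that] embed_lower_exponent(1)[OF _ q] that unfolding D0_def by blast
    show "AE x in lebesgue_on \<Omega>. embed (compl_of ?V ?p \<phi>) x = \<phi> x" if "\<phi> \<in> ?V" for \<phi>
      using embed_compl_of[OF that] unfolding AE .
    show "AE x in lebesgue_on \<Omega>. embed (compl_add ?V ?p X Y) x = embed X x + embed Y x"
      if "X \<in> D0 \<alpha> \<Omega>" "Y \<in> D0 \<alpha> \<Omega>" for X Y
      using embed_add[OF that[unfolded D0_def]] unfolding AE .
    show "AE x in lebesgue_on \<Omega>. embed (compl_scale ?V ?p c X) x = c * embed X x" if "X \<in> D0 \<alpha> \<Omega>" for c X
      using embed_scale[OF that[unfolded D0_def]] unfolding AE .
    show "X = Y" if "X \<in> D0 \<alpha> \<Omega>" "Y \<in> D0 \<alpha> \<Omega>" "AE x in lebesgue_on \<Omega>. embed X x = embed Y x" for X Y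
      by (rule embed_inj[OF that(1,2)[unfolded D0_def]]) (use that(3) in \<open>simp add: AE\<close>)
    show "\<exists>C. \<forall>X\<in>D0 \<alpha> \<Omega>. Lq_norm q l \<Omega> (embed X) \<le> C * compl_norm ?p X"
    proof (intro exI ballI)
      fix X assume X: "X \<in> D0 \<alpha> \<Omega>"
      show "Lq_norm q l \<Omega> (embed X) \<le> ((measure ?M (space ?M) + 1) powr (1 / q) * C) * compl_norm ?p X"
        unfolding Lq_norm_weighted[OF mE[OF X]] by (rule embed_lower_exponent(2)[OF X[unfolded D0_def] q])
    qed
  qed
  show "continuously_embedded \<alpha> l q \<Omega>" if "1 \<le> q \<and> q \<le> P"
    unfolding continuously_embedded_def using emb that by blast
  show "compactly_embedded \<alpha> l q \<Omega>" if q: "1 \<le> q \<and> q < P"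
    unfolding compactly_embedded_def
  proof (intro exI conjI)
    have q0: "q > 0" using q by simp
    show "continuous_embedding \<alpha> l q \<Omega> embed" using emb q by simp
    show "compact_map \<alpha> l q \<Omega> embed"
      unfolding compact_map_def
    proof (intro allI impI)
      fix X B assume X: "\<forall>n::nat. X n \<in> D0 \<alpha> \<Omega> \<and> compl_norm ?p (X n) \<le> B"
      have "\<exists>s f. strict_mono (s :: nat \<Rightarrow> nat) \<and> f \<in> borel_measurable ?M \<and> integrable ?M (\<lambda>x. \<bar>f x\<bar> powr q) \<and>
          (\<lambda>n. \<integral>x. \<bar>embed (X (s n)) x - f x\<bar> powr q \<partial>?M) \<longlonglongrightarrow> 0"
      proof (rule embed_compact)
        show "X n \<in> completion ?V ?p" "compl_norm ?p (X n) \<le> B" for n using X unfolding D0_def by auto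
        show "\<exists>s f. strict_mono (s :: nat \<Rightarrow> nat) \<and> f \<in> borel_measurable ?M \<and> (AE x in ?M. (\<lambda>n. \<phi> (s n) x) \<longlonglongrightarrow> f x)"
          if \<phi>: "\<And>n. \<phi> n \<in> ?V" "\<And>n. ?p (\<phi> n) \<le> B'" for \<phi> B'
        proof -
          obtain s f where sf: "strict_mono (s :: nat \<Rightarrow> nat)" "f \<in> borel_measurable borel" "AE x in lebesgue_on \<Omega>. (\<lambda>n. \<phi> (s n) x) \<longlonglongrightarrow> f x"
            using norm_2_bounded_AE_subsequence[of \<Omega> R \<alpha> \<phi> B', OF \<Omega>(1) R(2,1) \<alpha> \<phi>] by blast
          have "f \<in> borel_measurable ?M" using borel_imp_weighted_lebesgue[OF sf(2)] by simp
          with sf(1,3) show ?thesis unfolding AE by (intro exI[of _ s] exI[of _ f] conjI)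
        qed
      qed (use q in auto)
      then obtain s f where s: "strict_mono (s :: nat \<Rightarrow> nat)" and f: "f \<in> borel_measurable ?M" "integrable ?M (\<lambda>x. \<bar>f x\<bar> powr q)"
          and lim: "(\<lambda>n. \<integral>x. \<bar>embed (X (s n)) x - f x\<bar> powr q \<partial>?M) \<longlonglongrightarrow> 0"
        by blast
      have mf: "f \<in> borel_measurable (lebesgue_on \<Omega>)" using f(1) by simp
      have md: "(\<lambda>x. embed (X (s n)) x - f x) \<in> borel_measurable (lebesgue_on \<Omega>)" for n
        using mE X mf by (intro borel_measurable_diff) auto
      have "(\<lambda>n. (\<integral>x. \<bar>embed (X (s n)) x - f x\<bar> powr q \<partial>?M) powr (1 / q)) \<longlonglongrightarrow> 0 powr (1 / q)"
        using q0 by (intro tendsto_powr' lim tendsto_const) auto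
      then have "(\<lambda>n. Lq_norm q l \<Omega> (\<lambda>x. embed (X (s n)) x - f x)) \<longlonglongrightarrow> 0"
        unfolding Lq_norm_weighted[OF md] by simp
      moreover have "f \<in> Lq_weighted q l \<Omega>" unfolding Lq_weighted_iff[OF q0] using mf f(2) by blast
      ultimately show "\<exists>s f. strict_mono (s :: nat \<Rightarrow> nat) \<and> f \<in> Lq_weighted q l \<Omega> \<and>
          (\<lambda>n. Lq_norm q l \<Omega> (\<lambda>x. embed (X (s n)) x - f x)) \<longlonglongrightarrow> 0"
        using s by blast
    qed
  qed
qed

theorem proposition1p6:
  fixes N :: nat and \<alpha> l N' \<tau> :: real and \<Omega> :: "(real ^ 'n) set"
  assumes "CARD('n) = N" and "N \<ge> 5"
    and "N' = real N + \<alpha>" and "\<tau> = l - \<alpha>"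
    and "2 * real N > N'" and "N' > 4" and "\<tau> > -4" and "\<alpha> < (real N - 4) / 4 * \<tau>"
    and "bounded_C2_domain \<Omega>" and "\<nexists>a r. \<Omega> = ball a r" and "0 \<in> \<Omega>"
  shows "(\<forall>q. 1 \<le> q \<and> q \<le> 2 * real N / (real N - 4) \<longrightarrow> continuously_embedded \<alpha> l q \<Omega>) \<and>
         (\<forall>q. 1 \<le> q \<and> q < 2 * real N / (real N - 4) \<longrightarrow> compactly_embedded \<alpha> l q \<Omega>)"
proof -
  have dim: "DIM(real ^ 'n) = N" using assms(1) by simp
  define P where "P = 2 * real N / (real N - 4)"
  have \<Omega>: "open \<Omega>" "bounded \<Omega>" using assms(9) by (auto simp: bounded_C2_domain_def)
  have N4: "real N - 4 > 0" using assms(2) by simp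
  have "\<alpha> * 4 < (real N - 4) * \<tau>" using assms(8) by (simp add: field_simps)
  then have "\<alpha> * 4 < (real N - 4) * (l - \<alpha>)" unfolding assms(4) .
  then have "\<alpha> * real N \<le> l * (real N - 4)" by (simp add: algebra_simps)
  then have lP: "\<alpha> * P / 2 \<le> l" using N4 by (simp add: P_def field_simps)
  note E = weighted_Sobolev_embedding[where 'a = "real ^ 'n", unfolded dim, OF assms(2) P_def _ _ _ lP \<Omega>]
  show ?thesis
    using E assms(3-7) by (auto simp: P_def)
qed

end
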